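(* Let $M$ be an oriented smooth manifold of dimension $n\ge 1$ and $x_0\in M$. Let $\varphi=\nu^{-1}\varphi_{-1}+\varphi_0+\nu\varphi_1+\dots$ be a (complex) formal phase function on $M$ such that $x_0$ is a nondegenerate critical point of $\varphi_{-1}$ with zero critical value, $\varphi_{-1}(x_0)=0$, and let $\rho=\rho_0+\nu\rho_1+\dots$ be a formal volume form on $M$ such that $\rho_0$ does not vanish at $x_0$. Then: (1) there exists a formal oscillatory integral (FOI) $\Lambda$ at $x_0$ strongly associated with the pair $(\varphi,\rho)$, and it is determined up to a nonzero multiplicative constant from $\mathbb{C}$; (2) in particular, there is a unique FOI $\Lambda$ strongly associated with $(\varphi,\rho)$ whose leading term is $\Lambda_0=\delta_{x_0}$; (3) if a FOI $\Lambda$ strongly associated with $(\varphi,\rho)$ is also strongly associated with another pair $(\hat\varphi,\rho)$ (with the same $\rho$), then the full jet of $\varphi-\hat\varphi$ at $x_0$ is a constant from $\mathbb{C}$ (i.e. equals the full jet of a constant function with value in $\mathbb{C}$, independent of $\nu$).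
   Context: For a vector space $V$, $V((\nu))$ denotes the space of formal Laurent series $\nu^kv_k+\nu^{k+1}v_{k+1}+\dots$, $k\in\mathbb{Z}$, $v_r\in V$. Functions are complex-valued. $\delta_{x_0}(f)=f(x_0)$. A pair at $x_0$ always means $(\varphi,\rho)$ with $\varphi=\nu^{-1}\varphi_{-1}+\varphi_0+\dots$ a formal function such that $x_0$ is a nondegenerate critical point of $\varphi_{-1}$ with $\varphi_{-1}(x_0)=0$, and $\rho=\rho_0+\nu\rho_1+\dots$ a formal (complex) volume form with $\rho_0(x_0)\neq0$. A formal distribution supported at $x_0$ is $\Lambda=\Lambda_0+\nu\Lambda_1+\dots$, where each $\Lambda_r$ is a distribution supported at $x_0$ (in local coordinates, a finite linear combination of partial derivatives evaluated at $x_0$), extended $\nu$-linearly to $C^\infty(M)((\nu))$. A FOI at $x_0$ associated with the pair $(\varphi,\rho)$ is a formal distribution $\Lambda=\Lambda_0+\nu\Lambda_1+\dots$ supported at $x_0$ such that $\Lambda_0\ne0$ and $$\Lambda\big(vf+(v\varphi+\mathrm{div}_\rho v)f\big)=0$$ for every vector field $v$ and every function $f$ on $M$, where $\mathrm{div}_\rho v=(\mathbb{L}_v\rho)/\rho$ and $\mathbb{L}_v$ is the Lie derivative. On a coordinate chart $U$ around $x_0$ (shrunk if necessary) write $\rho=e^u\,dx^1\wedge\dots\wedge dx^n$ with $u\in C^\infty(U)[[\nu]]$; the derivative $du/d\nu$ does not depend on the choice of coordinates. A FOI $\Lambda$ associated with $(\varphi,\rho)$ is strongly associated with $(\varphi,\rho)$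 if for all formal functions $f\in C^\infty(U)((\nu))$ $$\frac{d}{d\nu}\Lambda(f)-\Lambda\left(\frac{df}{d\nu}+\left(\frac{d(\varphi+u)}{d\nu}-\frac{n}{2\nu}\right)f\right)=0 .$$ The full jet at $x_0$ of a formal function is the formal series of the infinite-order jets (Taylor series) at $x_0$ of its coefficients. *)

theory Defs
  imports
    "HOL-Analysis.Analysis"
    "HOL-Computational_Algebra.Formal_Laurent_Series"
    "HOL-Library.Function_Algebras"
begin

unbundle fps_syntax

(* Pointwise operations on functions (Function_Algebras) make ('m => complex) a commutative ring,
   so that formal functions on M are elements of ('m => complex) fls (resp. fps), the formal
   variable nu being fls_X, and d/dnu being fls_deriv. *)


section \<open>Smooth functions on open subsets of Euclidean space\<close>

definition pd :: "'n::finite \<Rightarrow> (real^'n \<Rightarrow> 'b::real_normed_vector) \<Rightarrow> real^'n \<Rightarrow> 'b" where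
  "pd i g = (\<lambda>x. frechet_derivative g (at x) (axis i 1))"

primrec pds :: "'n::finite list \<Rightarrow> (real^'n \<Rightarrow> 'b::real_normed_vector) \<Rightarrow> real^'n \<Rightarrow> 'b" where
  "pds [] g = g"
| "pds (i # is) g = pd i (pds is g)"

(* meant for open S *)
definition smooth_map_on :: "(real^'n::finite) set \<Rightarrow> (real^'n \<Rightarrow> 'b::real_normed_vector) \<Rightarrow> bool" where
  "smooth_map_on S g \<longleftrightarrow> (\<forall>is. \<forall>x\<in>S. pds is g differentiable (at x))"


section \<open>Oriented manifolds\<close>

(* A chart is a pair of a domain and a coordinate map; the map is only relevant on the domain. *)
type_synonym ('m, 'n) chart = "'m set \<times> ('m \<Rightarrow> real^'n)"

definition chart_inv :: "('m, 'n::finite) chart \<Rightarrow> real^'n \<Rightarrow> 'm" where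
  "chart_inv c = inv_into (fst c) (snd c)"

definition jac :: "('m, 'n::finite) chart \<Rightarrow> ('m, 'n) chart \<Rightarrow> 'm \<Rightarrow> real^'n^'n" where
  "jac c c' p = matrix (frechet_derivative (snd c' \<circ> chart_inv c) (at (snd c p)))"

(* The manifold is the whole type 'm, its dimension is CARD('n); the smooth structure and the
   orientation are given by an atlas whose transition maps preserve the orientation. *)
definition oriented_atlas ::
    "('m::{t2_space, second_countable_topology}, 'n::finite) chart set \<Rightarrow> bool" where
  "oriented_atlas A \<longleftrightarrow>
     (\<Union>c\<in>A. fst c) = UNIV \<and>
     (\<forall>c\<in>A. open (fst c) \<and> open (snd c ` fst c) \<and>
        homeomorphism (fst c) (snd c ` fst c) (snd c) (chart_inv c)) \<and>
     (\<forall>c\<in>A. \<forall>c'\<in>A. smooth_map_on (snd c ` (fst c \<inter> fst c')) (snd c' \<circ> chart_inv c)) \<and>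
     (\<forall>c\<in>A. \<forall>c'\<in>A. \<forall>p\<in>fst c \<inter> fst c'. det (jac c c' p) > 0)"

definition chart_pds ::
    "('m, 'n::finite) chart \<Rightarrow> 'n list \<Rightarrow> ('m \<Rightarrow> 'b::real_normed_vector) \<Rightarrow> 'm \<Rightarrow> 'b" where
  "chart_pds c is f p = pds is (f \<circ> chart_inv c) (snd c p)"

(* meant for open W *)
definition smooth_fun_on ::
    "('m::topological_space, 'n::finite) chart set \<Rightarrow> 'm set \<Rightarrow>
     ('m \<Rightarrow> 'b::real_normed_vector) \<Rightarrow> bool" where
  "smooth_fun_on A W f \<longleftrightarrow>
     (\<forall>c\<in>A. smooth_map_on (snd c ` (fst c \<inter> W)) (f \<circ> chart_inv c))"

definition smooth_near ::
    "('m::topological_space, 'n::finite) chart set \<Rightarrow> 'm \<Rightarrow> ('m \<Rightarrow> 'b::real_normed_vector) \<Rightarrow> bool"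
  where "smooth_near A x f \<longleftrightarrow> (\<exists>W. open W \<and> x \<in> W \<and> smooth_fun_on A W f)"

definition chart_at :: "('m, 'n::finite) chart set \<Rightarrow> 'm \<Rightarrow> ('m, 'n) chart" where
  "chart_at A p = (SOME c. c \<in> A \<and> p \<in> fst c)"


section \<open>Vector fields\<close>

(* Components with respect to the coordinate frame of every chart of the atlas. *)
type_synonym ('m, 'n) vfield = "('m, 'n) chart \<Rightarrow> 'm \<Rightarrow> complex^'n"

definition vector_field ::
    "('m::topological_space, 'n::finite) chart set \<Rightarrow> ('m, 'n) vfield \<Rightarrow> bool" where
  "vector_field A v \<longleftrightarrow>
     (\<forall>c\<in>A. smooth_fun_on A (fst c) (v c)) \<and>
     (\<forall>c\<in>A. \<forall>c'\<in>A. \<forall>p\<in>fst c \<inter> fst c'.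
        v c' p = map_matrix complex_of_real (jac c c' p) *v v c p)"

definition dir_deriv ::
    "('m, 'n::finite) chart \<Rightarrow> ('m \<Rightarrow> complex^'n) \<Rightarrow> ('m \<Rightarrow> complex) \<Rightarrow> 'm \<Rightarrow> complex" where
  "dir_deriv c w f p = (\<Sum>i\<in>UNIV. w p $ i * chart_pds c [i] f p)"

(* vf; by the transformation law of v the value does not depend on the chart around p. *)
definition vf_apply ::
    "('m, 'n::finite) chart set \<Rightarrow> ('m, 'n) vfield \<Rightarrow> ('m \<Rightarrow> complex) \<Rightarrow> 'm \<Rightarrow> complex" where
  "vf_apply A v f p = dir_deriv (chart_at A p) (v (chart_at A p)) f p"

definition vf_apply_fls ::
    "('m, 'n::finite) chart set \<Rightarrow> ('m, 'n) vfield \<Rightarrow> ('m \<Rightarrow> complex) fls \<Rightarrow> ('m \<Rightarrow> complex) fls"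
  where "vf_apply_fls A v F = Abs_fls (\<lambda>k. vf_apply A v (F $$ k))"

lemma chart_pds_zero: "chart_pds c [i] (0 :: 'm \<Rightarrow> complex) p = 0"
proof -
  have "(0 :: 'm \<Rightarrow> complex) \<circ> chart_inv c = (\<lambda>_. 0)"
    by (auto simp: fun_eq_iff)
  then show ?thesis
    by (simp add: chart_pds_def pd_def)
qed

lemma vf_apply_fls_nth: "vf_apply_fls A v F $$ k = vf_apply A v (F $$ k)"
proof -
  have "vf_apply A v 0 = 0"
    by (simp add: vf_apply_def dir_deriv_def chart_pds_zero fun_eq_iff)
  then have "\<forall>j<fls_subdegree F. vf_apply A v (F $$ j) = 0"
    by simp
  then show ?thesis
    unfolding vf_apply_fls_def by (intro nth_Abs_fls_ex_lower_bound) blast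
qed


section \<open>Formal volume forms and divergence\<close>

(* A form r dx^1 ... dx^n of top degree is given by its coefficient r in every chart. *)
type_synonym ('m, 'n) top_form = "('m, 'n) chart \<Rightarrow> 'm \<Rightarrow> complex"

definition top_form ::
    "('m::topological_space, 'n::finite) chart set \<Rightarrow> ('m, 'n) top_form \<Rightarrow> bool" where
  "top_form A \<omega> \<longleftrightarrow>
     (\<forall>c\<in>A. smooth_fun_on A (fst c) (\<omega> c)) \<and>
     (\<forall>c\<in>A. \<forall>c'\<in>A. \<forall>p\<in>fst c \<inter> fst c'.
        \<omega> c p = complex_of_real (det (jac c c' p)) * \<omega> c' p)"

(* (r dx^1 ... dx^n) (w_1, ..., w_n), with vector fields given by their components *)
definition form_eval ::
    "('m \<Rightarrow> complex) \<Rightarrow> ('n::finite \<Rightarrow> 'm \<Rightarrow> complex^'n) \<Rightarrow> 'm \<Rightarrow> complex" where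
  "form_eval r w p = r p * det (\<chi> k. w k p)"

definition lie_bracket ::
    "('m, 'n::finite) chart \<Rightarrow> ('m \<Rightarrow> complex^'n) \<Rightarrow> ('m \<Rightarrow> complex^'n) \<Rightarrow> 'm \<Rightarrow> complex^'n" where
  "lie_bracket c v w p =
     (\<chi> j. dir_deriv c v (\<lambda>q. w q $ j) p - dir_deriv c w (\<lambda>q. v q $ j) p)"

definition coord_frame :: "'n::finite \<Rightarrow> 'm \<Rightarrow> complex^'n" where
  "coord_frame k p = axis k 1"

(* (L_v \<omega>)(w_1, ..., w_n) = v (\<omega>(w_1, ..., w_n)) - (\<Sum>i. \<omega>(w_1, ..., [v, w_i], ..., w_n))
   on the coordinate frame, which gives the coefficient of L_v \<omega> in the chart. *)
definition lie_form :: "('m, 'n::finite) vfield \<Rightarrow> ('m, 'n) top_form \<Rightarrow> ('m, 'n) top_form" where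
  "lie_form v \<omega> c p =
     dir_deriv c (v c) (form_eval (\<omega> c) (coord_frame :: 'n \<Rightarrow> 'm \<Rightarrow> complex^'n)) p -
     (\<Sum>i\<in>UNIV. form_eval (\<omega> c) (coord_frame(i := lie_bracket c (v c) (coord_frame i))) p)"

(* A formal form of top degree is a power series in nu with such forms as coefficients;
   this is the value at p of its coefficient in the chart c. *)
definition form_at :: "('m, 'n) top_form fps \<Rightarrow> ('m, 'n) chart \<Rightarrow> 'm \<Rightarrow> complex fps" where
  "form_at \<rho> c p = Abs_fps (\<lambda>r. (\<rho> $ r) c p)"

(* The quotient of L_v \<rho> by \<rho>, pointwise in \<complex>[[nu]]. It is meaningful where \<rho>_0 does not vanish,
   in particular in a neighbourhood of x0, and there independent of the chart. *)
definition divergence ::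
    "('m, 'n::finite) chart set \<Rightarrow> ('m, 'n) top_form fps \<Rightarrow> ('m, 'n) vfield \<Rightarrow> ('m \<Rightarrow> complex) fps" where
  "divergence A \<rho> v =
     Abs_fps (\<lambda>r p. (form_at (Abs_fps (\<lambda>s. lie_form v (\<rho> $ s))) (chart_at A p) p /
                     form_at \<rho> (chart_at A p) p) $ r)"


section \<open>Pairs\<close>

definition nondegenerate_critical ::
    "('m, 'n::finite) chart set \<Rightarrow> ('m \<Rightarrow> complex) \<Rightarrow> 'm \<Rightarrow> bool" where
  "nondegenerate_critical A f x \<longleftrightarrow>
     (\<forall>c\<in>A. x \<in> fst c \<longrightarrow>
        (\<forall>i. chart_pds c [i] f x = 0) \<and>
        det (\<chi> i j. chart_pds c [i, j] f x) \<noteq> 0)"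

definition formal_phase ::
    "('m::topological_space, 'n::finite) chart set \<Rightarrow> 'm \<Rightarrow> ('m \<Rightarrow> complex) fls \<Rightarrow> bool" where
  "formal_phase A x\<^sub>0 \<phi> \<longleftrightarrow>
     (\<forall>k. smooth_fun_on A UNIV (\<phi> $$ k)) \<and> (\<forall>k < -1. \<phi> $$ k = 0) \<and>
     nondegenerate_critical A (\<phi> $$ (-1)) x\<^sub>0 \<and> (\<phi> $$ (-1)) x\<^sub>0 = 0"

definition formal_volume ::
    "('m::topological_space, 'n::finite) chart set \<Rightarrow> 'm \<Rightarrow> ('m, 'n) top_form fps \<Rightarrow> bool" where
  "formal_volume A x\<^sub>0 \<rho> \<longleftrightarrow>
     (\<forall>r. top_form A (\<rho> $ r)) \<and> (\<forall>c\<in>A. x\<^sub>0 \<in> fst c \<longrightarrow> (\<rho> $ 0) c x\<^sub>0 \<noteq> 0)"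


section \<open>Formal distributions supported at a point\<close>

(* A distribution supported at x0 acts on all functions that are smooth near x0. In order that
   equality of functionals be equality of distributions, the value is 0 on all other arguments. *)
definition point_distribution ::
    "('m::topological_space, 'n::finite) chart set \<Rightarrow> 'm \<Rightarrow> (('m \<Rightarrow> complex) \<Rightarrow> complex) \<Rightarrow> bool" where
  "point_distribution A x\<^sub>0 L \<longleftrightarrow>
     (\<exists>c\<in>A. x\<^sub>0 \<in> fst c \<and>
        (\<exists>I (a :: 'n list \<Rightarrow> complex). finite I \<and>
           (\<forall>f. L f = (if smooth_near A x\<^sub>0 f then \<Sum>is\<in>I. a is * chart_pds c is f x\<^sub>0 else 0))))"

definition delta ::
    "('m::topological_space, 'n::finite) chart set \<Rightarrow> 'm \<Rightarrow> ('m \<Rightarrow> complex) \<Rightarrow> complex" where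
  "delta A x\<^sub>0 f = (if smooth_near A x\<^sub>0 f then f x\<^sub>0 else 0)"

(* The family \<Lambda> stands for \<Lambda> 0 + nu \<Lambda> 1 + nu^2 \<Lambda> 2 + ... *)
type_synonym 'm formal_distribution = "nat \<Rightarrow> ('m \<Rightarrow> complex) \<Rightarrow> complex"

(* The nu-linear extension: (\<Sum>r. nu^r \<Lambda>_r)(\<Sum>k. nu^k f_k) = \<Sum>k. nu^k (\<Sum>r. \<Lambda>_r(f_(k-r))) *)
definition fd_apply :: "'m formal_distribution \<Rightarrow> ('m \<Rightarrow> complex) fls \<Rightarrow> complex fls" where
  "fd_apply \<Lambda> F =
     Abs_fls (\<lambda>k. \<Sum>r | fls_subdegree F + int r \<le> k. \<Lambda> r (F $$ (k - int r)))"

lemma fd_apply_nth: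
  "fd_apply \<Lambda> F $$ k = (\<Sum>r | fls_subdegree F + int r \<le> k. \<Lambda> r (F $$ (k - int r)))"
  unfolding fd_apply_def
proof (intro nth_Abs_fls_ex_lower_bound exI allI impI)
  fix j assume "j < fls_subdegree F"
  then have "{r. fls_subdegree F + int r \<le> j} = {}"
    by auto
  then show "(\<Sum>r | fls_subdegree F + int r \<le> j. \<Lambda> r (F $$ (j - int r))) = 0"
    by simp
qed


section \<open>Formal oscillatory integrals\<close>

definition foi ::
    "('m::topological_space, 'n::finite) chart set \<Rightarrow> 'm \<Rightarrow>
     ('m \<Rightarrow> complex) fls \<Rightarrow> ('m, 'n) top_form fps \<Rightarrow> 'm formal_distribution \<Rightarrow> bool" where
  "foi A x\<^sub>0 \<phi> \<rho> \<Lambda> \<longleftrightarrow>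
     (\<forall>r. point_distribution A x\<^sub>0 (\<Lambda> r)) \<and> \<Lambda> 0 \<noteq> 0 \<and>
     (\<forall>v f. vector_field A v \<longrightarrow> smooth_fun_on A UNIV f \<longrightarrow>
        fd_apply \<Lambda> (fls_const (vf_apply A v f) +
          (vf_apply_fls A v \<phi> + fps_to_fls (divergence A \<rho> v)) * fls_const f) = 0)"

(* exp on \<complex>[[nu]] *)
definition formal_exp :: "complex fps \<Rightarrow> complex fps" where
  "formal_exp a = fps_const (exp (a $ 0)) * (fps_exp 1 oo (a - fps_const (a $ 0)))"

(* \<rho> = e^u dx^1 ... dx^n on the open subset W of the domain of the chart c, with u in
   C^infinity(W)[[nu]] *)
definition log_density ::
    "('m::topological_space, 'n::finite) chart set \<Rightarrow> ('m, 'n) top_form fps \<Rightarrow>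
     ('m, 'n) chart \<Rightarrow> 'm set \<Rightarrow> ('m \<Rightarrow> complex) fps \<Rightarrow> bool" where
  "log_density A \<rho> c W u \<longleftrightarrow>
     c \<in> A \<and> open W \<and> W \<subseteq> fst c \<and> (\<forall>r. smooth_fun_on A W (u $ r)) \<and>
     (\<forall>p\<in>W. form_at \<rho> c p = formal_exp (Abs_fps (\<lambda>r. (u $ r) p)))"

(* fls_const (\<lambda>_. n/2) * fls_X_inv is n/(2 nu), where n = CARD('n) *)
definition strongly_associated ::
    "('m::topological_space, 'n::finite) chart set \<Rightarrow> 'm \<Rightarrow>
     ('m \<Rightarrow> complex) fls \<Rightarrow> ('m, 'n) top_form fps \<Rightarrow> 'm formal_distribution \<Rightarrow> bool" where
  "strongly_associated A x\<^sub>0 \<phi> \<rho> \<Lambda> \<longleftrightarrow>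
     foi A x\<^sub>0 \<phi> \<rho> \<Lambda> \<and>
     (\<exists>c W u. x\<^sub>0 \<in> W \<and> log_density A \<rho> c W u \<and>
        (\<forall>f. (\<forall>k. smooth_fun_on A W (f $$ k)) \<longrightarrow>
           fls_deriv (fd_apply \<Lambda> f) -
           fd_apply \<Lambda> (fls_deriv f +
             (fls_deriv (\<phi> + fps_to_fls u) -
              fls_const (\<lambda>_. of_nat CARD('n) / 2) * fls_X_inv) * f) = 0))"


section \<open>Full jets\<close>

(* The jet of infinite order at x of a function, by means of its partial derivatives in the
   chart c around x. *)
definition jet :: "('m, 'n::finite) chart \<Rightarrow> 'm \<Rightarrow> ('m \<Rightarrow> complex) \<Rightarrow> 'n list \<Rightarrow> complex" where
  "jet c x f = (\<lambda>is. chart_pds c is f x)"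

definition full_jet ::
    "('m, 'n::finite) chart \<Rightarrow> 'm \<Rightarrow> ('m \<Rightarrow> complex) fls \<Rightarrow> int \<Rightarrow> 'n list \<Rightarrow> complex" where
  "full_jet c x F = (\<lambda>k. jet c x (F $$ k))"

end

theory Submission
  imports Defs
begin

text \<open>
  All conditions concern germs at \<open>x\<^sub>0\<close> only, so the proof takes place in one chart \<open>c\<close>, on an open
  set \<open>W\<close> on which \<open>\<rho> = e\<^sup>u dx\<close>. Let \<open>D\<^sub>i\<close> be the coordinate derivatives and write
  \<open>\<phi> = \<psi>/\<nu> + \<phi>\<^sub>0 + \<nu> \<phi>\<^sub>1 + \<dots>\<close> with \<open>\<psi> = \<phi>\<^sub>-\<^sub>1\<close>. Testing with the vector fields \<open>w \<partial>\<^sub>i\<close>, the condition that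
  \<open>\<Lambda>\<close> be a FOI becomes \<open>\<Lambda>(D\<^sub>i w + B\<^sub>i w) = 0\<close> with \<open>B\<^sub>i = D\<^sub>i \<phi> + (D\<^sub>i \<rho>)/\<rho>\<close>, and strong association
  becomes \<open>d\<Lambda>(F)/d\<nu> = \<Lambda>(dF/d\<nu> + T F)\<close> with \<open>T = d(\<phi> + u)/d\<nu> - n/(2\<nu>)\<close>
  (lemmas \<open>foi_iff_local\<close> and \<open>strongly_associated_iff_local\<close>).

  Existence. Formally \<open>\<Lambda>(f) = \<nu>\<^bsup>-n/2\<^esup> \<integral> e\<^sup>\<phi> f \<rho>\<close>. Let \<open>q\<close> be the quadratic Taylor polynomial of \<open>\<psi>\<close>
  and \<open>h = \<psi> - q\<close>. The Gaussian integral of \<open>e\<^bsup>q/\<nu>\<^esup> f\<close> expands as \<open>\<Sum>\<^sub>k \<nu>\<^sup>k G\<^sub>k(f)\<close> with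
  \<open>G\<^sub>k(f) = (lap\<^sup>k f)(x\<^sub>0)/k!\<close>, where \<open>lap = -1/2 \<Sum> (H\<^sup>-\<^sup>1)\<^sub>i\<^sub>j D\<^sub>i D\<^sub>j\<close> for the Hessian \<open>H\<close> of \<open>\<psi>\<close>, and expanding
  \<open>e\<^bsup>h/\<nu>\<^esup>\<close> gives the coefficients \<open>\<Lambda>\<^sub>r(f) = \<Sum>\<^sub>j G\<^sub>r\<^sub>+\<^sub>j(h\<^sup>j f)/j!\<close> (\<open>phase_functional\<close>). The sum is finite,
  because \<open>h\<close> vanishes to third order and \<open>G\<^sub>k\<close> only sees the jet of order \<open>2k\<close>. The two required
  identities are checked algebraically: integration by parts for \<open>G\<^sub>k\<close>, and Euler's identity for
  the effect of a multiplication by \<open>q\<close>, which produces the term \<open>n/(2\<nu>)\<close>. The remaining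
  factor \<open>\<epsilon> = e\<^bsup>\<phi>\<^sub>0 + \<nu> \<phi>\<^sub>1 + \<dots>\<^esup> e\<^sup>u\<close> is a power series in \<open>\<nu>\<close> with an invertible leading term, and
  \<open>F \<mapsto> \<Lambda>(\<epsilon> F)\<close> is the required functional (\<open>twisted_phase_functional\<close>).

  Uniqueness. Let \<open>\<Lambda>'\<close> be another solution and let \<open>c \<in> \<complex>[[\<nu>]]\<close> be such that \<open>\<Lambda>'\<close> and \<open>c \<Lambda>\<close> agree on the
  constant \<open>1\<close>. By induction the coefficients of \<open>\<kappa> = \<Lambda>' - c \<Lambda>\<close> vanish: if \<open>\<kappa>\<^sub>s = 0\<close> for \<open>s < r\<close>, then the
  lowest order of the FOI condition says \<open>\<kappa>\<^sub>r(w D\<^sub>i \<psi>) = 0\<close>. As \<open>x\<^sub>0\<close> is nondegenerate, the functions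
  \<open>w D\<^sub>i \<psi>\<close> generate, modulo functions vanishing to any given order, all functions vanishing at \<open>x\<^sub>0\<close>; hence \<open>\<kappa>\<^sub>r\<close> is a
  multiple of the evaluation at \<open>x\<^sub>0\<close> (\<open>point_functional_killing_gradient\<close>), and the multiple is
  zero because \<open>\<kappa>\<^sub>r(1) = 0\<close>. So \<open>\<Lambda>' = c \<Lambda>\<close>, and strong association of both forces \<open>dc/d\<nu> = 0\<close>.

  The jet of the phase. If \<open>\<Lambda>\<close> serves the phases \<open>\<phi>\<close> and \<open>\<phi>'\<close> with the same \<open>\<rho>\<close>, subtracting the two conditions
  gives \<open>\<Lambda>(\<chi> F) = 0\<close> for all \<open>F\<close>, where \<open>\<chi>\<close> is any of the functions \<open>D\<^sub>i(\<phi> - \<phi>')\<close> and \<open>d(\<phi> - \<phi>')/d\<nu>\<close>.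
  The formal functions \<open>\<chi>\<close> with this property are stable under the \<open>D\<^sub>i\<close>, and the leading coefficient of such
  a \<open>\<chi>\<close> vanishes at \<open>x\<^sub>0\<close> because \<open>\<Lambda>\<^sub>0\<close> is a multiple of the evaluation; so all coefficients of \<open>\<chi>\<close>
  are flat at \<open>x\<^sub>0\<close> (\<open>closed_functional_flat\<close>). Hence the jet of \<open>\<phi> - \<phi>'\<close> depends neither on the
  coordinates nor on \<open>\<nu>\<close>.
\<close>

(* The symbol $ denotes vector components as well as coefficients of power series; where only one
   of the two meanings occurs, the other is switched off. *)
unbundle no Formal_Power_Series.fps_syntax

section \<open>Smooth maps between Euclidean spaces\<close>

lemma pds_append: "pds (is @ js) g = pds is (pds js g)"
  by (induction "is") auto

lemma pd_eqI: "(g has_derivative g') (at x) \<Longrightarrow> pd i g x = g' (axis i 1)"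
  unfolding pd_def using frechet_derivative_at by metis

lemma has_derivative_cong_open:
  assumes "open S" "x \<in> S" "\<And>y. y \<in> S \<Longrightarrow> f y = g y"
  shows "(f has_derivative f') (at x) \<longleftrightarrow> (g has_derivative f') (at x)"
  using assms has_derivative_transform_within_open[of f f' x UNIV S g]
    has_derivative_transform_within_open[of g f' x UNIV S f] by auto

lemma pd_cong:
  assumes "open S" "x \<in> S" "\<And>y. y \<in> S \<Longrightarrow> f y = g y"
  shows "pd i f x = pd i g x"
  unfolding pd_def frechet_derivative_def using has_derivative_cong_open[OF assms] by simp

lemma pds_cong:
  assumes "open S" "x \<in> S" "\<And>y. y \<in> S \<Longrightarrow> f y = g y"
  shows "pds is f x = pds is g x"
  using assms(2)
proof (induction "is" arbitrary: x)
  case (Cons i js)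
  then show ?case using pd_cong[OF assms(1) Cons.prems, of "pds js f" "pds js g"] by simp
qed (use assms in simp)

lemma differentiable_cong_open:
  assumes "open S" "x \<in> S" "\<And>y. y \<in> S \<Longrightarrow> f y = g y"
  shows "f differentiable at x \<longleftrightarrow> g differentiable at x"
  unfolding differentiable_def using has_derivative_cong_open[OF assms] by simp

lemma pds_differentiable_cong:
  assumes "open S" "\<And>y. y \<in> S \<Longrightarrow> f y = g y" "x \<in> S"
  shows "pds is f differentiable at x \<longleftrightarrow> pds is g differentiable at x"
  by (rule differentiable_cong_open[OF assms(1,3)]) (rule pds_cong[OF assms(1) _ assms(2)])

lemma smooth_map_on_cong:
  assumes "open S" "\<And>y. y \<in> S \<Longrightarrow> f y = g y"
  shows "smooth_map_on S f \<longleftrightarrow> smooth_map_on S g"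
  unfolding smooth_map_on_def using pds_differentiable_cong[OF assms] by simp

lemma smooth_map_on_subset: "smooth_map_on S g \<Longrightarrow> T \<subseteq> S \<Longrightarrow> smooth_map_on T g"
  unfolding smooth_map_on_def by blast

lemma smooth_map_on_Un: "smooth_map_on S g \<Longrightarrow> smooth_map_on T g \<Longrightarrow> smooth_map_on (S \<union> T) g"
  unfolding smooth_map_on_def by blast

text \<open>Closure properties of smooth maps are proved by induction on the order of differentiability: the
  partial derivatives of a product or of a composite are again sums of such, with other factors. The
  recursion peels off the innermost derivative, whereas \<open>pds\<close> adds derivatives on the outside.\<close>

primrec smooth_upto :: "nat \<Rightarrow> (real^'n::finite) set \<Rightarrow> (real^'n \<Rightarrow> 'b::real_normed_vector) \<Rightarrow> bool"
  where
  "smooth_upto 0 S g \<longleftrightarrow> (\<forall>x\<in>S. g differentiable at x)"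
| "smooth_upto (Suc m) S g \<longleftrightarrow> (\<forall>x\<in>S. g differentiable at x) \<and> (\<forall>i. smooth_upto m S (pd i g))"

lemma smooth_upto_iff:
  "smooth_upto m S g \<longleftrightarrow> (\<forall>is. length is \<le> m \<longrightarrow> (\<forall>x\<in>S. pds is g differentiable at x))"
proof (induction m arbitrary: g)
  case (Suc m)
  have "(\<forall>is. length is \<le> Suc m \<longrightarrow> (\<forall>x\<in>S. pds is g differentiable at x)) \<longleftrightarrow>
    (\<forall>x\<in>S. g differentiable at x) \<and>
    (\<forall>i is. length is \<le> m \<longrightarrow> (\<forall>x\<in>S. pds (is @ [i]) g differentiable at x))" (is "?l \<longleftrightarrow> ?r")
  proof
    assume l: ?l
    show ?r
    proof (intro conjI allI impI)
      show "\<forall>x\<in>S. g differentiable at x" using l[rule_format, of "[]"] by simp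
      show "\<forall>x\<in>S. pds (is @ [i]) g differentiable at x" if "length is \<le> m" for i "is"
        using l[rule_format, of "is @ [i]"] that by simp
    qed
  next
    assume r: ?r
    show ?l
    proof (intro allI impI)
      fix "is" :: "'a list" assume "length is \<le> Suc m"
      then show "\<forall>x\<in>S. pds is g differentiable at x"
        using r by (cases "is" rule: rev_cases) auto
    qed
  qed
  then show ?case using Suc by (simp add: pds_append)
qed simp

lemma smooth_map_on_iff_upto: "smooth_map_on S g \<longleftrightarrow> (\<forall>m. smooth_upto m S g)"
  unfolding smooth_map_on_def smooth_upto_iff by blast

lemma smooth_upto_differentiable: "smooth_upto m S g \<Longrightarrow> x \<in> S \<Longrightarrow> g differentiable at x"
  by (cases m) auto

lemma smooth_upto_SucD: "smooth_upto (Suc m) S g \<Longrightarrow> smooth_upto m S g"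
  unfolding smooth_upto_iff by auto

lemma smooth_map_on_differentiable: "smooth_map_on S g \<Longrightarrow> x \<in> S \<Longrightarrow> g differentiable at x"
  using smooth_map_on_iff_upto smooth_upto_differentiable by blast

lemma smooth_map_on_pd: "smooth_map_on S g \<Longrightarrow> smooth_map_on S (pd i g)"
  unfolding smooth_map_on_iff_upto using smooth_upto.simps(2) by blast

lemma smooth_map_on_pds: "smooth_map_on S g \<Longrightarrow> smooth_map_on S (pds is g)"
  by (induction "is") (auto intro: smooth_map_on_pd)

lemma smooth_upto_cong:
  assumes "open S" "\<And>y. y \<in> S \<Longrightarrow> f y = g y"
  shows "smooth_upto m S f \<longleftrightarrow> smooth_upto m S g"
  unfolding smooth_upto_iff using pds_differentiable_cong[OF assms] by simp

lemma smooth_upto_const: "smooth_upto m S (\<lambda>_. c)"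
proof (induction m arbitrary: c)
  case (Suc m)
  have "pd i (\<lambda>_::real^'a. c) = (\<lambda>_. 0)" for i
    by (rule ext, subst pd_eqI[OF has_derivative_const]) simp
  then show ?case using Suc by simp
qed simp

lemma smooth_map_on_const: "smooth_map_on S (\<lambda>_. c)"
  unfolding smooth_map_on_iff_upto using smooth_upto_const by blast

lemma pd_add:
  assumes "f differentiable at x" "g differentiable at x"
  shows "pd i (\<lambda>x. f x + g x) x = pd i f x + pd i g x"
  using pd_eqI[OF has_derivative_add[OF assms[unfolded frechet_derivative_works]]]
  by (simp add: pd_def)

lemma smooth_upto_add:
  assumes S: "open S"
  shows "smooth_upto m S f \<Longrightarrow> smooth_upto m S g \<Longrightarrow> smooth_upto m S (\<lambda>x. f x + g x)"
proof (induction m arbitrary: f g)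
  case (Suc m)
  have "smooth_upto m S (pd i (\<lambda>x. f x + g x))" for i
    using Suc smooth_upto_cong[OF S, of "pd i (\<lambda>x. f x + g x)" "\<lambda>x. pd i f x + pd i g x"]
    by (simp add: pd_add)
  then show ?case using Suc.prems by (simp add: differentiable_add)
qed (simp add: differentiable_add)

lemma smooth_map_on_add:
  "open S \<Longrightarrow> smooth_map_on S f \<Longrightarrow> smooth_map_on S g \<Longrightarrow> smooth_map_on S (\<lambda>x. f x + g x)"
  unfolding smooth_map_on_iff_upto using smooth_upto_add by blast

lemma smooth_map_on_sum:
  assumes "open S" "\<And>k. k \<in> I \<Longrightarrow> smooth_map_on S (f k)"
  shows "smooth_map_on S (\<lambda>x. \<Sum>k\<in>I. f k x)"
  using assms(2)
  by (induction I rule: infinite_finite_induct) (auto intro: smooth_map_on_const smooth_map_on_add[OF assms(1)])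

lemma pd_bounded_linear:
  assumes "bounded_linear h" "f differentiable at x"
  shows "pd i (\<lambda>x. h (f x)) x = h (pd i f x)"
  using pd_eqI[OF bounded_linear.has_derivative[OF assms(1) assms(2)[unfolded frechet_derivative_works]]]
  by (simp add: pd_def)

lemma pds_bounded_linear:
  assumes h: "bounded_linear h" and S: "open S" and f: "smooth_map_on S f" and x: "x \<in> S"
  shows "pds is (\<lambda>x. h (f x)) x = h (pds is f x)"
  using x
proof (induction "is" arbitrary: x)
  case (Cons i js)
  have "pds (i # js) (\<lambda>x. h (f x)) x = pd i (\<lambda>x. h (pds js f x)) x"
    using pd_cong[OF S Cons.prems Cons.IH] by simp
  also have "\<dots> = h (pd i (pds js f) x)"
    by (rule pd_bounded_linear[OF h]) (use Cons.prems f smooth_map_on_def in blast)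
  finally show ?case by simp
qed simp

lemma smooth_map_on_bounded_linear:
  assumes h: "bounded_linear h" and S: "open S" and f: "smooth_map_on S f"
  shows "smooth_map_on S (\<lambda>x. h (f x))"
  unfolding smooth_map_on_def
proof (intro allI ballI)
  fix "is" x assume x: "x \<in> S"
  have "(\<lambda>x. h (pds is f x)) differentiable at x"
    using f x bounded_linear.has_derivative[OF h] unfolding smooth_map_on_def differentiable_def
    by blast
  then show "pds is (\<lambda>x. h (f x)) differentiable at x"
    using differentiable_cong_open[OF S x, of "pds is (\<lambda>x. h (f x))" "\<lambda>x. h (pds is f x)"]
      pds_bounded_linear[OF h S f] by simp
qed

lemma pd_bilinear:
  assumes h: "bounded_bilinear h" and "f differentiable at x" "g differentiable at x"
  shows "pd i (\<lambda>x. h (f x) (g x)) x = h (f x) (pd i g x) + h (pd i f x) (g x)"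
  using pd_eqI[OF bounded_bilinear.FDERIV[OF h assms(2,3)[unfolded frechet_derivative_works]]]
  by (simp add: pd_def)

lemma smooth_upto_bilinear:
  assumes S: "open S" and h: "bounded_bilinear h"
  shows "smooth_upto m S f \<Longrightarrow> smooth_upto m S g \<Longrightarrow> smooth_upto m S (\<lambda>x. h (f x) (g x))"
proof (induction m arbitrary: f g)
  case 0
  then show ?case
    using bounded_bilinear.FDERIV[OF h] unfolding smooth_upto.simps differentiable_def by blast
next
  case (Suc m)
  have d: "f differentiable at x" "g differentiable at x" if "x \<in> S" for x
    using Suc.prems that by auto
  have "smooth_upto m S (\<lambda>x. h (f x) (pd i g x) + h (pd i f x) (g x))" for i
    using Suc.prems by (intro smooth_upto_add[OF S] Suc.IH) (auto simp del: smooth_upto.simps(1) intro: smooth_upto_SucD)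
  then have "smooth_upto m S (pd i (\<lambda>x. h (f x) (g x)))" for i
    using smooth_upto_cong[OF S, of "pd i (\<lambda>x. h (f x) (g x))"] pd_bilinear[OF h d] by simp
  moreover have "(\<lambda>x. h (f x) (g x)) differentiable at x" if "x \<in> S" for x
    using bounded_bilinear.FDERIV[OF h] d[OF that] unfolding differentiable_def by blast
  ultimately show ?case by simp
qed

lemma smooth_map_on_bilinear:
  assumes "open S" "bounded_bilinear h" "smooth_map_on S f" "smooth_map_on S g"
  shows "smooth_map_on S (\<lambda>x. h (f x) (g x))"
  using assms unfolding smooth_map_on_iff_upto using smooth_upto_bilinear by blast

lemma smooth_map_on_mult:
  fixes f g :: "real^'n::finite \<Rightarrow> 'b::real_normed_algebra"
  assumes "open S" "smooth_map_on S f" "smooth_map_on S g"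
  shows "smooth_map_on S (\<lambda>x. f x * g x)"
  using smooth_map_on_bilinear[OF assms(1) bounded_bilinear_mult assms(2,3)] .

lemma pd_mult:
  fixes f g :: "real^'n::finite \<Rightarrow> 'b::real_normed_algebra"
  assumes "f differentiable at x" "g differentiable at x"
  shows "pd i (\<lambda>x. f x * g x) x = f x * pd i g x + pd i f x * g x"
  using pd_bilinear[OF bounded_bilinear_mult assms] .

lemma smooth_map_on_linear:
  assumes "bounded_linear h"
  shows "smooth_map_on S h"
proof -
  have "smooth_upto m UNIV h" for m
  proof (cases m)
    case 0 then show ?thesis using assms bounded_linear_imp_differentiable by auto
  next
    case (Suc k)
    have "pd i h = (\<lambda>x. h (axis i 1))" for i
      by (rule ext) (rule pd_eqI, rule bounded_linear_imp_has_derivative[OF assms])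
    then show ?thesis using Suc assms bounded_linear_imp_differentiable smooth_upto_const by auto
  qed
  then show ?thesis using smooth_map_on_subset smooth_map_on_iff_upto by blast
qed

lemma smooth_map_on_id: "smooth_map_on S (\<lambda>x. x)"
  by (rule smooth_map_on_linear) (rule bounded_linear_ident)

lemma smooth_map_on_component: "open S \<Longrightarrow> smooth_map_on S f \<Longrightarrow> smooth_map_on S (\<lambda>x. f x $ a)"
  for f :: "real^'n::finite \<Rightarrow> 'b::real_normed_vector^'k::finite"
  by (rule smooth_map_on_bounded_linear[OF bounded_linear_vec_nth])

lemma pd_component: "f differentiable at x \<Longrightarrow> pd i (\<lambda>x. f x $ a) x = pd i f x $ a"
  for f :: "real^'n::finite \<Rightarrow> 'b::real_normed_vector^'k::finite"
  by (rule pd_bounded_linear[OF bounded_linear_vec_nth])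

lemma bounded_linear_axis: "bounded_linear (\<lambda>z. axis a z :: 'b::real_normed_vector^'k::finite)"
proof (rule bounded_linear_intro[where K = 1])
  show "axis a (x + y) = axis a x + axis a y" for x y :: 'b by (auto simp: axis_def vec_eq_iff)
  show "axis a (r *\<^sub>R x) = r *\<^sub>R axis a x" for r and x :: 'b by (auto simp: axis_def vec_eq_iff)
  have "norm (axis a x :: 'b^'k) \<le> norm x" for x :: 'b
  proof -
    have "norm (axis a x :: 'b^'k) = sqrt (\<Sum>i\<in>UNIV. (if i = a then (norm x)\<^sup>2 else 0))"
      unfolding norm_vec_def L2_set_def by (intro arg_cong[where f = sqrt] sum.cong) (auto simp: axis_def)
    then show ?thesis by simp
  qed
  then show "norm (axis a x :: 'b^'k) \<le> norm x * 1" for x :: 'b by simp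
qed

lemma smooth_map_on_vec:
  fixes f :: "real^'n::finite \<Rightarrow> 'b::real_normed_vector^'k::finite"
  assumes S: "open S" and f: "\<And>a. smooth_map_on S (\<lambda>x. f x $ a)"
  shows "smooth_map_on S f"
proof -
  have "smooth_map_on S (\<lambda>x. \<Sum>a\<in>UNIV. axis a (f x $ a))"
    by (intro smooth_map_on_sum[OF S] smooth_map_on_bounded_linear[OF bounded_linear_axis S] f)
  moreover have "(\<lambda>x. \<Sum>a\<in>UNIV. axis a (f x $ a)) = f"
    by (auto simp: fun_eq_iff vec_eq_iff axis_def if_distrib cong: if_cong)
  ultimately show ?thesis by simp
qed

lemma frechet_derivative_expand:
  fixes f :: "real^'n::finite \<Rightarrow> 'b::real_normed_vector"
  assumes "f differentiable at x"
  shows "frechet_derivative f (at x) v = (\<Sum>k\<in>UNIV. (v $ k) *\<^sub>R pd k f x)"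
proof -
  have l: "linear (frechet_derivative f (at x))"
    using assms by (rule linear_frechet_derivative)
  have "v = (\<Sum>k\<in>UNIV. (v $ k) *\<^sub>R axis k 1)"
    using basis_expansion[of v] by (simp add: scalar_mult_eq_scaleR)
  then have "frechet_derivative f (at x) v = frechet_derivative f (at x) (\<Sum>k\<in>UNIV. (v $ k) *\<^sub>R axis k 1)"
    by simp
  also have "\<dots> = (\<Sum>k\<in>UNIV. (v $ k) *\<^sub>R pd k f x)"
    by (simp add: linear_sum[OF l] linear_scale[OF l] pd_def)
  finally show ?thesis .
qed

text \<open>The chain rule in coordinates. It is what makes composition amenable to the induction over
  \<open>smooth_upto\<close>: the derivative is a sum of products of a partial derivative of the inner map with a
  composite whose outer function has one order of differentiability less.\<close>

lemma pd_compose: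
  fixes f :: "real^'k::finite \<Rightarrow> 'b::real_normed_vector" and g :: "real^'n::finite \<Rightarrow> real^'k"
  assumes f: "f differentiable at (g x)" and g: "g differentiable at x"
  shows "pd i (\<lambda>x. f (g x)) x = (\<Sum>k\<in>UNIV. (pd i g x $ k) *\<^sub>R pd k f (g x))"
proof -
  have "pd i (\<lambda>x. f (g x)) x = frechet_derivative f (at (g x)) (frechet_derivative g (at x) (axis i 1))"
    by (rule pd_eqI) (rule has_derivative_compose[OF g[unfolded frechet_derivative_works] f[unfolded frechet_derivative_works]])
  also have "\<dots> = (\<Sum>k\<in>UNIV. (pd i g x $ k) *\<^sub>R pd k f (g x))"
    unfolding frechet_derivative_expand[OF f] by (simp add: pd_def)
  finally show ?thesis .
qed

lemma smooth_upto_compose: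
  fixes g :: "real^'n::finite \<Rightarrow> real^'k::finite"
  assumes S: "open S" and g: "smooth_map_on S g" "g ` S \<subseteq> T"
  shows "smooth_upto m T f \<Longrightarrow> smooth_upto m S (\<lambda>x. f (g x))"
proof (induction m arbitrary: f)
  case 0
  then show ?case
    using g smooth_map_on_differentiable[OF g(1)] differentiable_compose[of f g]
    by (auto simp: image_subset_iff)
next
  case (Suc m)
  have d: "f differentiable at (g x)" "g differentiable at x" if "x \<in> S" for x
    using Suc.prems that g smooth_map_on_differentiable[OF g(1)] by (auto simp: image_subset_iff)
  have "smooth_upto m S (\<lambda>x. (pd i g x $ k) *\<^sub>R pd k f (g x))" for i k
  proof (rule smooth_upto_bilinear[OF S bounded_bilinear_scaleR])
    show "smooth_upto m S (\<lambda>x. pd k f (g x))" using Suc by auto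
    show "smooth_upto m S (\<lambda>x. pd i g x $ k)"
      using smooth_map_on_component[OF S smooth_map_on_pd[OF g(1)]] smooth_map_on_iff_upto by blast
  qed
  then have "smooth_upto m S (\<lambda>x. \<Sum>k\<in>K. (pd i g x $ k) *\<^sub>R pd k f (g x))" for i K
    by (induction K rule: infinite_finite_induct) (auto intro: smooth_upto_const smooth_upto_add[OF S])
  then have "smooth_upto m S (pd i (\<lambda>x. f (g x)))" for i
    using smooth_upto_cong[OF S, of "pd i (\<lambda>x. f (g x))"] pd_compose[OF d] by simp
  moreover have "(\<lambda>x. f (g x)) differentiable at x" if "x \<in> S" for x
    using differentiable_compose[of f g] d[OF that] by auto
  ultimately show ?case by simp
qed

lemma smooth_map_on_compose:
  fixes g :: "real^'n::finite \<Rightarrow> real^'k::finite"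
  assumes "open S" "smooth_map_on S g" "g ` S \<subseteq> T" "smooth_map_on T f"
  shows "smooth_map_on S (\<lambda>x. f (g x))"
  using assms(4) smooth_upto_compose[OF assms(1-3)] unfolding smooth_map_on_iff_upto by blast

text \<open>Composition with a function of one variable from a family that is closed under derivatives. The
  family, rather than a single function, makes the induction work; it covers \<open>exp\<close>, the inverse and
  the flat functions from which bump functions are built.\<close>

lemma smooth_map_on_family:
  fixes f :: "real^'n::finite \<Rightarrow> 'b::real_normed_field"
  assumes S: "open S" and f: "smooth_map_on S f"
    and family: "\<And>F. F \<in> \<F> \<Longrightarrow> \<exists>F'\<in>\<F>. \<forall>x\<in>S. (F has_field_derivative F' (f x)) (at (f x))"
    and F: "F \<in> \<F>"
  shows "smooth_map_on S (\<lambda>x. F (f x))"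
proof -
  have df: "f differentiable at x" if "x \<in> S" for x
    using smooth_map_on_differentiable[OF f that] .
  have "smooth_upto m S (\<lambda>x. F (f x))" if "F \<in> \<F>" for F m
    using that
  proof (induction m arbitrary: F)
    case 0
    obtain F' where D: "\<And>x. x \<in> S \<Longrightarrow> (F has_field_derivative F' (f x)) (at (f x))"
      using family[OF 0] by blast
    have "(\<lambda>x. F (f x)) differentiable at x" if "x \<in> S" for x
      using has_derivative_compose[OF df[OF that, unfolded frechet_derivative_works]
          D[OF that, unfolded has_field_derivative_def]] unfolding differentiable_def by blast
    then show ?case by simp
  next
    case (Suc m)
    obtain F' where F': "F' \<in> \<F>" and D: "\<And>x. x \<in> S \<Longrightarrow> (F has_field_derivative F' (f x)) (at (f x))"
      using family[OF Suc.prems] by blast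
    have H: "((\<lambda>x. F (f x)) has_derivative (\<lambda>v. F' (f x) * frechet_derivative f (at x) v)) (at x)"
      if "x \<in> S" for x
      using has_derivative_compose[OF df[OF that, unfolded frechet_derivative_works]
          D[OF that, unfolded has_field_derivative_def]] by simp
    then have "pd i (\<lambda>x. F (f x)) x = F' (f x) * pd i f x" if "x \<in> S" for i x
      using pd_eqI[OF H[OF that]] by (simp add: pd_def)
    moreover have "smooth_upto m S (\<lambda>x. F' (f x) * pd i f x)" for i
      using Suc.IH[OF F'] smooth_map_on_pd[OF f] smooth_upto_bilinear[OF S bounded_bilinear_mult]
      unfolding smooth_map_on_iff_upto by blast
    ultimately have "smooth_upto m S (pd i (\<lambda>x. F (f x)))" for i
      using smooth_upto_cong[OF S, of "pd i (\<lambda>x. F (f x))"] by simp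
    moreover have "(\<lambda>x. F (f x)) differentiable at x" if "x \<in> S" for x
      using H[OF that] unfolding differentiable_def by blast
    ultimately show ?case by simp
  qed
  then show ?thesis using F unfolding smooth_map_on_iff_upto by blast
qed

lemma smooth_map_on_inverse:
  fixes f :: "real^'n::finite \<Rightarrow> 'b::real_normed_field"
  assumes S: "open S" and f: "smooth_map_on S f" and nz: "\<And>x. x \<in> S \<Longrightarrow> f x \<noteq> 0"
  shows "smooth_map_on S (\<lambda>x. inverse (f x))"
proof -
  have "smooth_map_on S (\<lambda>x. (\<lambda>z. 1 * inverse z ^ 1) (f x))"
  proof (rule smooth_map_on_family[OF S f, where \<F> = "{\<lambda>z. c * inverse z ^ n |c n. True}"])
    fix F :: "'b \<Rightarrow> 'b" assume "F \<in> {\<lambda>z. c * inverse z ^ n |c n. True}"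
    then obtain c n where F: "F = (\<lambda>z. c * inverse z ^ n)" by blast
    have "(F has_field_derivative (- c * of_nat n) * inverse (f x) ^ (n + 1)) (at (f x))" if "x \<in> S" for x
    proof -
      have "(F has_field_derivative
          c * (of_nat n * (- (inverse (f x) ^ Suc (Suc 0)) * inverse (f x) ^ (n - Suc 0)))) (at (f x))"
        unfolding F by (intro DERIV_cmult DERIV_power DERIV_inverse nz that)
      then show ?thesis by (cases n) (simp_all add: mult_ac)
    qed
    then have "\<forall>x\<in>S. (F has_field_derivative (\<lambda>z. (- c * of_nat n) * inverse z ^ (n + 1)) (f x)) (at (f x))"
      by simp
    then show "\<exists>F'\<in>{\<lambda>z. c * inverse z ^ n |c n. True}. \<forall>x\<in>S. (F has_field_derivative F' (f x)) (at (f x))"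
      by (intro bexI[of _ "\<lambda>z. (- c * of_nat n) * inverse z ^ (n + 1)"]) blast+
  qed blast
  then show ?thesis by simp
qed

lemma smooth_map_on_exp:
  fixes f :: "real^'n::finite \<Rightarrow> 'b::{real_normed_field,banach}"
  assumes S: "open S" and f: "smooth_map_on S f"
  shows "smooth_map_on S (\<lambda>x. exp (f x))"
proof (rule smooth_map_on_family[OF S f, where \<F> = "{exp}"])
  fix F :: "'b \<Rightarrow> 'b" assume "F \<in> {exp}"
  then have "F = exp" by simp
  moreover have "\<forall>x\<in>S. (exp has_field_derivative exp (f x)) (at (f x))"
    by (intro ballI DERIV_exp)
  ultimately show "\<exists>F'\<in>{exp}. \<forall>x\<in>S. (F has_field_derivative F' (f x)) (at (f x))"
    by simp
qed simp

text \<open>The derivative of the logarithm is the inverse, whose smoothness is known already; so one step of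
  the recursion for \<open>smooth_upto\<close> suffices.\<close>

lemma smooth_map_on_Ln:
  fixes f :: "real^'n::finite \<Rightarrow> complex"
  assumes S: "open S" and f: "smooth_map_on S f" and nz: "\<And>x. x \<in> S \<Longrightarrow> f x \<notin> \<real>\<^sub>\<le>\<^sub>0"
  shows "smooth_map_on S (\<lambda>x. Ln (f x))"
proof -
  have d: "(Ln has_field_derivative inverse (f x)) (at (f x))" if "x \<in> S" for x
    by (rule has_field_derivative_Ln) (use nz that in simp)
  have df: "(\<lambda>x. Ln (f x)) differentiable at x"
    "pd i (\<lambda>x. Ln (f x)) x = inverse (f x) * pd i f x" if "x \<in> S" for x i
  proof -
    have H: "((\<lambda>x. Ln (f x)) has_derivative (\<lambda>v. inverse (f x) * frechet_derivative f (at x) v)) (at x)"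
      using has_derivative_compose[OF
          smooth_map_on_differentiable[OF f that, unfolded frechet_derivative_works]
          d[OF that, unfolded has_field_derivative_def]] by simp
    show "(\<lambda>x. Ln (f x)) differentiable at x" using H unfolding differentiable_def by blast
    show "pd i (\<lambda>x. Ln (f x)) x = inverse (f x) * pd i f x"
      using pd_eqI[OF H] by (simp add: pd_def)
  qed
  have "smooth_upto m S (pd i (\<lambda>x. Ln (f x)))" for i m
  proof -
    have "f x \<noteq> 0" if "x \<in> S" for x using nz[OF that] by auto
    then have "smooth_map_on S (\<lambda>x. inverse (f x) * pd i f x)"
      by (rule smooth_map_on_mult[OF S smooth_map_on_inverse[OF S f] smooth_map_on_pd[OF f]])
    moreover have "smooth_upto m S (pd i (\<lambda>x. Ln (f x))) \<longleftrightarrow> smooth_upto m S (\<lambda>x. inverse (f x) * pd i f x)"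
      by (rule smooth_upto_cong[OF S df(2)])
    ultimately show ?thesis by (simp only: smooth_map_on_iff_upto)
  qed
  note pd_smooth = this
  have "smooth_upto m S (\<lambda>x. Ln (f x))" for m
  proof (rule smooth_upto_SucD)
    show "smooth_upto (Suc m) S (\<lambda>x. Ln (f x))"
      unfolding smooth_upto.simps
    proof (intro conjI ballI allI)
      show "(\<lambda>x. Ln (f x)) differentiable at x" if "x \<in> S" for x
        by (rule df(1)[OF that])
      show "smooth_upto m S (pd i (\<lambda>x. Ln (f x)))" for i
        by (rule pd_smooth)
    qed
  qed
  then show ?thesis unfolding smooth_map_on_iff_upto by (rule allI)
qed

subsection \<open>Symmetry of second derivatives\<close>

text \<open>The mean value inequality along the \<open>i\<close>-axis shows that the second difference of \<open>g\<close> over a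
  parallelogram with sides \<open>h\<close> is \<open>h\<^sup>2\<close> times a mixed derivative, up to \<open>o(h\<^sup>2)\<close>. The second difference is symmetric in
  \<open>i\<close> and \<open>j\<close>, hence so is the mixed derivative.\<close>

lemma second_difference_bound:
  fixes g :: "real^'n::finite \<Rightarrow> 'b::real_normed_vector"
  assumes S: "open S" "x \<in> S" and g: "\<And>y. y \<in> S \<Longrightarrow> g differentiable at y"
    and gi: "pd i g differentiable at x" and \<epsilon>: "\<epsilon> > 0"
  shows "\<forall>\<^sub>F h in at_right 0. norm (g (x + h *\<^sub>R axis i 1 + h *\<^sub>R axis j 1) - g (x + h *\<^sub>R axis i 1)
           - g (x + h *\<^sub>R axis j 1) + g x - h\<^sup>2 *\<^sub>R pd j (pd i g) x) \<le> \<epsilon> * h\<^sup>2"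
proof -
  define a b where "a = (axis i 1 :: real^'n)" and "b = (axis j 1 :: real^'n)"
  define A where "A = frechet_derivative (pd i g) (at x)"
  have ab: "norm a = 1" "norm b = 1" by (simp_all add: a_def b_def)
  have Ad: "(pd i g has_derivative A) (at x)"
    using gi unfolding A_def frechet_derivative_works .
  obtain d1 where d1: "d1 > 0" "\<And>y. norm (y - x) < d1 \<Longrightarrow>
      norm (pd i g y - pd i g x - A (y - x)) \<le> (\<epsilon>/3) * norm (y - x)"
    using Ad[unfolded has_derivative_at_alt, THEN conjunct2, rule_format, of "\<epsilon>/3"] \<epsilon> by auto
  obtain d2 where d2: "d2 > 0" "ball x d2 \<subseteq> S" using S openE by blast
  define d where "d = min d1 d2 / 2"
  have d: "d > 0" using d1 d2 by (simp add: d_def)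
  have lin: "linear A" using has_derivative_linear[OF Ad] .
  have main: "norm (g (x + h *\<^sub>R a + h *\<^sub>R b) - g (x + h *\<^sub>R a)
           - g (x + h *\<^sub>R b) + g x - h\<^sup>2 *\<^sub>R A b) \<le> \<epsilon> * h\<^sup>2" if h: "0 < h" "h < d" for h
  proof -
    \<comment> \<open>the second difference minus its predicted value is the increment of K over [0, h]\<close>
    define K where "K t = g (x + t *\<^sub>R a + h *\<^sub>R b) - g (x + t *\<^sub>R a) - t *\<^sub>R (h *\<^sub>R A b)" for t
    define K' where "K' t = pd i g (x + t *\<^sub>R a + h *\<^sub>R b) - pd i g (x + t *\<^sub>R a) - h *\<^sub>R A b" for t
    have n1: "norm (t *\<^sub>R a + h *\<^sub>R b) \<le> 2 * h" and n2: "norm (t *\<^sub>R a) \<le> h" if "t \<in> {0..h}" for t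
    proof -
      show "norm (t *\<^sub>R a) \<le> h" using that ab by simp
      show "norm (t *\<^sub>R a + h *\<^sub>R b) \<le> 2 * h"
        by (rule order_trans[OF norm_triangle_ineq]) (use that ab h in simp)
    qed
    have lt: "2 * h < d1" "2 * h < d2" using h by (auto simp: d_def)
    have inS: "x + t *\<^sub>R a + h *\<^sub>R b \<in> S" "x + t *\<^sub>R a \<in> S" if "t \<in> {0..h}" for t
    proof -
      have "x + w \<in> S" if "norm w < d2" for w
        using that d2(2) by (auto simp: subset_eq dist_norm)
      from this[of "t *\<^sub>R a + h *\<^sub>R b"] this[of "t *\<^sub>R a"]
      show "x + t *\<^sub>R a + h *\<^sub>R b \<in> S" "x + t *\<^sub>R a \<in> S"
        using n1[OF that] n2[OF that] lt h by (simp_all add: add.assoc)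
    qed
    have line: "((\<lambda>t. g (x + t *\<^sub>R a + w)) has_vector_derivative pd i g (x + t *\<^sub>R a + w)) (at t within T)"
      if "x + t *\<^sub>R a + w \<in> S" for t w T
    proof -
      have "((\<lambda>t. g (x + t *\<^sub>R a + w)) has_derivative
          (\<lambda>s. frechet_derivative g (at (x + t *\<^sub>R a + w)) (s *\<^sub>R a))) (at t within T)"
        by (rule has_derivative_compose[where f = "\<lambda>t. x + t *\<^sub>R a + w" and g = g])
          (use g[OF that, unfolded frechet_derivative_works] in \<open>auto intro!: derivative_eq_intros\<close>)
      then show ?thesis
        unfolding has_vector_derivative_def pd_def a_def[symmetric]
        by (simp add: linear_scale[OF linear_frechet_derivative[OF g[OF that]]])
    qed
    have KD: "(K has_vector_derivative K' t) (at t within {0..h})" if "t \<in> {0..h}" for t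
    proof -
      have "((\<lambda>t. t *\<^sub>R (h *\<^sub>R A b)) has_vector_derivative h *\<^sub>R A b) (at t within {0..h})"
        by (auto intro!: derivative_eq_intros)
      moreover have "((\<lambda>t. g (x + t *\<^sub>R a)) has_vector_derivative pd i g (x + t *\<^sub>R a)) (at t within {0..h})"
        using line[of t 0] inS(2)[OF that] by simp
      ultimately show ?thesis
        unfolding K_def K'_def using line[OF inS(1)[OF that]]
        by (intro has_vector_derivative_diff)
    qed
    have KB: "norm (K' t) \<le> \<epsilon> * h" if "t \<in> {0..h}" for t
    proof -
      define u v where "u = t *\<^sub>R a + h *\<^sub>R b" and "v = t *\<^sub>R a"
      have "A u - A v = h *\<^sub>R A b"
        by (simp add: u_def v_def linear_add[OF lin] linear_scale[OF lin])
      then have "K' t = (pd i g (x + u) - pd i g x - A u) - (pd i g (x + v) - pd i g x - A v)"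
        by (simp add: K'_def u_def v_def algebra_simps)
      moreover have "norm (pd i g (x + u) - pd i g x - A u) \<le> \<epsilon>/3 * norm u"
        using d1(2)[of "x + u"] n1[OF that] lt by (simp add: u_def)
      moreover have "norm (pd i g (x + v) - pd i g x - A v) \<le> \<epsilon>/3 * norm v"
        using d1(2)[of "x + v"] n2[OF that] lt h by (simp add: v_def)
      ultimately have "norm (K' t) \<le> \<epsilon>/3 * norm u + \<epsilon>/3 * norm v"
        using norm_triangle_le_diff[OF add_mono] by metis
      also have "\<dots> \<le> \<epsilon>/3 * (2 * h) + \<epsilon>/3 * h"
        using n1[OF that] n2[OF that] \<epsilon> by (intro add_mono mult_left_mono) (auto simp: u_def v_def)
      finally show ?thesis by simp
    qed
    have "norm (K h - K 0) \<le> (\<epsilon> * h) * norm (h - 0)"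
    proof (rule differentiable_bound[of "{0..h}" K "\<lambda>t s. s *\<^sub>R K' t"])
      show "onorm (\<lambda>s. s *\<^sub>R K' t) \<le> \<epsilon> * h" if "t \<in> {0..h}" for t
        by (rule onorm_le) (use mult_left_mono[OF KB[OF that] abs_ge_zero] in \<open>simp add: mult.commute\<close>)
    qed (use KD h in \<open>auto simp: has_vector_derivative_def\<close>)
    then show ?thesis using h by (simp add: K_def power2_eq_square algebra_simps)
  qed
  have "pd j (pd i g) x = A b" by (simp add: pd_def A_def b_def)
  then have "\<forall>h>0. h < d \<longrightarrow> norm (g (x + h *\<^sub>R axis i 1 + h *\<^sub>R axis j 1) - g (x + h *\<^sub>R axis i 1)
           - g (x + h *\<^sub>R axis j 1) + g x - h\<^sup>2 *\<^sub>R pd j (pd i g) x) \<le> \<epsilon> * h\<^sup>2"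
    using main by (simp add: a_def b_def)
  then show ?thesis
    unfolding eventually_at_right_field using d by blast
qed

lemma pd_commute:
  fixes g :: "real^'n::finite \<Rightarrow> 'b::real_normed_vector"
  assumes S: "open S" "x \<in> S" and g: "smooth_map_on S g"
  shows "pd i (pd j g) x = pd j (pd i g) x"
proof -
  define e where "e = norm (pd i (pd j g) x - pd j (pd i g) x)"
  have "e \<le> 0 + \<epsilon>" if \<epsilon>: "\<epsilon> > 0" for \<epsilon>
  proof -
    have diff: "g differentiable at y" "pd k g differentiable at y" if "y \<in> S" for y k
      using g that smooth_map_on_differentiable smooth_map_on_pd by blast+
    have bound: "\<forall>\<^sub>F h in at_right 0. norm (g (x + h *\<^sub>R axis k 1 + h *\<^sub>R axis l 1) - g (x + h *\<^sub>R axis k 1)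
           - g (x + h *\<^sub>R axis l 1) + g x - h\<^sup>2 *\<^sub>R pd l (pd k g) x) \<le> \<epsilon>/2 * h\<^sup>2" for k l
      by (rule second_difference_bound[OF S]) (use diff S \<epsilon> in auto)
    have "\<forall>\<^sub>F h in at_right 0. h > 0 \<and> e * h\<^sup>2 \<le> \<epsilon> * h\<^sup>2"
      using bound[of i j] bound[of j i] eventually_at_right_less[of "0::real"]
    proof (eventually_elim, goal_cases)
      case (1 h)
      define D where "D = g (x + h *\<^sub>R axis i 1 + h *\<^sub>R axis j 1) - g (x + h *\<^sub>R axis i 1)
           - g (x + h *\<^sub>R axis j 1) + g x"
      have "norm (D - h\<^sup>2 *\<^sub>R pd j (pd i g) x) \<le> \<epsilon>/2 * h\<^sup>2" using 1(1) \<epsilon> by (simp add: D_def)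
      moreover have "norm (D - h\<^sup>2 *\<^sub>R pd i (pd j g) x) \<le> \<epsilon>/2 * h\<^sup>2"
        using 1(2) \<epsilon> by (simp add: D_def algebra_simps)
      ultimately have "norm ((D - h\<^sup>2 *\<^sub>R pd j (pd i g) x) - (D - h\<^sup>2 *\<^sub>R pd i (pd j g) x))
          \<le> \<epsilon>/2 * h\<^sup>2 + \<epsilon>/2 * h\<^sup>2"
        using norm_triangle_le_diff[OF add_mono] by blast
      moreover have "(D - h\<^sup>2 *\<^sub>R pd j (pd i g) x) - (D - h\<^sup>2 *\<^sub>R pd i (pd j g) x) =
          h\<^sup>2 *\<^sub>R (pd i (pd j g) x - pd j (pd i g) x)" by (simp add: algebra_simps)
      ultimately show ?case using 1(3) by (simp add: e_def mult.commute)
    qed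
    then obtain h where "h > 0" "e * h\<^sup>2 \<le> \<epsilon> * h\<^sup>2"
      using eventually_happens trivial_limit_at_right_real by blast
    then show ?thesis by simp
  qed
  then have "e \<le> 0" by (rule field_le_epsilon)
  then show ?thesis by (simp add: e_def)
qed

subsection \<open>Bump functions\<close>

lemma poly_div_exp_tendsto_0: "((\<lambda>s. s ^ k * poly p s / exp s) \<longlongrightarrow> (0::real)) at_top"
proof (induction p arbitrary: k)
  case (pCons a p)
  have "((\<lambda>s. a * (s ^ k / exp s) + s ^ Suc k * poly p s / exp s) \<longlongrightarrow> a * 0 + 0) at_top"
    by (intro tendsto_intros tendsto_power_div_exp_0 pCons.IH)
  moreover have "(\<lambda>s. a * (s ^ k / exp s) + s ^ Suc k * poly p s / exp s) = (\<lambda>s. s ^ k * poly (pCons a p) s / exp s)"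
    by (auto simp: fun_eq_iff field_simps)
  ultimately show ?case by simp
qed simp

text \<open>The functions \<open>p(1/t) e\<^bsup>-1/t\<^esup>\<close> for polynomials \<open>p\<close>, extended by zero: a family containing the classical
  smooth flat function and closed under derivatives.\<close>

definition flat_exp :: "real poly \<Rightarrow> real \<Rightarrow> real" where
  "flat_exp p t = (if t > 0 then poly p (inverse t) / exp (inverse t) else 0)"

lemma flat_exp_deriv:
  "(flat_exp p has_field_derivative flat_exp ((p - pderiv p) * [:0, 0, 1:]) t) (at t)"
proof -
  consider "t > 0" | "t < 0" | "t = 0" by linarith
  then show ?thesis
  proof cases
    case 1
    have "((\<lambda>t. poly p (inverse t) * exp (- inverse t)) has_field_derivative
        poly (pderiv p) (inverse t) * (- (inverse t ^ Suc (Suc 0))) * exp (- inverse t)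
        + exp (- inverse t) * (- (- (inverse t ^ Suc (Suc 0)))) * poly p (inverse t)) (at t)"
      using 1 by (intro DERIV_mult DERIV_chain2[OF poly_DERIV] DERIV_chain2[OF DERIV_exp] DERIV_minus DERIV_inverse) auto
    moreover have "poly (pderiv p) (inverse t) * (- (inverse t ^ Suc (Suc 0))) * exp (- inverse t)
        + exp (- inverse t) * (- (- (inverse t ^ Suc (Suc 0)))) * poly p (inverse t)
        = flat_exp ((p - pderiv p) * [:0, 0, 1:]) t"
      using 1 by (simp add: flat_exp_def exp_minus divide_inverse) algebra
    moreover have "\<forall>\<^sub>F s in nhds t. poly p (inverse s) * exp (- inverse s) = flat_exp p s"
      using eventually_nhds_in_open[of "{0<..}" t] 1
      by (auto elim!: eventually_mono simp: flat_exp_def exp_minus divide_inverse)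
    ultimately show ?thesis
      using DERIV_cong_ev[OF refl _ refl, of "\<lambda>t. poly p (inverse t) * exp (- inverse t)" "flat_exp p" t] by simp
  next
    case 2
    have "((\<lambda>t. 0) has_field_derivative flat_exp ((p - pderiv p) * [:0, 0, 1:]) t) (at t)"
      using 2 by (simp add: flat_exp_def)
    moreover have "\<forall>\<^sub>F s in nhds t. 0 = flat_exp p s"
      using eventually_nhds_in_open[of "{..<0}" t] 2 by (auto elim!: eventually_mono simp: flat_exp_def)
    ultimately show ?thesis using DERIV_cong_ev[OF refl _ refl, of "\<lambda>_. 0" "flat_exp p" t] by simp
  next
    case 3
    have "((\<lambda>y. (flat_exp p y - flat_exp p 0) / (y - 0)) \<longlongrightarrow> 0) (at 0)"
    proof (rule filterlim_split_at)
      have "\<forall>\<^sub>F y in at_left 0. 0 = (flat_exp p y - flat_exp p 0) / (y - 0)"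
        unfolding eventually_at_left_field by (auto simp: flat_exp_def intro: exI[of _ "-1"])
      then show "((\<lambda>y. (flat_exp p y - flat_exp p 0) / (y - 0)) \<longlongrightarrow> 0) (at_left 0)"
        by (rule Lim_transform_eventually[OF tendsto_const])
      have "\<forall>\<^sub>F s in at_top. s ^ 1 * poly p s / exp s = (flat_exp p (inverse s) - flat_exp p 0) / (inverse s - 0)"
        using eventually_gt_at_top[of 0] by eventually_elim (auto simp: flat_exp_def field_simps)
      then have "((\<lambda>s. (flat_exp p (inverse s) - flat_exp p 0) / (inverse s - 0)) \<longlongrightarrow> 0) at_top"
        by (rule Lim_transform_eventually[OF poly_div_exp_tendsto_0[of 1 p]])
      then show "((\<lambda>y. (flat_exp p y - flat_exp p 0) / (y - 0)) \<longlongrightarrow> 0) (at_right 0)"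
        by (simp add: filterlim_at_right_to_top)
    qed
    then show ?thesis using 3 by (simp add: has_field_derivative_iff flat_exp_def)
  qed
qed

text \<open>The quotient \<open>h1/(h1 + h2)\<close>, where \<open>h1\<close> is positive inside the ball of radius \<open>e\<close> and \<open>h2\<close> outside the
  ball of radius \<open>e/2\<close>; the denominator has no zero.\<close>

lemma smooth_bump_function:
  fixes y\<^sub>0 :: "real^'n::finite"
  assumes e: "e > 0"
  obtains b :: "real^'n \<Rightarrow> real" where "smooth_map_on UNIV b"
    "\<And>x. dist y\<^sub>0 x \<le> e/2 \<Longrightarrow> b x = 1" "\<And>x. dist y\<^sub>0 x \<ge> e \<Longrightarrow> b x = 0"
proof -
  define r where "r x = (x - y\<^sub>0) \<bullet> (x - y\<^sub>0)" for x
  define h1 where "h1 x = flat_exp 1 (e\<^sup>2 + - 1 * r x)" for x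
  define h2 where "h2 x = flat_exp 1 (- (e/2)\<^sup>2 + r x)" for x
  have sub: "smooth_map_on UNIV (\<lambda>x::real^'n. x - y\<^sub>0)"
    using smooth_map_on_add[OF open_UNIV smooth_map_on_id smooth_map_on_const, of "- y\<^sub>0"] by simp
  have r: "smooth_map_on UNIV r"
    unfolding r_def by (rule smooth_map_on_bilinear[OF open_UNIV bounded_bilinear_inner sub sub])
  have F: "smooth_map_on UNIV (\<lambda>x. flat_exp 1 (f x))" if "smooth_map_on UNIV f"
    for f :: "real^'n \<Rightarrow> real"
  proof (rule smooth_map_on_family[OF open_UNIV that, where \<F> = "range flat_exp"])
    fix G assume "G \<in> range flat_exp"
    then obtain p where "G = flat_exp p" by blast
    then have "\<forall>x\<in>UNIV. (G has_field_derivative flat_exp ((p - pderiv p) * [:0, 0, 1:]) (f x)) (at (f x))"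
      using flat_exp_deriv by simp
    then show "\<exists>G'\<in>range flat_exp. \<forall>x\<in>UNIV. (G has_field_derivative G' (f x)) (at (f x))"
      by (intro bexI[of _ "flat_exp ((p - pderiv p) * [:0, 0, 1:])"]) simp_all
  qed simp
  have h1: "smooth_map_on UNIV h1"
    unfolding h1_def by (rule F, rule smooth_map_on_add[OF open_UNIV smooth_map_on_const],
        rule smooth_map_on_mult[OF open_UNIV smooth_map_on_const r])
  have h2: "smooth_map_on UNIV h2"
    unfolding h2_def by (rule F, rule smooth_map_on_add[OF open_UNIV smooth_map_on_const r])
  have r_dist: "r x = (dist y\<^sub>0 x)\<^sup>2" for x
    by (simp add: r_def dist_norm power2_norm_eq_inner norm_minus_commute)
  have nonneg: "flat_exp 1 t \<ge> 0" and pos: "t > 0 \<Longrightarrow> flat_exp 1 t > 0" for t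
    by (auto simp: flat_exp_def)
  have h_nonneg: "h1 x \<ge> 0" "h2 x \<ge> 0" for x
    unfolding h1_def h2_def by (rule nonneg)+
  have sum_pos: "h1 x + h2 x > 0" for x
  proof (cases "dist y\<^sub>0 x < e")
    case True
    then have "(dist y\<^sub>0 x)\<^sup>2 < e\<^sup>2" by (rule power_strict_mono) simp_all
    then have "h1 x > 0" unfolding h1_def r_dist by (intro pos) simp
    then show ?thesis using h_nonneg(2) by (rule add_pos_nonneg)
  next
    case False
    then have "e/2 < dist y\<^sub>0 x" using e by linarith
    then have "(e/2)\<^sup>2 < (dist y\<^sub>0 x)\<^sup>2" by (rule power_strict_mono) (use e in simp_all)
    then have "h2 x > 0" unfolding h2_def r_dist by (intro pos) linarith
    with h_nonneg(1) show ?thesis by (rule add_nonneg_pos)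
  qed
  then have nz: "h1 x + h2 x \<noteq> 0" for x using less_imp_neq[of 0 "h1 x + h2 x"] by simp
  show ?thesis
  proof (rule that)
    show "smooth_map_on UNIV (\<lambda>x. h1 x * inverse (h1 x + h2 x))"
      by (intro smooth_map_on_mult[OF open_UNIV] smooth_map_on_inverse[OF open_UNIV]
          smooth_map_on_add[OF open_UNIV] h1 h2 nz)
    show "h1 x * inverse (h1 x + h2 x) = 1" if "dist y\<^sub>0 x \<le> e/2" for x
    proof -
      have "(dist y\<^sub>0 x)\<^sup>2 \<le> (e/2)\<^sup>2" by (rule power_mono) (use that in auto)
      then have "h2 x = 0" by (simp add: h2_def r_dist flat_exp_def)
      then show ?thesis using sum_pos[of x] by simp
    qed
    show "h1 x * inverse (h1 x + h2 x) = 0" if "dist y\<^sub>0 x \<ge> e" for x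
    proof -
      have "e\<^sup>2 \<le> (dist y\<^sub>0 x)\<^sup>2" by (rule power_mono) (use that e in auto)
      then show ?thesis by (simp add: h1_def r_dist flat_exp_def)
    qed
  qed
qed

unbundle Formal_Power_Series.fps_syntax

section \<open>Differential rings of germs\<close>

abbreviation cst :: "complex \<Rightarrow> 'm \<Rightarrow> complex" where
  "cst a \<equiv> \<lambda>_. a"

lemma cst_fun: "cst 0 = 0" "cst 1 = 1" "cst (a + b) = cst a + cst b" "cst (a * b) = cst a * cst b"
  "cst (- a) = - cst a" "cst (a - b) = cst a - cst b"
  by (simp_all add: fun_eq_iff)

lemma sum_fun_apply: "(\<Sum>k\<in>I. f k) x = (\<Sum>k\<in>I. f k x)"
  for f :: "'k \<Rightarrow> 'a \<Rightarrow> 'b::comm_monoid_add"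
  by (induction I rule: infinite_finite_induct) simp_all

text \<open>The algebra needed at \<open>x\<^sub>0\<close>: a ring \<open>R\<close> of functions with commuting derivations \<open>D\<^sub>i\<close> and coordinates \<open>X\<^sub>i\<close>. The
  ring of smooth functions on a chart neighbourhood is represented by functions that are zero outside it;
  therefore the unit \<open>e\<close> is an indicator function and not the constant \<open>1\<close>.\<close>

locale germ_ring =
  fixes R :: "('m \<Rightarrow> complex) set" and D :: "'n::finite \<Rightarrow> ('m \<Rightarrow> complex) \<Rightarrow> 'm \<Rightarrow> complex"
    and X :: "'n \<Rightarrow> 'm \<Rightarrow> complex" and e :: "'m \<Rightarrow> complex" and x\<^sub>0 :: 'm
  assumes e_in [simp, intro]: "e \<in> R" and e_unit [simp]: "f \<in> R \<Longrightarrow> e * f = f" and e_at [simp]: "e x\<^sub>0 = 1"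
    and add_in [simp, intro]: "f \<in> R \<Longrightarrow> g \<in> R \<Longrightarrow> f + g \<in> R"
    and mult_in [simp, intro]: "f \<in> R \<Longrightarrow> g \<in> R \<Longrightarrow> f * g \<in> R"
    and cst_in [simp, intro]: "f \<in> R \<Longrightarrow> cst a * f \<in> R"
    and D_in [simp, intro]: "f \<in> R \<Longrightarrow> D i f \<in> R"
    and D_add: "f \<in> R \<Longrightarrow> g \<in> R \<Longrightarrow> D i (f + g) = D i f + D i g"
    and D_mult: "f \<in> R \<Longrightarrow> g \<in> R \<Longrightarrow> D i (f * g) = D i f * g + f * D i g"
    and D_cst: "f \<in> R \<Longrightarrow> D i (cst a * f) = cst a * D i f"
    and D_comm: "f \<in> R \<Longrightarrow> D i (D j f) = D j (D i f)"
    and X_in [simp, intro]: "X i \<in> R" and X_at [simp]: "X i x\<^sub>0 = 0"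
    and D_X: "D i (X j) = (if i = j then e else 0)"

text \<open>Functions are calculated with as ring elements. The rules switched off here would push the
  evaluation of sums and products inside, and ring normalization would fail.\<close>

bundle pointwise_simps_off =
  plus_fun_apply [simp del] times_fun_apply [simp del] zero_fun_apply [simp del]
  one_fun_apply [simp del] minus_apply [simp del] uminus_apply [simp del] of_nat_fun_apply [simp del]

context germ_ring
begin

context
  includes pointwise_simps_off
begin

lemma at_point [simp]:
  "(f + g) x\<^sub>0 = f x\<^sub>0 + g x\<^sub>0" "(f * g) x\<^sub>0 = f x\<^sub>0 * g x\<^sub>0" "(0 :: 'm \<Rightarrow> complex) x\<^sub>0 = 0"
  "(f - g) x\<^sub>0 = f x\<^sub>0 - g x\<^sub>0" "(- f) x\<^sub>0 = - f x\<^sub>0" "(of_nat k :: 'm \<Rightarrow> complex) x\<^sub>0 = of_nat k"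
  "(1 :: 'm \<Rightarrow> complex) x\<^sub>0 = 1"
  for f g :: "'m \<Rightarrow> complex"
  by (simp_all add: plus_fun_apply times_fun_apply zero_fun_apply minus_apply uminus_apply of_nat_fun_apply one_fun_apply)

lemma zero_in [simp, intro]: "0 \<in> R"
  using cst_in[OF e_in, of 0] by (simp add: cst_fun)

lemma uminus_in [simp, intro]: "f \<in> R \<Longrightarrow> - f \<in> R"
  using cst_in[of f "-1"] by (simp add: cst_fun)

lemma diff_in [simp, intro]: "f \<in> R \<Longrightarrow> g \<in> R \<Longrightarrow> f - g \<in> R"
  using add_in[OF _ uminus_in, of f g] by simp

lemma sum_in [simp, intro]: "(\<And>k. k \<in> I \<Longrightarrow> f k \<in> R) \<Longrightarrow> sum f I \<in> R"
  by (induction I rule: infinite_finite_induct) auto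

lemma D_0 [simp]: "D i 0 = 0"
  using D_cst[OF e_in, of i 0] by (simp add: cst_fun)

lemma D_uminus: "f \<in> R \<Longrightarrow> D i (- f) = - D i f"
  using D_cst[of f i "-1"] by (simp add: cst_fun)

lemma D_diff: "f \<in> R \<Longrightarrow> g \<in> R \<Longrightarrow> D i (f - g) = D i f - D i g"
  using D_add[of f "- g" i] D_uminus[of g i] by simp

lemma D_sum: "(\<And>k. k \<in> I \<Longrightarrow> f k \<in> R) \<Longrightarrow> D i (sum f I) = (\<Sum>k\<in>I. D i (f k))"
  by (induction I rule: infinite_finite_induct) (auto simp: D_add)

lemma D_e [simp]: "D i e = 0"
proof -
  have "D i e * e = D i e" using e_unit[of "D i e"] by (simp only: mult.commute[of "D i e" e]) auto
  then have "D i (e * e) = D i e + D i e" using D_mult[of e e i] by simp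
  moreover have "e * e = e" by (rule e_unit) simp
  ultimately show ?thesis by (simp only: add_cancel_right_right)
qed

lemma power_in: "h \<in> R \<Longrightarrow> f \<in> R \<Longrightarrow> h ^ j * f \<in> R"
  by (induction j) (auto simp: mult.assoc)

lemma D_power_mult:
  assumes h: "h \<in> R" and f: "f \<in> R"
  shows "D i (h ^ j * f) = of_nat j * (h ^ (j - 1) * (D i h * f)) + h ^ j * D i f"
  using f
proof (induction j arbitrary: f)
  case (Suc j)
  have "D i (h ^ Suc j * f) = D i (h ^ j * (h * f))" by (simp add: mult_ac)
  also have "\<dots> = of_nat j * (h ^ (j - 1) * (D i h * (h * f))) + h ^ j * (D i h * f + h * D i f)"
    using Suc h by (simp add: D_mult mult_in)
  also have "of_nat j * (h ^ (j - 1) * (D i h * (h * f))) = of_nat j * (h ^ j * (D i h * f))"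
    by (cases j) (simp_all add: mult_ac)
  finally show ?case by (simp add: algebra_simps)
qed simp

subsection \<open>Order of vanishing\<close>

text \<open>\<open>vanish n f\<close> expresses that all derivatives of \<open>f\<close> of order less than \<open>n\<close> are zero at \<open>x\<^sub>0\<close>.\<close>

primrec vanish :: "nat \<Rightarrow> ('m \<Rightarrow> complex) \<Rightarrow> bool" where
  "vanish 0 f \<longleftrightarrow> True"
| "vanish (Suc n) f \<longleftrightarrow> f x\<^sub>0 = 0 \<and> (\<forall>i. vanish n (D i f))"

lemma vanish_Suc_imp: "vanish (Suc n) f \<Longrightarrow> vanish n f"
  by (induction n arbitrary: f) auto

lemma vanish_mono: "m \<le> n \<Longrightarrow> vanish n f \<Longrightarrow> vanish m f"
  by (induction rule: inc_induct) (auto dest: vanish_Suc_imp simp del: vanish.simps)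

lemma vanish_zero [simp]: "vanish n 0"
  by (induction n) auto

lemma vanish_add: "f \<in> R \<Longrightarrow> g \<in> R \<Longrightarrow> vanish n f \<Longrightarrow> vanish n g \<Longrightarrow> vanish n (f + g)"
  by (induction n arbitrary: f g) (auto simp: D_add)

lemma vanish_cst: "f \<in> R \<Longrightarrow> vanish n f \<Longrightarrow> vanish n (cst a * f)"
  by (induction n arbitrary: f) (auto simp: D_cst)

lemma vanish_sum: "(\<And>k. k \<in> I \<Longrightarrow> f k \<in> R \<and> vanish n (f k)) \<Longrightarrow> vanish n (sum f I)"
  by (induction I rule: infinite_finite_induct) (auto intro: vanish_add)

lemma vanish_mult:
  "f \<in> R \<Longrightarrow> g \<in> R \<Longrightarrow> vanish a f \<Longrightarrow> vanish b g \<Longrightarrow> vanish (a + b) (f * g)"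
proof (induction "a + b" arbitrary: a b f g)
  case (Suc n)
  have "(f * g) x\<^sub>0 = 0" using Suc.hyps(2) Suc.prems(3,4) by (cases a; cases b) auto
  moreover have "vanish n (D i f * g + f * D i g)" for i
  proof (rule vanish_add)
    show "vanish n (D i f * g)"
    proof (cases a)
      case 0
      then have "vanish (0 + n) (D i f * g)"
        using Suc.hyps(2) Suc.prems by (intro Suc.hyps(1)) (auto intro: vanish_mono[of n b] simp del: vanish.simps(2))
      then show ?thesis by simp
    next
      case (Suc a')
      then have "vanish (a' + b) (D i f * g)"
        using Suc.hyps(2) Suc.prems Suc.hyps(1)[of a' b "D i f" g] \<open>Suc n = a + b\<close>
        by auto
      then show ?thesis using Suc.hyps(2) Suc by simp
    qed
    show "vanish n (f * D i g)"
    proof (cases b)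
      case 0
      then have "vanish (n + 0) (f * D i g)"
        using Suc.hyps(2) Suc.prems by (intro Suc.hyps(1)) (auto intro: vanish_mono[of n a] simp del: vanish.simps(2))
      then show ?thesis by simp
    next
      case (Suc b')
      then have "vanish (a + b') (f * D i g)"
        using Suc.hyps(2) Suc.prems Suc.hyps(1)[of a b' f "D i g"] \<open>Suc n = a + b\<close>
        by auto
      then show ?thesis using Suc.hyps(2) Suc by simp
    qed
  qed (use Suc.prems in auto)
  ultimately show ?case using Suc.hyps(2)[symmetric] Suc.prems by (simp add: D_mult)
qed simp

lemma vanish_power_mult:
  assumes "h \<in> R" "vanish k h" "f \<in> R" "vanish m f"
  shows "vanish (j * k + m) (h ^ j * f)"
proof (induction j)
  case (Suc j)
  then have "vanish (k + (j * k + m)) (h * (h ^ j * f))"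
    using assms power_in[OF assms(1,3)] vanish_mult[of h "h ^ j * f"] by blast
  then show ?case by (simp add: mult_ac add_ac)
qed (use assms in simp)

text \<open>Euler's identity: on the homogeneous Taylor component of degree \<open>m\<close> the operator \<open>\<Sum>\<^sub>j X\<^sub>j D\<^sub>j\<close> is
  multiplication by \<open>m\<close>. Up to higher order, this writes a function of order \<open>m\<close> as a combination of
  the coordinates, without a Taylor formula with remainder.\<close>

lemma euler_vanish:
  "f \<in> R \<Longrightarrow> vanish m f \<Longrightarrow> vanish (Suc m) ((\<Sum>j\<in>UNIV. X j * D j f) - cst (of_nat m) * f)"
proof (induction m arbitrary: f)
  case 0
  then show ?case by (simp add: sum_fun_apply)
next
  case (Suc m)
  let ?E = "\<lambda>m f. (\<Sum>j\<in>UNIV. X j * D j f) - cst (of_nat m) * f"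
  have "D i (?E (Suc m) f) = ?E m (D i f)" for i
  proof -
    have "D i (X j * D j f) = (if i = j then D i f else 0) + X j * D j (D i f)" for j
      using Suc.prems by (simp add: D_mult D_X D_comm[of f i j])
    then have "D i (?E (Suc m) f) = (\<Sum>j\<in>UNIV. (if i = j then D i f else 0) + X j * D j (D i f))
        - cst (of_nat (Suc m)) * D i f"
      using Suc.prems by (simp add: D_diff D_sum D_cst)
    also have "\<dots> = ?E m (D i f)"
      by (simp add: sum.distrib cst_fun algebra_simps)
    finally show ?thesis .
  qed
  moreover have "?E (Suc m) f x\<^sub>0 = 0" using Suc.prems by (simp add: sum_fun_apply)
  moreover have "vanish (Suc m) (?E m (D i f))" for i
    using Suc.prems by (intro Suc.IH) auto
  ultimately show ?case by (simp del: vanish.simps add: vanish.simps(2)[of "Suc m"])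
qed

subsection \<open>Distributions supported at the point\<close>

text \<open>The functionals \<open>f \<mapsto> \<Sum> a\<^sub>i\<^sub>s (D\<^sub>i\<^sub>s f)(x\<^sub>0)\<close>. The last rule makes the values outside \<open>R\<close> irrelevant, so that an
  identity that holds on \<open>R\<close> only can be used to establish membership.\<close>

inductive point_functional :: "(('m \<Rightarrow> complex) \<Rightarrow> complex) \<Rightarrow> bool" where
  eval: "point_functional (\<lambda>f. f x\<^sub>0)"
| derivative: "point_functional L \<Longrightarrow> point_functional (\<lambda>f. L (D i f))"
| plus: "point_functional L \<Longrightarrow> point_functional K \<Longrightarrow> point_functional (\<lambda>f. L f + K f)"
| scale: "point_functional L \<Longrightarrow> point_functional (\<lambda>f. a * L f)"
| agree: "point_functional L \<Longrightarrow> (\<And>f. f \<in> R \<Longrightarrow> K f = L f) \<Longrightarrow> point_functional K"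

lemma point_functional_add:
  "point_functional L \<Longrightarrow> f \<in> R \<Longrightarrow> g \<in> R \<Longrightarrow> L (f + g) = L f + L g"
  by (induction arbitrary: f g rule: point_functional.induct)
    (auto simp: D_add distrib_left)

lemma point_functional_cst:
  "point_functional L \<Longrightarrow> f \<in> R \<Longrightarrow> L (cst a * f) = a * L f"
  by (induction arbitrary: f rule: point_functional.induct)
    (auto simp: D_cst distrib_left mult.left_commute)

lemma point_functional_0: "point_functional L \<Longrightarrow> L 0 = 0"
  using point_functional_cst[of L 0 0] by simp

lemma point_functional_diff:
  "point_functional L \<Longrightarrow> f \<in> R \<Longrightarrow> g \<in> R \<Longrightarrow> L (f - g) = L f - L g"
  using point_functional_add[of L "f - g" g] by simp

lemma point_functional_sum_arg:
  "point_functional L \<Longrightarrow> (\<And>k. k \<in> I \<Longrightarrow> f k \<in> R) \<Longrightarrow> L (sum f I) = (\<Sum>k\<in>I. L (f k))"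
  by (induction I rule: infinite_finite_induct)
    (auto simp: point_functional_0 point_functional_add)

lemma point_functional_zero: "point_functional (\<lambda>f. 0)"
  using point_functional.scale[OF eval, of 0] by simp

lemma point_functional_sum:
  "(\<And>k. k \<in> I \<Longrightarrow> point_functional (L k)) \<Longrightarrow> point_functional (\<lambda>f. \<Sum>k\<in>I. L k f)"
  by (induction I rule: infinite_finite_induct) (auto intro: point_functional.plus point_functional_zero)

lemma point_functional_minus:
  "point_functional L \<Longrightarrow> point_functional K \<Longrightarrow> point_functional (\<lambda>f. L f - K f)"
  using point_functional.plus[OF _ scale[of K "-1"], of L] by simp

text \<open>By the product rule, multiplication is dual to an operation on distributions; this gives
  the twist of a family of distributions by an amplitude.\<close>

lemma point_functional_mult:
  "point_functional L \<Longrightarrow> g \<in> R \<Longrightarrow> point_functional (\<lambda>f. L (g * f))"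
proof (induction arbitrary: g rule: point_functional.induct)
  case eval
  show ?case using point_functional.scale[OF point_functional.eval, of "g x\<^sub>0"] by simp
next
  case (derivative L i)
  have "point_functional (\<lambda>f. L (D i g * f) + L (g * D i f))"
    using derivative by (intro point_functional.plus point_functional.derivative[of "\<lambda>f. L (g * f)"]) auto
  then show ?case
    by (rule point_functional.agree) (use derivative in \<open>simp add: D_mult point_functional_add\<close>)
next
  case (agree L K)
  show ?case by (rule point_functional.agree[OF agree.IH[OF agree.prems]]) (use agree in auto)
qed (auto intro: point_functional.plus point_functional.scale)

lemma point_functional_order:
  "point_functional L \<Longrightarrow> \<exists>N. \<forall>f\<in>R. vanish N f \<longrightarrow> L f = 0"
proof (induction rule: point_functional.induct)
  case eval
  show ?case by (intro exI[of _ 1]) simp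
next
  case (derivative L i)
  then obtain N where "\<forall>f\<in>R. vanish N f \<longrightarrow> L f = 0" by blast
  then show ?case by (intro exI[of _ "Suc N"]) auto
next
  case (plus L K)
  then obtain N M where "\<forall>f\<in>R. vanish N f \<longrightarrow> L f = 0" "\<forall>f\<in>R. vanish M f \<longrightarrow> K f = 0" by blast
  then show ?case
    using vanish_mono[of N "max N M"] vanish_mono[of M "max N M"] by (intro exI[of _ "max N M"]) simp
qed auto

lemma point_functional_flat:
  "point_functional L \<Longrightarrow> f \<in> R \<Longrightarrow> (\<And>n. vanish n f) \<Longrightarrow> L f = 0"
  using point_functional_order by blast

primrec Ds :: "'n list \<Rightarrow> ('m \<Rightarrow> complex) \<Rightarrow> 'm \<Rightarrow> complex" where
  "Ds [] f = f"
| "Ds (i # is) f = D i (Ds is f)"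

lemma Ds_append: "Ds (is @ js) f = Ds is (Ds js f)"
  by (induction "is") auto

lemma Ds_snoc: "Ds (is @ [i]) f = Ds is (D i f)"
  by (simp add: Ds_append)

lemma point_functional_representation:
  "point_functional L \<Longrightarrow>
    \<exists>I a. finite I \<and> (\<forall>f\<in>R. L f = (\<Sum>is\<in>I. a is * Ds is f x\<^sub>0))"
proof (induction rule: point_functional.induct)
  case eval
  show ?case by (intro exI[of _ "{[]}"] exI[of _ "\<lambda>_. 1"]) simp
next
  case (derivative L i)
  then obtain I a where *: "finite I" "\<forall>f\<in>R. L f = (\<Sum>is\<in>I. a is * Ds is f x\<^sub>0)" by blast
  have "(\<Sum>js\<in>(\<lambda>is. is @ [i]) ` I. a (butlast js) * Ds js f x\<^sub>0) =
      (\<Sum>is\<in>I. a is * Ds is (D i f) x\<^sub>0)" for f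
    by (subst sum.reindex) (auto simp: inj_on_def Ds_snoc)
  with * show ?case
    by (intro exI[of _ "(\<lambda>is. is @ [i]) ` I"] exI[of _ "\<lambda>js. a (butlast js)"]) auto
next
  case (plus L K)
  then obtain I a J b where *: "finite I" "\<forall>f\<in>R. L f = (\<Sum>is\<in>I. a is * Ds is f x\<^sub>0)"
    "finite J" "\<forall>f\<in>R. K f = (\<Sum>is\<in>J. b is * Ds is f x\<^sub>0)" by blast
  define c where "c is = (if is \<in> I then a is else 0) + (if is \<in> J then b is else 0)" for "is"
  have "(\<Sum>is\<in>I. a is * Ds is f x\<^sub>0) = (\<Sum>is\<in>I \<union> J. (if is \<in> I then a is else 0) * Ds is f x\<^sub>0)"
    "(\<Sum>is\<in>J. b is * Ds is f x\<^sub>0) = (\<Sum>is\<in>I \<union> J. (if is \<in> J then b is else 0) * Ds is f x\<^sub>0)" for f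
    using *(1,3) by (auto intro!: sum.mono_neutral_cong_left)
  with * show ?case
    by (intro exI[of _ "I \<union> J"] exI[of _ c])
      (auto simp: c_def distrib_right sum.distrib)
next
  case (scale L a)
  then obtain I b where *: "finite I" "\<forall>f\<in>R. L f = (\<Sum>is\<in>I. b is * Ds is f x\<^sub>0)" by blast
  then show ?case
    by (intro exI[of _ I] exI[of _ "\<lambda>is. a * b is"]) (auto simp: sum_distrib_left mult_ac)
next
  case (agree L K)
  then show ?case by auto
qed

end

end

context germ_ring
begin

context
  includes pointwise_simps_off
begin

section \<open>The stationary phase expansion\<close>

subsection \<open>Functionals that kill a gradient ideal\<close>

lemma e_unit_right [simp]: "f \<in> R \<Longrightarrow> f * e = f"
  using e_unit[of f] by (simp only: mult.commute)

text \<open>At a nondegenerate critical point suitable linear combinations \<open>Y\<^sub>j\<close> of the \<open>D\<^sub>i \<psi>\<close> agree with the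
  coordinates \<open>X\<^sub>j\<close> to second order. With Euler's identity, a function of order \<open>m \<ge> 1\<close> is
  \<open>1/m \<Sum>\<^sub>j Y\<^sub>j D\<^sub>j f\<close>, which \<open>L\<close> kills, plus a function of higher order. As \<open>L\<close> has finite order, it kills
  all functions vanishing at \<open>x\<^sub>0\<close>.\<close>

lemma point_functional_killing_gradient:
  assumes \<psi>: "\<psi> \<in> R" "\<And>i. D i \<psi> x\<^sub>0 = 0" and inv: "\<And>j l. (\<Sum>i\<in>UNIV. H' j i * D i (D l \<psi>) x\<^sub>0) = (if j = l then 1 else 0)"
    and L: "point_functional L" and kill: "\<And>i w. w \<in> R \<Longrightarrow> L (w * D i \<psi>) = 0"
    and f: "f \<in> R"
  shows "L f = f x\<^sub>0 * L e"
proof -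
  obtain N where N: "\<And>f. f \<in> R \<Longrightarrow> vanish N f \<Longrightarrow> L f = 0"
    using point_functional_order[OF L] by blast
  define Y where "Y j = (\<Sum>i\<in>UNIV. cst (H' j i) * D i \<psi>)" for j
  have Y: "Y j \<in> R" for j using \<psi> by (simp add: Y_def)
  have LY: "L (Y j * w) = 0" if "w \<in> R" for j w
  proof -
    have "Y j * w = (\<Sum>i\<in>UNIV. cst (H' j i) * (w * D i \<psi>))"
      unfolding Y_def sum_distrib_right by (simp add: mult_ac)
    then show ?thesis
      using that \<psi> kill by (simp add: point_functional_sum_arg[OF L] point_functional_cst[OF L])
  qed
  have YX: "vanish 2 (X j - Y j)" for j
  proof -
    have "(X j - Y j) x\<^sub>0 = 0" using \<psi> by (simp add: Y_def sum_fun_apply)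
    moreover have "D l (X j - Y j) x\<^sub>0 = 0" for l
    proof -
      have "D l (X j - Y j) = (if l = j then e else 0) - (\<Sum>i\<in>UNIV. cst (H' j i) * D i (D l \<psi>))"
        using \<psi> Y by (simp add: D_diff D_X Y_def D_sum D_cst D_comm[of \<psi> l])
      then show ?thesis using inv[of j l] by (simp add: sum_fun_apply)
    qed
    ultimately show ?thesis by (simp add: numeral_2_eq_2)
  qed
  \<comment> \<open>downward induction from the order N of L\<close>
  have "vanish m f \<longrightarrow> L f = 0" if "m \<ge> 1" "f \<in> R" for m f
  proof (cases "m \<le> N")
    case True
    then show ?thesis using that
    proof (induction m arbitrary: f rule: inc_induct)
      case base
      then show ?case using N by blast
    next
      case (step m)
      show ?case
      proof
        assume v: "vanish m f"
        define r where "r = (\<Sum>j\<in>UNIV. X j * D j f) - cst (of_nat m) * f"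
        define s where "s = (\<Sum>j\<in>UNIV. (X j - Y j) * D j f)"
        have rR: "r \<in> R" and sR: "s \<in> R" using step.prems Y by (auto simp: r_def s_def)
        have "vanish (Suc m) r" using euler_vanish[OF step.prems(2) v] by (simp add: r_def)
        then have Lr: "L r = 0" using step.IH rR by simp
        have "vanish (2 + (m - 1)) ((X j - Y j) * D j f)" for j
          using v step.prems Y by (intro vanish_mult YX) (cases m; auto)+
        then have "vanish (Suc m) s"
          unfolding s_def using step.prems Y by (intro vanish_sum) auto
        then have Ls: "L s = 0" using step.IH sR by simp
        have "cst (of_nat m) * f = (\<Sum>j\<in>UNIV. Y j * D j f) + s - r"
          by (simp add: r_def s_def left_diff_distrib sum_subtractf)
        then have "of_nat m * L f = L ((\<Sum>j\<in>UNIV. Y j * D j f) + s - r)"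
          using point_functional_cst[OF L step.prems(2), of "of_nat m"] by simp
        also have "\<dots> = (\<Sum>j\<in>UNIV. L (Y j * D j f)) + L s - L r"
          using step.prems Y sR rR
          by (simp add: point_functional_diff[OF L] point_functional_add[OF L] point_functional_sum_arg[OF L])
        finally show "L f = 0" using step.prems Lr Ls by (simp add: LY)
      qed
    qed
  next
    case False
    then show ?thesis using N vanish_mono[of N m f] that by auto
  qed
  from this[of 1 "f - cst (f x\<^sub>0) * e"] have "L (f - cst (f x\<^sub>0) * e) = 0"
    using f by simp
  then show ?thesis
    using f by (simp add: point_functional_diff[OF L] point_functional_cst[OF L])
qed

end

end

subsection \<open>Gaussian functionals\<close>

text \<open>Formal Gaussian integration with the quadratic phase \<open>q\<close> whose Hessian is \<open>H\<close>; the matrix \<open>K\<close> is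
  \<open>-H\<^sup>-\<^sup>1/2\<close>, half the covariance divided by \<open>\<nu>\<close>.\<close>

locale gaussian = germ_ring R D X e x\<^sub>0
  for R :: "('m \<Rightarrow> complex) set" and D :: "'n::finite \<Rightarrow> ('m \<Rightarrow> complex) \<Rightarrow> 'm \<Rightarrow> complex"
    and X :: "'n \<Rightarrow> 'm \<Rightarrow> complex" and e :: "'m \<Rightarrow> complex" and x\<^sub>0 :: 'm +
  fixes H K :: "'n \<Rightarrow> 'n \<Rightarrow> complex"
  assumes K_sym: "K i j = K j i" and H_sym: "H i j = H j i"
    and HK: "(\<Sum>l\<in>UNIV. H j l * K l i) = (if j = i then - 1/2 else 0)"
begin

context
  includes pointwise_simps_off
begin

definition lap :: "('m \<Rightarrow> complex) \<Rightarrow> 'm \<Rightarrow> complex" where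
  "lap f = (\<Sum>i\<in>UNIV. \<Sum>j\<in>UNIV. cst (K i j) * D i (D j f))"

text \<open>The coefficient of \<open>\<nu>\<^sup>k\<close> in \<open>(e\<^bsup>\<nu> lap\<^esup> f)(x\<^sub>0)\<close>, the normalized integral of \<open>e\<^bsup>q/\<nu>\<^esup> f\<close>.\<close>

definition gauss :: "nat \<Rightarrow> ('m \<Rightarrow> complex) \<Rightarrow> complex" where
  "gauss k f = (lap ^^ k) f x\<^sub>0 / fact k"

definition dq :: "'n \<Rightarrow> 'm \<Rightarrow> complex" where
  "dq j = (\<Sum>l\<in>UNIV. cst (H j l) * X l)"

definition q :: "'m \<Rightarrow> complex" where
  "q = cst (1/2) * (\<Sum>j\<in>UNIV. dq j * X j)"

lemma lap_in [simp, intro]: "f \<in> R \<Longrightarrow> lap f \<in> R"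
  by (simp add: lap_def)

lemma lap_pow_in [simp, intro]: "f \<in> R \<Longrightarrow> (lap ^^ k) f \<in> R"
  by (induction k) auto

lemma lap_add: "f \<in> R \<Longrightarrow> g \<in> R \<Longrightarrow> lap (f + g) = lap f + lap g"
  by (simp add: lap_def D_add distrib_left sum.distrib)

lemma lap_cst: "f \<in> R \<Longrightarrow> lap (cst a * f) = cst a * lap f"
  by (simp add: lap_def D_cst sum_distrib_left mult.left_commute)

lemma D_lap: "f \<in> R \<Longrightarrow> D i (lap f) = lap (D i f)"
proof -
  assume f: "f \<in> R"
  have "D i (D j (D k f)) = D j (D k (D i f))" for j k
    using f by (simp add: D_comm[of _ i j] D_comm[of _ i k])
  then show ?thesis using f by (simp add: lap_def D_sum D_cst)
qed

lemma D_lap_pow: "f \<in> R \<Longrightarrow> D i ((lap ^^ k) f) = (lap ^^ k) (D i f)"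
  by (induction k arbitrary: f) (simp_all add: D_lap)

lemma lap_pow_add: "f \<in> R \<Longrightarrow> g \<in> R \<Longrightarrow> (lap ^^ k) (f + g) = (lap ^^ k) f + (lap ^^ k) g"
  by (induction k) (simp_all add: lap_add)

lemma lap_pow_cst: "f \<in> R \<Longrightarrow> (lap ^^ k) (cst a * f) = cst a * (lap ^^ k) f"
  by (induction k) (simp_all add: lap_cst)

text \<open>The commutator of a second-order operator with a coordinate is a first-order operator commuting
  with both; iterating this gives \<open>lap_pow_X_mult\<close> and Wick's recursion \<open>gauss_X_mult\<close>.\<close>

lemma lap_X_mult:
  assumes g: "g \<in> R"
  shows "lap (X l * g) = X l * lap g + cst 2 * (\<Sum>i\<in>UNIV. cst (K l i) * D i g)"
proof -
  have "D i (D j (X l * g)) = (if j = l then D i g else 0) + ((if i = l then D j g else 0) + X l * D i (D j g))"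
    for i j
    using g by (simp add: D_mult D_X D_add )
  then have "lap (X l * g) = (\<Sum>i\<in>UNIV. \<Sum>j\<in>UNIV. (if j = l then cst (K i j) * D i g else 0))
      + ((\<Sum>i\<in>UNIV. \<Sum>j\<in>UNIV. if i = l then cst (K i j) * D j g else 0)
      + (\<Sum>i\<in>UNIV. \<Sum>j\<in>UNIV. X l * (cst (K i j) * D i (D j g))))"
    unfolding lap_def sum.distrib[symmetric]
    by (intro sum.cong refl) (simp add: distrib_left mult_ac)
  also have "(\<Sum>i\<in>UNIV. \<Sum>j\<in>UNIV. (if j = l then cst (K i j) * D i g else 0)) = (\<Sum>i\<in>UNIV. cst (K l i) * D i g)"
    by (simp add: K_sym[of _ l])
  also have "(\<Sum>i\<in>UNIV. \<Sum>j\<in>UNIV. if i = l then cst (K i j) * D j g else 0) = (\<Sum>i\<in>UNIV. cst (K l i) * D i g)"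
    by (subst sum.swap) simp
  also have "(\<Sum>i\<in>UNIV. \<Sum>j\<in>UNIV. X l * (cst (K i j) * D i (D j g))) = X l * lap g"
    by (simp add: lap_def sum_distrib_left)
  also have "(\<Sum>i\<in>UNIV. cst (K l i) * D i g) + ((\<Sum>i\<in>UNIV. cst (K l i) * D i g) + X l * lap g) =
      X l * lap g + cst 2 * (\<Sum>i\<in>UNIV. cst (K l i) * D i g)"
  proof -
    have "cst 2 * y = y + y" for y :: "'m \<Rightarrow> complex"
      by (simp add: fun_eq_iff times_fun_apply plus_fun_apply)
    then show ?thesis by (simp only: add_ac)
  qed
  finally show ?thesis .
qed

lemma lap_pow_X_mult:
  "g \<in> R \<Longrightarrow> (lap ^^ Suc k) (X l * g) =
    X l * (lap ^^ Suc k) g + cst (2 * of_nat (Suc k)) * (\<Sum>i\<in>UNIV. cst (K l i) * (lap ^^ k) (D i g))"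
proof (induction k)
  case 0
  then show ?case by (simp add: lap_X_mult)
next
  case (Suc k)
  let ?S = "\<lambda>k. \<Sum>i\<in>UNIV. cst (K l i) * (lap ^^ k) (D i g)"
  have lapS: "lap (?S k) = ?S (Suc k)" for k
  proof -
    have *: "finite I \<Longrightarrow> lap (\<Sum>i\<in>I. cst (K l i) * (lap ^^ k) (D i g)) =
        (\<Sum>i\<in>I. cst (K l i) * (lap ^^ Suc k) (D i g))" for I
    proof (induction I rule: finite_induct)
      case empty
      show ?case using lap_cst[OF e_in, of 0] by (simp add: cst_fun)
    next
      case (insert i I)
      then show ?case using Suc.prems by (simp add: lap_add lap_cst)
    qed
    show ?thesis by (rule *) simp
  qed
  have SR: "?S k \<in> R" using Suc.prems by auto
  have "(lap ^^ Suc (Suc k)) (X l * g) = lap (X l * (lap ^^ Suc k) g + cst (2 * of_nat (Suc k)) * ?S k)"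
    using Suc by simp
  also have "\<dots> = X l * (lap ^^ Suc (Suc k)) g + cst 2 * (\<Sum>i\<in>UNIV. cst (K l i) * D i ((lap ^^ Suc k) g))
      + cst (2 * of_nat (Suc k)) * ?S (Suc k)"
    using Suc.prems SR lap_pow_in[OF Suc.prems, of "Suc k"]
    by (simp only: lap_add mult_in X_in cst_in lap_X_mult lap_cst lapS funpow.simps(2) o_apply)
  also have "(\<Sum>i\<in>UNIV. cst (K l i) * D i ((lap ^^ Suc k) g)) = ?S (Suc k)"
    using Suc.prems by (simp only: D_lap_pow)
  also have "X l * (lap ^^ Suc (Suc k)) g + cst 2 * ?S (Suc k) + cst (2 * of_nat (Suc k)) * ?S (Suc k) =
      X l * (lap ^^ Suc (Suc k)) g + cst (2 * of_nat (Suc (Suc k))) * ?S (Suc k)"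
  proof -
    have "2 * of_nat (Suc (Suc k)) = (2 :: complex) + 2 * of_nat (Suc k)" by simp
    then show ?thesis by (simp only: cst_fun(3) distrib_right add.assoc)
  qed
  finally show ?case .
qed

lemma gauss_add: "f \<in> R \<Longrightarrow> g \<in> R \<Longrightarrow> gauss k (f + g) = gauss k f + gauss k g"
  by (simp add: gauss_def lap_pow_add add_divide_distrib)

lemma gauss_cst: "f \<in> R \<Longrightarrow> gauss k (cst a * f) = a * gauss k f"
  by (simp add: gauss_def lap_pow_cst)

lemma gauss_sum: "(\<And>i. i \<in> I \<Longrightarrow> f i \<in> R) \<Longrightarrow> gauss k (sum f I) = (\<Sum>i\<in>I. gauss k (f i))"
proof (induction I rule: infinite_finite_induct)
  case empty
  show ?case using gauss_cst[OF e_in, of k 0] by (simp add: cst_fun)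
next
  case (infinite A)
  show ?case using infinite gauss_cst[OF e_in, of k 0] by (simp add: cst_fun)
qed (simp add: gauss_add)

lemma gauss_X_mult:
  "g \<in> R \<Longrightarrow> gauss (Suc k) (X l * g) = 2 * (\<Sum>i\<in>UNIV. K l i * gauss k (D i g))"
  unfolding gauss_def lap_pow_X_mult
  by (simp add: sum_fun_apply sum_distrib_left sum_divide_distrib field_simps del: of_nat_Suc)

lemma dq_in [simp, intro]: "dq j \<in> R" and q_in [simp, intro]: "q \<in> R"
  by (simp_all add: dq_def q_def)

lemma D_dq: "D i (dq j) = cst (H j i) * e"
proof -
  have "D i (dq j) = (\<Sum>l\<in>UNIV. if i = l then cst (H j l) * e else 0)"
    by (simp add: dq_def D_sum D_cst D_X if_distrib cong: if_cong)
  then show ?thesis by simp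
qed

lemma D_q: "D i q = dq i"
proof -
  have "D i q = cst (1/2) * (\<Sum>j\<in>UNIV. cst (H j i) * X j + (if i = j then dq j else 0))"
    by (simp add: q_def D_cst D_sum D_mult D_dq D_X mult.assoc if_distrib  cong: if_cong)
  also have "(\<Sum>j\<in>UNIV. cst (H j i) * X j + (if i = j then dq j else 0)) = dq i + dq i"
    by (simp add: sum.distrib dq_def H_sym[of _ i])
  also have "cst (1/2) * (dq i + dq i) = cst (1/2 + 1/2) * dq i"
    by (simp only: cst_fun(3) distrib_right distrib_left)
  finally show ?thesis by (simp add: cst_fun(2))
qed

text \<open>Integration by parts: formally the integral of \<open>D\<^sub>j(e\<^bsup>q/\<nu>\<^esup> g)\<close> vanishes. The factor \<open>1/\<nu>\<close> accounts for the shift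
  of the index.\<close>

lemma gauss_dq_mult: "g \<in> R \<Longrightarrow> gauss (Suc k) (dq j * g) = - gauss k (D j g)"
proof -
  assume g: "g \<in> R"
  have "dq j * g = (\<Sum>l\<in>UNIV. cst (H j l) * (X l * g))"
    by (simp add: dq_def sum_distrib_right mult.assoc)
  then have "gauss (Suc k) (dq j * g) = (\<Sum>l\<in>UNIV. H j l * (2 * (\<Sum>i\<in>UNIV. K l i * gauss k (D i g))))"
    using g by (simp add: gauss_sum gauss_cst gauss_X_mult)
  also have "\<dots> = (\<Sum>i\<in>UNIV. 2 * (\<Sum>l\<in>UNIV. H j l * K l i) * gauss k (D i g))"
    unfolding sum_distrib_left sum_distrib_right by (subst sum.swap) (simp add: mult_ac)
  also have "\<dots> = - gauss k (D j g)"
    by (simp add: HK if_distrib[of "\<lambda>z. 2 * z * _"] cong: if_cong)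
  finally show ?thesis .
qed

text \<open>Applying Wick's recursion once contracts the Euler operator to \<open>2 lap\<close>, and \<open>G\<^sub>k\<^sub>-\<^sub>1(lap g) = k G\<^sub>k(g)\<close>.\<close>

lemma gauss_euler: "g \<in> R \<Longrightarrow> (\<Sum>j\<in>UNIV. gauss k (X j * D j g)) = 2 * of_nat k * gauss k g"
proof (cases k)
  case 0
  then show ?thesis by (simp add: gauss_def)
next
  case (Suc k')
  assume g: "g \<in> R"
  have "(\<Sum>j\<in>UNIV. gauss k (X j * D j g)) = 2 * gauss k' (lap g)"
    using g by (simp add: Suc gauss_X_mult lap_def gauss_sum gauss_cst sum_distrib_left)
      (simp add: D_comm)
  also have "gauss k' (lap g) = of_nat k * gauss k g"
    by (simp add: Suc gauss_def funpow_swap1 field_simps del: of_nat_Suc)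
  finally show ?thesis by simp
qed

text \<open>Since \<open>q\<close> is half of \<open>\<Sum>\<^sub>j (D\<^sub>j q) X\<^sub>j\<close>, integration by parts leaves \<open>-1/2 \<Sum>\<^sub>j D\<^sub>j(X\<^sub>j g)\<close>. The dimension \<open>n\<close> enters
  through \<open>\<Sum>\<^sub>j D\<^sub>j X\<^sub>j\<close>; this is the source of the term \<open>n/(2\<nu>)\<close> in strong association.\<close>

lemma gauss_q_mult:
  assumes g: "g \<in> R"
  shows "gauss (Suc k) (q * g) = - (of_nat CARD('n) / 2 + of_nat k) * gauss k g"
proof -
  have "q * g = (\<Sum>j\<in>UNIV. cst (1/2) * (dq j * (X j * g)))"
    by (simp add: q_def sum_distrib_left sum_distrib_right mult.assoc)
  then have "gauss (Suc k) (q * g) = (\<Sum>j\<in>UNIV. - (1/2) * gauss k (D j (X j * g)))"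
    using g by (simp add: gauss_sum gauss_cst gauss_dq_mult)
  also have "\<dots> = (\<Sum>j\<in>(UNIV::'n set). - (1/2) * (gauss k g + gauss k (X j * D j g)))"
    using g by (simp add: D_mult D_X gauss_add)
  also have "\<dots> = - (1/2) * (of_nat CARD('n) * gauss k g + (\<Sum>j\<in>UNIV. gauss k (X j * D j g)))"
    by (simp only: sum_distrib_left[symmetric] sum.distrib sum_constant)
  also have "\<dots> = - (of_nat CARD('n) / 2 + of_nat k) * gauss k g"
    unfolding gauss_euler[OF g, of k] by (simp add: field_simps)
  finally show ?thesis .
qed

lemma vanish_lap: "f \<in> R \<Longrightarrow> vanish (Suc (Suc n)) f \<Longrightarrow> vanish n (lap f)"
  unfolding lap_def by (intro vanish_sum conjI vanish_cst) auto

lemma gauss_vanish: "f \<in> R \<Longrightarrow> vanish (Suc (2 * k)) f \<Longrightarrow> gauss k f = 0"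
proof -
  have "f \<in> R \<Longrightarrow> vanish (Suc (2 * k)) f \<Longrightarrow> vanish 1 ((lap ^^ k) f)"
  proof (induction k arbitrary: f)
    case (Suc k)
    have "vanish 1 ((lap ^^ k) (lap f))"
      using Suc.prems by (intro Suc.IH vanish_lap) simp_all
    then show ?case by (simp add: funpow_swap1 del: vanish.simps)
  qed simp
  then show "f \<in> R \<Longrightarrow> vanish (Suc (2 * k)) f \<Longrightarrow> gauss k f = 0" by (simp add: gauss_def)
qed

lemma point_functional_gauss: "point_functional (gauss k)"
proof -
  have lap: "point_functional (\<lambda>f. L (lap f))" if "point_functional L" for L
  proof (rule point_functional.agree)
    show "point_functional (\<lambda>f. \<Sum>i\<in>UNIV. \<Sum>j\<in>UNIV. K i j * L (D i (D j f)))"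
      using point_functional.derivative[OF point_functional.derivative[OF that]]
      by (intro point_functional_sum point_functional.scale)
    show "L (lap f) = (\<Sum>i\<in>UNIV. \<Sum>j\<in>UNIV. K i j * L (D i (D j f)))" if "f \<in> R" for f
      using that \<open>point_functional L\<close>
      by (simp add: lap_def point_functional_sum_arg point_functional_cst)
  qed
  have "point_functional (\<lambda>f. (lap ^^ k) f x\<^sub>0)"
  proof (induction k)
    case (Suc k)
    from lap[OF this] show ?case by (simp add: funpow_swap1)
  qed (simp add: point_functional.eval)
  from point_functional.scale[OF this, of "1 / fact k"] show ?thesis
    by (simp add: gauss_def[abs_def])
qed

end

end

subsection \<open>Nondegenerate phases\<close>

locale stationary_phase = gaussian R D X e x\<^sub>0 H K
  for R :: "('m \<Rightarrow> complex) set" and D :: "'n::finite \<Rightarrow> ('m \<Rightarrow> complex) \<Rightarrow> 'm \<Rightarrow> complex"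
    and X :: "'n \<Rightarrow> 'm \<Rightarrow> complex" and e :: "'m \<Rightarrow> complex" and x\<^sub>0 :: 'm and H K +
  fixes \<psi> :: "'m \<Rightarrow> complex"
  assumes \<psi>_in [simp, intro]: "\<psi> \<in> R" and \<psi>_at: "\<psi> x\<^sub>0 = 0" and D_\<psi>_at: "D i \<psi> x\<^sub>0 = 0"
    and H_\<psi>: "H i j = D i (D j \<psi>) x\<^sub>0"
begin

context
  includes pointwise_simps_off
begin

definition h :: "'m \<Rightarrow> complex" where
  "h = \<psi> - q"

text \<open>The coefficient of \<open>\<nu>\<^sup>r\<close> in the expansion of the integral of \<open>e\<^bsup>q/\<nu>\<^esup> e\<^bsup>h/\<nu>\<^esup> f\<close>, where the term with \<open>(h/\<nu>)\<^sup>j\<close>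
  contributes with \<open>G\<^sub>r\<^sub>+\<^sub>j\<close>. The terms with \<open>j > 2r\<close> are zero, because \<open>h\<^sup>j\<close> vanishes to order \<open>3j > 2(r + j)\<close>.\<close>

definition phase_functional :: "nat \<Rightarrow> ('m \<Rightarrow> complex) \<Rightarrow> complex" where
  "phase_functional r f = (\<Sum>j\<le>2 * r. gauss (r + j) (h ^ j * f) / fact j)"

lemma h_in [simp, intro]: "h \<in> R"
  by (simp add: h_def)

lemma vanish_h: "vanish 3 h"
proof -
  have Dh: "D i h = D i \<psi> - dq i" for i by (simp add: h_def D_diff D_q)
  have "h x\<^sub>0 = 0" by (simp add: h_def \<psi>_at q_def sum_fun_apply times_fun_apply)
  moreover have "D i h x\<^sub>0 = 0" for i
    by (simp add: Dh D_\<psi>_at dq_def sum_fun_apply)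
  moreover have "D j (D i h) x\<^sub>0 = 0" for i j
    by (simp add: Dh D_diff D_dq H_\<psi> D_comm[of \<psi> j i])
  ultimately show ?thesis by (simp add: numeral_3_eq_3)
qed

lemma gauss_h_vanish:
  assumes "w \<in> R" "vanish m w" "2 * k < 3 * j + m"
  shows "gauss k (h ^ j * w) = 0"
proof (rule gauss_vanish)
  have "vanish (j * 3 + m) (h ^ j * w)"
    using assms vanish_h by (intro vanish_power_mult) auto
  then show "vanish (Suc (2 * k)) (h ^ j * w)"
    by (rule vanish_mono[rotated]) (use assms in simp)
qed (use assms power_in in auto)

text \<open>The freedom in the upper limit lets sums that belong to different values of \<open>r\<close> be combined.\<close>

lemma phase_functional_extend:
  assumes f: "f \<in> R" and J: "2 * r \<le> J"
  shows "phase_functional r f = (\<Sum>j\<le>J. gauss (r + j) (h ^ j * f) / fact j)"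
  unfolding phase_functional_def
proof (rule sum.mono_neutral_left)
  show "\<forall>j\<in>{..J} - {..2 * r}. gauss (r + j) (h ^ j * f) / fact j = 0"
    using gauss_h_vanish[OF f, of 0] by auto
qed (use J in auto)

lemma phase_functional_0: "phase_functional 0 f = f x\<^sub>0"
  by (simp add: phase_functional_def gauss_def)

lemma point_functional_phase: "point_functional (phase_functional r)"
proof -
  have "point_functional (\<lambda>f. L (h ^ j * f))" if "point_functional L" for j L
    using that
  proof (induction j arbitrary: L)
    case (Suc j)
    from Suc.IH[OF point_functional_mult[OF Suc.prems h_in]] show ?case by (simp add: mult.assoc)
  qed simp
  from this[OF point_functional_gauss]
  have "point_functional (\<lambda>f. \<Sum>j\<le>2 * r. (1 / fact j) * gauss (r + j) (h ^ j * f))"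
    by (intro point_functional_sum point_functional.scale)
  then show ?thesis by (simp add: phase_functional_def[abs_def])
qed

text \<open>The integral of \<open>D\<^sub>i(e\<^bsup>\<psi>/\<nu>\<^esup> w)\<close> vanishes. Splitting \<open>D\<^sub>i \<psi> = D\<^sub>i q + D\<^sub>i h\<close>, the Gaussian integration by parts
  handles the first summand; differentiating \<open>h\<^sup>j\<close> cancels the second one in a telescoping sum.\<close>

lemma phase_functional_by_parts:
  assumes w: "w \<in> R"
  shows "phase_functional r (D i w) + phase_functional (Suc r) (D i \<psi> * w) = 0"
proof -
  define J where "J = 2 * Suc r"
  define T where "T j = gauss (Suc (r + j)) (h ^ j * (D i h * w)) / fact j" for j
  have D\<psi>: "D i \<psi> = dq i + D i h" by (simp add: h_def D_diff D_q)
  have "gauss (Suc r + j) (h ^ j * (D i \<psi> * w)) / fact j =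
      - (if j = 0 then 0 else T (j - 1)) - gauss (r + j) (h ^ j * D i w) / fact j + T j" for j
  proof -
    have "h ^ j * (D i \<psi> * w) = dq i * (h ^ j * w) + h ^ j * (D i h * w)"
      by (simp add: D\<psi> algebra_simps)
    then have "gauss (Suc r + j) (h ^ j * (D i \<psi> * w)) / fact j =
        - gauss (r + j) (D i (h ^ j * w)) / fact j + T j"
      using w by (simp add: gauss_add gauss_dq_mult power_in T_def add_divide_distrib diff_divide_distrib)
    also have "gauss (r + j) (D i (h ^ j * w)) =
        of_nat j * gauss (r + j) (h ^ (j - 1) * (D i h * w)) + gauss (r + j) (h ^ j * D i w)"
    proof -
      have "of_nat j * g = cst (of_nat j) * g" for g :: "'m \<Rightarrow> complex"
        by (simp add: fun_eq_iff times_fun_apply of_nat_fun_apply)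
      then show ?thesis
        using w by (simp add: D_power_mult gauss_add gauss_cst power_in)
    qed
    finally show ?thesis
      by (cases j) (simp_all add: T_def field_simps del: of_nat_Suc)
  qed
  then have "phase_functional (Suc r) (D i \<psi> * w) =
      (\<Sum>j\<le>J. - (if j = 0 then 0 else T (j - 1)) - gauss (r + j) (h ^ j * D i w) / fact j + T j)"
    using w by (subst phase_functional_extend[of _ _ J]) (simp_all add: J_def)
  also have "\<dots> = - (\<Sum>j\<le>J. if j = 0 then 0 else T (j - 1)) - phase_functional r (D i w) + (\<Sum>j\<le>J. T j)"
    using w by (subst phase_functional_extend[of "D i w" r J])
      (simp_all add: J_def sum.distrib sum_subtractf sum_negf)
  also have "(\<Sum>j\<le>J. if j = 0 then 0 else T (j - 1)) = (\<Sum>j<J. T j)"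
    by (cases J) (simp_all add: sum.atMost_Suc_shift lessThan_Suc_atMost del: sum.atMost_Suc)
  also have "(\<Sum>j\<le>J. T j) = (\<Sum>j<J. T j) + T J"
    by (simp add: lessThan_Suc_atMost[symmetric])
  \<comment> \<open>the boundary term of the telescoping sum has too high an order to be seen\<close>
  also have "T J = 0"
  proof -
    have "vanish 2 (D i h)" using vanish_h by (simp add: numeral_3_eq_3 numeral_2_eq_2)
    then have "vanish (2 + 0) (D i h * w)" using w by (intro vanish_mult) auto
    then show ?thesis using gauss_h_vanish[of "D i h * w" 2 "Suc (r + J)" J] w by (simp add: T_def J_def)
  qed
  finally show ?thesis by simp
qed

text \<open>Homogeneity in \<open>\<nu>\<close>. Writing \<open>\<psi> = q + h\<close>, the factor \<open>q\<close> yields \<open>-(n/2 + r + j)\<close> on the \<open>j\<close>-th summand, and the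
  factor \<open>h\<close> moves it to the \<open>(j + 1)\<close>-st one with the factor \<open>j + 1\<close>; the terms with \<open>j\<close> telescope.\<close>

lemma phase_functional_phase_mult:
  assumes f: "f \<in> R"
  shows "phase_functional (Suc r) (\<psi> * f) = - (of_nat CARD('n) / 2 + of_nat r) * phase_functional r f"
proof -
  define J where "J = 2 * Suc r"
  define U where "U j = gauss (r + j) (h ^ j * f) / fact j" for j
  have "gauss (Suc r + j) (h ^ j * (\<psi> * f)) / fact j =
      - (of_nat CARD('n) / 2 + of_nat r) * U j - of_nat j * U j + of_nat (Suc j) * U (Suc j)" for j
  proof -
    have "h ^ j * (\<psi> * f) = q * (h ^ j * f) + h ^ Suc j * f"
      by (simp add: h_def algebra_simps)
    then have E1: "gauss (Suc r + j) (h ^ j * (\<psi> * f)) =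
        - (of_nat CARD('n) / 2 + of_nat (r + j)) * gauss (r + j) (h ^ j * f) + gauss (r + Suc j) (h ^ Suc j * f)"
      using f power_in[OF h_in f] by (simp only: gauss_add gauss_q_mult mult_in q_in add_Suc add_Suc_right)
    have E2: "of_nat (Suc j) * U (Suc j) = gauss (r + Suc j) (h ^ Suc j * f) / fact j"
      by (simp add: U_def del: of_nat_Suc power_Suc add_Suc_right)
    have E3: "gauss (r + j) (h ^ j * f) = fact j * U j"
      by (simp add: U_def)
    show ?thesis unfolding E1 E2 E3 by (simp add: field_simps del: power_Suc)
  qed
  then have "phase_functional (Suc r) (\<psi> * f) =
      (\<Sum>j\<le>J. - (of_nat CARD('n) / 2 + of_nat r) * U j - of_nat j * U j + of_nat (Suc j) * U (Suc j))"
    using f by (subst phase_functional_extend[of _ _ J]) (simp_all add: J_def)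
  also have "\<dots> = - (of_nat CARD('n) / 2 + of_nat r) * (\<Sum>j\<le>J. U j)
      + ((\<Sum>j\<le>J. of_nat (Suc j) * U (Suc j)) - (\<Sum>j\<le>J. of_nat j * U j))"
    by (simp only: sum.distrib sum_subtractf sum_distrib_left add.assoc diff_conv_add_uminus) (simp only: add_ac sum_negf)
  also have "(\<Sum>j\<le>J. of_nat (Suc j) * U (Suc j)) - (\<Sum>j\<le>J. of_nat j * U j) = of_nat (Suc J) * U (Suc J)"
    by (induction J) (simp_all add: algebra_simps)
  also have "U (Suc J) = 0"
    using gauss_h_vanish[OF f, of 0 "r + Suc J" "Suc J"] by (simp add: U_def J_def)
  also have "(\<Sum>j\<le>J. U j) = phase_functional r f"
    using f by (subst phase_functional_extend[of f r J]) (simp_all add: J_def U_def)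
  finally show ?thesis by simp
qed

end

end

section \<open>Formal functions and formal distributions\<close>

lemma fls_times_nth_finite:
  fixes F G :: "'a::semiring_0 fls"
  assumes I: "finite I" and 0: "\<And>i. i \<notin> I \<Longrightarrow> F $$ i * G $$ (n - i) = 0"
  shows "(F * G) $$ n = (\<Sum>i\<in>I. F $$ i * G $$ (n - i))"
proof -
  let ?A = "{fls_subdegree F..n - fls_subdegree G}"
  have "(F * G) $$ n = (\<Sum>i\<in>?A. F $$ i * G $$ (n - i))" by (rule fls_times_nth(2))
  also have "\<dots> = (\<Sum>i\<in>?A \<union> I. F $$ i * G $$ (n - i))"
    using I by (intro sum.mono_neutral_left) auto
  also have "\<dots> = (\<Sum>i\<in>I. F $$ i * G $$ (n - i))"
    using I 0 by (intro sum.mono_neutral_right) auto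
  finally show ?thesis .
qed

lemma fps_fls_times_nth:
  fixes F :: "'a::semiring_0 fls"
  assumes "\<And>l. l > m \<Longrightarrow> F $$ (n - int l) = 0"
  shows "(fps_to_fls c * F) $$ n = (\<Sum>l\<le>m. c $ l * F $$ (n - int l))"
proof -
  have "(fps_to_fls c * F) $$ n = (\<Sum>i\<in>int ` {..m}. fps_to_fls c $$ i * F $$ (n - i))"
  proof (rule fls_times_nth_finite)
    fix i assume i: "i \<notin> int ` {..m}"
    show "fps_to_fls c $$ i * F $$ (n - i) = 0"
    proof (cases "i < 0")
      case False
      then have l: "i = int (nat i)" by simp
      then have "nat i > m" using i by (metis atMost_iff imageI not_le)
      then have "F $$ (n - i) = 0" using assms[of "nat i"] False by simp
      then show ?thesis by simp
    qed simp
  qed simp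
  also have "\<dots> = (\<Sum>l\<le>m. c $ l * F $$ (n - int l))"
    by (subst sum.reindex) (auto simp: inj_on_def)
  finally show ?thesis .
qed

lemma fls_nth_eventually_0: "\<forall>\<^sub>F m in sequentially. \<forall>r\<ge>m. F $$ (k - int r) = 0"
  for F :: "'a::zero fls"
  unfolding eventually_sequentially
  by (rule exI[of _ "nat (k - fls_subdegree F) + 1"]) auto

text \<open>The range of summation in \<open>fd_apply\<close> depends on the order of the argument. Sums over \<open>r \<le> m\<close> with large \<open>m\<close>
  have the same value and can be compared for different arguments and different families.\<close>

lemma fd_apply_nth_eventually:
  assumes "\<And>r. \<Lambda> r 0 = 0"
  shows "\<forall>\<^sub>F m in sequentially. fd_apply \<Lambda> F $$ k = (\<Sum>r\<le>m. \<Lambda> r (F $$ (k - int r)))"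
  unfolding eventually_sequentially
proof (intro exI allI impI)
  fix m assume m: "m \<ge> nat (k - fls_subdegree F)"
  show "fd_apply \<Lambda> F $$ k = (\<Sum>r\<le>m. \<Lambda> r (F $$ (k - int r)))"
    unfolding fd_apply_nth
  proof (rule sum.mono_neutral_left)
    show "\<forall>r\<in>{..m} - {r. fls_subdegree F + int r \<le> k}. \<Lambda> r (F $$ (k - int r)) = 0"
      using assms by auto
  qed (use m in auto)
qed

lemma fd_apply_cong:
  assumes "\<And>r. \<Lambda> r 0 = 0" "\<And>r k. \<Lambda> r (F $$ k) = \<Lambda> r (G $$ k)"
  shows "fd_apply \<Lambda> F = fd_apply \<Lambda> G"
proof (rule fls_eqI)
  fix k
  have "\<forall>\<^sub>F m in sequentially. fd_apply \<Lambda> F $$ k = fd_apply \<Lambda> G $$ k"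
    using fd_apply_nth_eventually[where \<Lambda> = \<Lambda> and F = F and k = k, OF assms(1)]
      fd_apply_nth_eventually[where \<Lambda> = \<Lambda> and F = G and k = k, OF assms(1)]
    by eventually_elim (simp add: assms(2))
  then show "fd_apply \<Lambda> F $$ k = fd_apply \<Lambda> G $$ k" by simp
qed

lemma fd_apply_cong_functional:
  assumes "\<And>r. \<Lambda> r 0 = 0" "\<And>r. \<Lambda>' r 0 = 0" "\<And>r k. \<Lambda> r (F $$ k) = \<Lambda>' r (F $$ k)"
  shows "fd_apply \<Lambda> F = fd_apply \<Lambda>' F"
proof (rule fls_eqI)
  fix k
  have "\<forall>\<^sub>F m in sequentially. fd_apply \<Lambda> F $$ k = fd_apply \<Lambda>' F $$ k"
    using fd_apply_nth_eventually[where \<Lambda> = \<Lambda> and F = F and k = k, OF assms(1)]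
      fd_apply_nth_eventually[where \<Lambda> = \<Lambda>' and F = F and k = k, OF assms(2)]
    by eventually_elim (simp add: assms(3))
  then show "fd_apply \<Lambda> F $$ k = fd_apply \<Lambda>' F $$ k" by simp
qed

text \<open>The family \<open>F \<mapsto> \<Lambda>(\<epsilon> F)\<close>; see \<open>fd_apply_twist\<close>.\<close>

definition twist :: "('m \<Rightarrow> complex) fps \<Rightarrow> 'm formal_distribution \<Rightarrow> 'm formal_distribution" where
  "twist \<epsilon> \<Lambda> r f = (\<Sum>l\<le>r. \<Lambda> (r - l) (\<epsilon> $ l * f))"

text \<open>The product of \<open>\<Lambda>\<close> with a formal constant \<open>c \<in> \<complex>[[\<nu>]]\<close>; see \<open>fd_apply_fps_scale\<close>.\<close>

definition fps_scale :: "complex fps \<Rightarrow> 'm formal_distribution \<Rightarrow> 'm formal_distribution" where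
  "fps_scale c \<Lambda> r f = (\<Sum>l\<le>r. c $ l * \<Lambda> (r - l) f)"

lemma sum_triangle_swap:
  "(\<Sum>r\<le>m. \<Sum>l\<le>r. g (r - l) l) = (\<Sum>s\<le>m. \<Sum>l\<le>m - s. g s l)" for m :: nat
proof -
  have "(\<Sum>r\<le>m. \<Sum>l\<le>r. g (r - l) l) = (\<Sum>r\<le>m. \<Sum>s\<le>r. g s (r - s))"
  proof (rule sum.cong[OF refl])
    fix r
    show "(\<Sum>l\<le>r. g (r - l) l) = (\<Sum>s\<le>r. g s (r - s))"
      by (rule sum.reindex_bij_witness[of _ "\<lambda>s. r - s" "\<lambda>s. r - s"]) auto
  qed
  also have "\<dots> = (\<Sum>(s, l)\<in>{(s, l). s + l \<le> m}. g s l)"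
    by (rule sum.triangle_reindex_eq[symmetric])
  also have "{(s, l). s + l \<le> m} = Sigma {..m} (\<lambda>s. {..m - s})" by auto
  also have "(\<Sum>(s, l)\<in>\<dots>. g s l) = (\<Sum>s\<le>m. \<Sum>l\<le>m - s. g s l)"
    by (rule sum.Sigma[symmetric]) auto
  finally show ?thesis .
qed

lemma fd_apply_fps_scale:
  assumes "\<And>r. \<Lambda> r 0 = 0"
  shows "fd_apply (fps_scale c \<Lambda>) F = fps_to_fls c * fd_apply \<Lambda> F"
proof (rule fls_eqI)
  fix k
  have c0: "fps_scale c \<Lambda> r 0 = 0" for r using assms by (simp add: fps_scale_def)
  obtain m where m: "fd_apply (fps_scale c \<Lambda>) F $$ k = (\<Sum>r\<le>m. fps_scale c \<Lambda> r (F $$ (k - int r)))"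
    and m0: "\<forall>r\<ge>m. F $$ (k - int r) = 0"
    using eventually_happens'[OF sequentially_bot eventually_conj[OF
        fd_apply_nth_eventually[where \<Lambda> = "fps_scale c \<Lambda>" and F = F and k = k, OF c0]
        fls_nth_eventually_0[of F k]]] by blast
  have z: "F $$ j = 0" if "j \<le> k - int m" for j
    using m0[rule_format, of "nat (k - j)"] that by simp
  have ap: "fd_apply \<Lambda> F $$ (k - int l) = (\<Sum>s\<le>m - l. \<Lambda> s (F $$ (k - int l - int s)))" if "l \<le> m" for l
  proof -
    obtain M where M: "fd_apply \<Lambda> F $$ (k - int l) = (\<Sum>s\<le>M. \<Lambda> s (F $$ (k - int l - int s)))" "M \<ge> m - l"
      using eventually_happens'[OF sequentially_bot eventually_conj[OF
          fd_apply_nth_eventually[where \<Lambda> = \<Lambda> and F = F and k = "k - int l", OF assms]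
          eventually_ge_at_top[of "m - l"]]] by blast
    have "(\<Sum>s\<le>M. \<Lambda> s (F $$ (k - int l - int s))) = (\<Sum>s\<le>m - l. \<Lambda> s (F $$ (k - int l - int s)))"
    proof (rule sum.mono_neutral_right)
      have "F $$ (k - int l - int s) = 0" if "\<not> s \<le> m - l" for s
        by (rule z) (use that \<open>l \<le> m\<close> in linarith)
      then show "\<forall>s\<in>{..M} - {..m - l}. \<Lambda> s (F $$ (k - int l - int s)) = 0"
        using assms by simp
    qed (use M(2) in auto)
    then show ?thesis using M(1) by simp
  qed
  have "fd_apply \<Lambda> F $$ (k - int l) = 0" if "l > m" for l
    unfolding fd_apply_nth
  proof (intro sum.neutral ballI)
    fix s
    have "F $$ (k - int l - int s) = 0" by (rule z) (use that in linarith)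
    then show "\<Lambda> s (F $$ (k - int l - int s)) = 0" using assms by simp
  qed
  then have "(fps_to_fls c * fd_apply \<Lambda> F) $$ k = (\<Sum>l\<le>m. c $ l * fd_apply \<Lambda> F $$ (k - int l))"
    by (rule fps_fls_times_nth)
  also have "\<dots> = (\<Sum>l\<le>m. \<Sum>s\<le>m - l. c $ l * \<Lambda> s (F $$ (k - int l - int s)))"
    by (simp add: ap sum_distrib_left)
  also have "\<dots> = (\<Sum>r\<le>m. \<Sum>s\<le>r. c $ (r - s) * \<Lambda> s (F $$ (k - int (r - s) - int s)))"
    by (rule sum_triangle_swap[where g = "\<lambda>l s. c $ l * \<Lambda> s (F $$ (k - int l - int s))", symmetric])
  also have "\<dots> = (\<Sum>r\<le>m. fps_scale c \<Lambda> r (F $$ (k - int r)))"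
  proof (rule sum.cong[OF refl])
    fix r
    have "(\<Sum>s\<le>r. c $ (r - s) * \<Lambda> s (F $$ (k - int (r - s) - int s))) =
        (\<Sum>s\<le>r. c $ (r - s) * \<Lambda> s (F $$ (k - int r)))"
      by (intro sum.cong refl) (simp add: of_nat_diff)
    also have "\<dots> = fps_scale c \<Lambda> r (F $$ (k - int r))"
      unfolding fps_scale_def by (rule sum.reindex_bij_witness[of _ "\<lambda>s. r - s" "\<lambda>s. r - s"]) auto
    finally show "(\<Sum>s\<le>r. c $ (r - s) * \<Lambda> s (F $$ (k - int (r - s) - int s))) = fps_scale c \<Lambda> r (F $$ (k - int r))" .
  qed
  finally show "fd_apply (fps_scale c \<Lambda>) F $$ k = (fps_to_fls c * fd_apply \<Lambda> F) $$ k"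
    by (simp only: m)
qed

unbundle no vec_syntax

lemma fls_X_inv_mult_nth [simp]: "(fls_X_inv * F) $$ k = F $$ (k + 1)"
  for F :: "'a::comm_ring_1 fls"
  by (simp add: fls_X_inv_times_conv_shift)

lemma fls_const_mult_nth: "(fls_const a * F) $$ k = a * F $$ k" for F :: "'a::comm_ring_1 fls"
  by simp

context germ_ring
begin

context
  includes pointwise_simps_off
begin

definition formal :: "('m \<Rightarrow> complex) fls \<Rightarrow> bool" where
  "formal F \<longleftrightarrow> (\<forall>k. F $$ k \<in> R)"

definition D_fls :: "'n \<Rightarrow> ('m \<Rightarrow> complex) fls \<Rightarrow> ('m \<Rightarrow> complex) fls" where
  "D_fls i F = Abs_fls (\<lambda>k. D i (F $$ k))"

lemma D_fls_nth [simp]: "D_fls i F $$ k = D i (F $$ k)"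
  unfolding D_fls_def
  by (rule nth_Abs_fls_lower_bound[of "fls_subdegree F"]) simp

lemma formal_add: "formal F \<Longrightarrow> formal G \<Longrightarrow> formal (F + G)"
  by (simp add: formal_def)

lemma formal_diff: "formal F \<Longrightarrow> formal G \<Longrightarrow> formal (F - G)"
  by (simp add: formal_def)

lemma formal_mult: "formal F \<Longrightarrow> formal G \<Longrightarrow> formal (F * G)"
  unfolding formal_def fls_times_nth(2) by auto

lemma formal_const: "f \<in> R \<Longrightarrow> formal (fls_const f)"
  by (simp add: formal_def)

lemma formal_shift: "formal F \<Longrightarrow> formal (fls_X_inv * F)"
  by (simp add: formal_def)

lemma formal_D: "formal F \<Longrightarrow> formal (D_fls i F)"
  by (simp add: formal_def)

lemma of_int_mult: "of_int k * f = cst (of_int k) * f" for f :: "'m \<Rightarrow> complex"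
proof -
  have "of_int k = (cst (of_int k) :: 'm \<Rightarrow> complex)"
    by (cases k rule: int_cases2) (simp_all add: fun_eq_iff of_nat_fun_apply uminus_apply)
  then show ?thesis by simp
qed

lemma formal_deriv: "formal F \<Longrightarrow> formal (fls_deriv F)"
  unfolding formal_def fls_deriv_nth of_int_mult by auto

lemma formal_cst_mult: "formal F \<Longrightarrow> formal (fls_const (cst a) * F)"
  by (simp add: formal_def)

lemma formal_fps: "(\<And>k. \<epsilon> $ k \<in> R) \<Longrightarrow> formal (fps_to_fls \<epsilon>)"
  by (simp add: formal_def)

lemma D_fls_mult:
  assumes F: "formal F" and G: "formal G"
  shows "D_fls i (F * G) = D_fls i F * G + F * D_fls i G"
proof (rule fls_eqI)
  fix n
  let ?I = "{fls_subdegree F..n - fls_subdegree G}"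
  have "(D_fls i F * G) $$ n = (\<Sum>j\<in>?I. D i (F $$ j) * G $$ (n - j))"
    by (subst fls_times_nth_finite[of ?I]) (auto simp: not_le)
  moreover have "(F * D_fls i G) $$ n = (\<Sum>j\<in>?I. F $$ j * D i (G $$ (n - j)))"
    by (subst fls_times_nth_finite[of ?I]) (auto simp: not_le)
  moreover have "(F * G) $$ n = (\<Sum>j\<in>?I. F $$ j * G $$ (n - j))"
    by (rule fls_times_nth(2))
  ultimately show "D_fls i (F * G) $$ n = (D_fls i F * G + F * D_fls i G) $$ n"
    using F G by (simp add: formal_def D_sum D_mult sum.distrib)
qed

definition point_family :: "'m formal_distribution \<Rightarrow> bool" where
  "point_family \<Lambda> \<longleftrightarrow> (\<forall>r. point_functional (\<Lambda> r))"

lemma point_family_0: "point_family \<Lambda> \<Longrightarrow> \<Lambda> r 0 = 0"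
  by (simp add: point_family_def point_functional_0)

lemma fd_apply_add:
  assumes \<Lambda>: "point_family \<Lambda>" and FG: "formal F" "formal G"
  shows "fd_apply \<Lambda> (F + G) = fd_apply \<Lambda> F + fd_apply \<Lambda> G"
proof (rule fls_eqI)
  fix k
  note ev = fd_apply_nth_eventually[where \<Lambda> = \<Lambda> and k = k, OF point_family_0[OF \<Lambda>]]
  have "\<forall>\<^sub>F m in sequentially. fd_apply \<Lambda> (F + G) $$ k = fd_apply \<Lambda> F $$ k + fd_apply \<Lambda> G $$ k"
    using ev[of F] ev[of G] ev[of "F + G"]
    by eventually_elim
      (use \<Lambda> FG in \<open>simp add: point_family_def formal_def point_functional_add sum.distrib\<close>)
  then show "fd_apply \<Lambda> (F + G) $$ k = (fd_apply \<Lambda> F + fd_apply \<Lambda> G) $$ k" by simp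
qed

lemma point_family_twist: "point_family \<Lambda> \<Longrightarrow> (\<And>k. \<epsilon> $ k \<in> R) \<Longrightarrow> point_family (twist \<epsilon> \<Lambda>)"
  unfolding point_family_def twist_def[abs_def]
  by (auto intro!: point_functional_sum point_functional_mult)

lemma point_family_fps_scale: "point_family \<Lambda> \<Longrightarrow> point_family (fps_scale c \<Lambda>)"
  unfolding point_family_def fps_scale_def[abs_def]
  by (auto intro!: point_functional_sum point_functional.scale)

lemma fd_apply_twist:
  assumes \<Lambda>: "point_family \<Lambda>" and \<epsilon>: "\<And>k. \<epsilon> $ k \<in> R" and F: "formal F"
  shows "fd_apply (twist \<epsilon> \<Lambda>) F = fd_apply \<Lambda> (fps_to_fls \<epsilon> * F)"
proof (rule fls_eqI)
  fix k
  note ev = fd_apply_nth_eventually[where \<Lambda> = \<Lambda> and k = k, OF point_family_0[OF \<Lambda>]]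
  note ev' = fd_apply_nth_eventually[where \<Lambda> = "twist \<epsilon> \<Lambda>" and k = k,
      OF point_family_0[OF point_family_twist[OF \<Lambda> \<epsilon>]]]
  have "\<forall>\<^sub>F m in sequentially. fd_apply (twist \<epsilon> \<Lambda>) F $$ k = fd_apply \<Lambda> (fps_to_fls \<epsilon> * F) $$ k"
    using ev[of "fps_to_fls \<epsilon> * F"] ev'[of F] fls_nth_eventually_0[of F k]
  proof eventually_elim
    case (elim m)
    have z: "F $$ j = 0" if "j \<le> k - int m" for j
      using elim(3)[rule_format, of "nat (k - j)"] that by simp
    have prod: "(fps_to_fls \<epsilon> * F) $$ (k - int s) = (\<Sum>l\<le>m - s. \<epsilon> $ l * F $$ (k - int s - int l))" if "s \<le> m" for s
      by (rule fps_fls_times_nth) (rule z, use that in linarith)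
    have "fd_apply \<Lambda> (fps_to_fls \<epsilon> * F) $$ k = (\<Sum>s\<le>m. \<Sum>l\<le>m - s. \<Lambda> s (\<epsilon> $ l * F $$ (k - int s - int l)))"
      unfolding elim(1)
      by (intro sum.cong refl)
        (use \<Lambda> \<epsilon> F in \<open>simp add: prod point_family_def point_functional_sum_arg formal_def\<close>)
    also have "\<dots> = (\<Sum>r\<le>m. \<Sum>l\<le>r. \<Lambda> (r - l) (\<epsilon> $ l * F $$ (k - int (r - l) - int l)))"
      by (rule sum_triangle_swap[where g = "\<lambda>s l. \<Lambda> s (\<epsilon> $ l * F $$ (k - int s - int l))", symmetric])
    also have "\<dots> = (\<Sum>r\<le>m. twist \<epsilon> \<Lambda> r (F $$ (k - int r)))"
      unfolding twist_def by (intro sum.cong refl) (simp add: of_nat_diff)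
    finally show ?case unfolding elim(2) by simp
  qed
  then show "fd_apply (twist \<epsilon> \<Lambda>) F $$ k = fd_apply \<Lambda> (fps_to_fls \<epsilon> * F) $$ k" by simp
qed

subsection \<open>Families closed under twisted derivatives\<close>

text \<open>The twisted derivatives \<open>D\<^sub>i F + B\<^sub>i F\<close> play the role of exact forms, and \<open>\<Lambda>\<close> is a formal integral that does not
  see them.\<close>

definition closed_under :: "('n \<Rightarrow> ('m \<Rightarrow> complex) fls) \<Rightarrow> 'm formal_distribution \<Rightarrow> bool" where
  "closed_under B \<Lambda> \<longleftrightarrow> (\<forall>i. \<forall>F. formal F \<longrightarrow> fd_apply \<Lambda> (D_fls i F + B i * F) = 0)"

text \<open>The annihilator \<open>{\<chi>. \<forall>F. \<Lambda>(\<chi> F) = 0}\<close> is an ideal stable under the \<open>D\<^sub>i\<close>, because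
  \<open>(D\<^sub>i \<chi>) F\<close> equals a twisted derivative of \<open>\<chi> F\<close> minus a multiple of \<open>\<chi>\<close>. The lowest
  coefficient of an element that is not flat at \<open>x\<^sub>0\<close> must vanish at \<open>x\<^sub>0\<close>, since \<open>\<Lambda>\<^sub>0\<close> is a multiple of the
  evaluation; applying this to all derivatives shows that it is flat after all.\<close>

lemma closed_functional_flat:
  assumes \<Lambda>: "point_family \<Lambda>" and lead: "\<And>f. f \<in> R \<Longrightarrow> \<Lambda> 0 f = a * f x\<^sub>0" "a \<noteq> 0"
    and B: "\<And>i. formal (B i)" and closed: "closed_under B \<Lambda>"
    and \<chi>: "formal \<chi>" and kill: "\<And>F. formal F \<Longrightarrow> fd_apply \<Lambda> (\<chi> * F) = 0"
  shows "vanish n (\<chi> $$ k)"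
proof -
  define N where "N \<chi> \<longleftrightarrow> formal \<chi> \<and> (\<forall>F. formal F \<longrightarrow> fd_apply \<Lambda> (\<chi> * F) = 0)" for \<chi>
  have ND: "N (D_fls i \<chi>)" if "N \<chi>" for \<chi> i
    unfolding N_def
  proof (intro conjI allI impI)
    show "formal (D_fls i \<chi>)" using that formal_D by (simp add: N_def)
    fix F assume F: "formal F"
    have \<chi>: "formal \<chi>" and k: "\<And>F. formal F \<Longrightarrow> fd_apply \<Lambda> (\<chi> * F) = 0"
      using that by (auto simp: N_def)
    have "D_fls i (\<chi> * F) + B i * (\<chi> * F) = D_fls i \<chi> * F + (\<chi> * D_fls i F + \<chi> * (B i * F))"
      unfolding D_fls_mult[OF \<chi> F] by (simp add: algebra_simps)
    then have "0 = fd_apply \<Lambda> (D_fls i \<chi> * F + (\<chi> * D_fls i F + \<chi> * (B i * F)))"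
      using closed formal_mult[OF \<chi> F] by (metis closed_under_def)
    also have "\<dots> = fd_apply \<Lambda> (D_fls i \<chi> * F) + (fd_apply \<Lambda> (\<chi> * D_fls i F) + fd_apply \<Lambda> (\<chi> * (B i * F)))"
      using \<chi> F B by (simp add: fd_apply_add[OF \<Lambda>] formal_add formal_mult formal_D)
    finally show "fd_apply \<Lambda> (D_fls i \<chi> * F) = 0"
      using k F B by (simp add: formal_mult formal_D)
  qed
  \<comment> \<open>the distributions of positive order in nu meet flat coefficients only\<close>
  have step: "vanish n (\<chi> $$ k)" if "N \<chi>" "\<And>j n. j < k \<Longrightarrow> vanish n (\<chi> $$ j)" for n k \<chi>
    using that
  proof (induction n arbitrary: \<chi>)
    case (Suc n)
    have \<chi>R: "\<chi> $$ j \<in> R" for j using Suc.prems(1) by (simp add: N_def formal_def)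
    have "\<chi> * fls_const e = \<chi>" using \<chi>R by (intro fls_eqI) simp
    then have "fd_apply \<Lambda> \<chi> = 0" using Suc.prems(1) formal_const[OF e_in] by (metis N_def)
    moreover have "fd_apply \<Lambda> \<chi> $$ k = \<Lambda> 0 (\<chi> $$ k)"
    proof -
      have "\<forall>\<^sub>F m in sequentially. fd_apply \<Lambda> \<chi> $$ k = \<Lambda> 0 (\<chi> $$ k)"
        using fd_apply_nth_eventually[where \<Lambda> = \<Lambda> and k = k and F = \<chi>, OF point_family_0[OF \<Lambda>]]
      proof eventually_elim
        case (elim m)
        have "\<Lambda> r (\<chi> $$ (k - int r)) = 0" if "r \<noteq> 0" for r
          using \<Lambda> \<chi>R Suc.prems(2)[of "k - int r"] that
          by (intro point_functional_flat) (auto simp: point_family_def)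
        then have "(\<Sum>r\<le>m. \<Lambda> r (\<chi> $$ (k - int r))) = (\<Sum>r\<in>{0}. \<Lambda> r (\<chi> $$ (k - int r)))"
          by (intro sum.mono_neutral_right) auto
        then show ?case using elim by simp
      qed
      then show ?thesis by simp
    qed
    ultimately have "(\<chi> $$ k) x\<^sub>0 = 0" using lead(1)[OF \<chi>R[of k]] lead(2) by simp
    moreover have "vanish n (D i (\<chi> $$ k))" for i
    proof -
      have "vanish n (D_fls i \<chi> $$ j)" if "j < k" for j n
        using Suc.prems(2)[OF that, of "Suc n"] by simp
      from Suc.IH[OF ND[OF Suc.prems(1)] this] show ?thesis by simp
    qed
    ultimately show ?case by simp
  qed simp
  have N\<chi>: "N \<chi>" using \<chi> kill by (simp add: N_def)
  have "\<forall>j n. j < fls_subdegree \<chi> + int m \<longrightarrow> vanish n (\<chi> $$ j)" for m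
  proof (induction m)
    case (Suc m)
    show ?case
    proof (intro allI impI)
      fix j n assume "j < fls_subdegree \<chi> + int (Suc m)"
      then have "j < fls_subdegree \<chi> + int m \<or> j = fls_subdegree \<chi> + int m" by linarith
      then show "vanish n (\<chi> $$ j)" using Suc step[OF N\<chi>, of "fls_subdegree \<chi> + int m"] by blast
    qed
  qed simp
  from this[of "nat (k - fls_subdegree \<chi>) + 1"] show ?thesis by simp
qed

text \<open>Let \<open>c\<close> be the quotient of the values of \<open>\<Lambda>'\<close> and \<open>\<Lambda>\<close> on the unit. The difference \<open>\<kappa> = \<Lambda>' - c \<Lambda>\<close> kills the unit, and
  the lowest order of its closedness says that its first nonzero coefficient kills the gradient ideal of \<open>\<psi>\<close>. For \<open>\<Lambda>'\<close>,
  closedness on functions that do not depend on \<open>\<nu>\<close> is enough.\<close>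

lemma closed_functional_unique:
  assumes \<psi>: "\<psi> \<in> R" "\<And>i. D i \<psi> x\<^sub>0 = 0"
    and inv: "\<And>j l. (\<Sum>i\<in>UNIV. H' j i * D i (D l \<psi>) x\<^sub>0) = (if j = l then 1 else 0)"
    and B: "\<And>i. formal (B i)" "\<And>i k. k < - 1 \<Longrightarrow> B i $$ k = 0" "\<And>i. B i $$ (- 1) = D i \<psi>"
    and \<Lambda>: "point_family \<Lambda>" and closed: "closed_under B \<Lambda>" and lead: "\<Lambda> 0 e \<noteq> 0"
    and \<Lambda>': "point_family \<Lambda>'"
    and closed': "\<And>i w. w \<in> R \<Longrightarrow> fd_apply \<Lambda>' (fls_const (D i w) + B i * fls_const w) = 0"
  obtains c where "\<And>r f. f \<in> R \<Longrightarrow> \<Lambda>' r f = fps_scale c \<Lambda> r f"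
proof -
  define g g' where "g = Abs_fps (\<lambda>r. \<Lambda> r e)" and "g' = Abs_fps (\<lambda>r. \<Lambda>' r e)"
  define c where "c = g' * inverse g"
  have cg: "c * g = g'" using lead inverse_mult_eq_1[of g] by (simp add: c_def g_def mult.assoc)
  define \<kappa> where "\<kappa> r f = \<Lambda>' r f - fps_scale c \<Lambda> r f" for r f
  have pc: "point_family (fps_scale c \<Lambda>)" using \<Lambda> by (rule point_family_fps_scale)
  have p: "point_functional (\<kappa> r)" for r
    using \<Lambda>' pc unfolding \<kappa>_def[abs_def] point_family_def by (blast intro: point_functional_minus)
  then have \<kappa>: "point_family \<kappa>" by (simp add: point_family_def)
  have \<kappa>e: "\<kappa> r e = 0" for r
  proof -
    have "fps_scale c \<Lambda> r e = (c * g) $ r"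
      by (simp add: fps_scale_def fps_mult_nth g_def atMost_atLeast0)
    then show ?thesis by (simp add: \<kappa>_def cg g'_def)
  qed
  have \<kappa>_closed: "fd_apply \<kappa> (fls_const (D i w) + B i * fls_const w) = 0" if w: "w \<in> R" for i w
  proof (rule fls_eqI)
    fix k
    let ?Q = "fls_const (D i w) + B i * fls_const w"
    have "D_fls i (fls_const w) = fls_const (D i w)" by (rule fls_eqI) simp
    then have "fd_apply \<Lambda> ?Q = 0" using closed formal_const[OF w] by (metis closed_under_def)
    then have "fd_apply (fps_scale c \<Lambda>) ?Q = 0"
      by (simp add: fd_apply_fps_scale[where \<Lambda> = \<Lambda>, OF point_family_0[OF \<Lambda>]])
    moreover have "fd_apply \<Lambda>' ?Q = 0" using closed'[OF w] .
    moreover have "\<forall>\<^sub>F m in sequentially. fd_apply \<kappa> ?Q $$ k = fd_apply \<Lambda>' ?Q $$ k - fd_apply (fps_scale c \<Lambda>) ?Q $$ k"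
      using fd_apply_nth_eventually[where \<Lambda> = \<kappa> and k = k and F = ?Q, OF point_family_0[OF \<kappa>]]
        fd_apply_nth_eventually[where \<Lambda> = \<Lambda>' and k = k and F = ?Q, OF point_family_0[OF \<Lambda>']]
        fd_apply_nth_eventually[where \<Lambda> = "fps_scale c \<Lambda>" and k = k and F = ?Q, OF point_family_0[OF pc]]
      by eventually_elim (simp add: \<kappa>_def sum_subtractf)
    ultimately show "fd_apply \<kappa> ?Q $$ k = 0 $$ k" by simp
  qed
  have "\<forall>f\<in>R. \<kappa> r f = 0" for r
  proof (induction r rule: less_induct)
    case (less r)
    have kill: "\<kappa> r (w * D i \<psi>) = 0" if w: "w \<in> R" for i w
    proof -
      let ?Q = "fls_const (D i w) + B i * fls_const w"
      have QR: "?Q $$ k \<in> R" for k using B(1)[of i] w by (simp add: formal_def)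
      \<comment> \<open>in the coefficient of order r - 1 the smaller indices vanish by induction, and the larger ones
        meet coefficients of B below its lowest order -1\<close>
      have "\<forall>\<^sub>F m in sequentially. fd_apply \<kappa> ?Q $$ (int r - 1) = \<kappa> r (w * D i \<psi>)"
        using fd_apply_nth_eventually[where \<Lambda> = \<kappa> and k = "int r - 1" and F = ?Q, OF point_family_0[OF \<kappa>]]
          eventually_ge_at_top[of r]
      proof eventually_elim
        case (elim m)
        have "(\<Sum>s\<le>m. \<kappa> s (?Q $$ (int r - 1 - int s))) = (\<Sum>s\<in>{r}. \<kappa> s (?Q $$ (int r - 1 - int s)))"
        proof (rule sum.mono_neutral_right)
          show "\<forall>s\<in>{..m} - {r}. \<kappa> s (?Q $$ (int r - 1 - int s)) = 0"
          proof
            fix s assume "s \<in> {..m} - {r}"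
            then consider "s < r" | "s > r" by force
            then show "\<kappa> s (?Q $$ (int r - 1 - int s)) = 0"
            proof cases
              case 1 then show ?thesis using less.IH QR by blast
            next
              case 2
              then have "?Q $$ (int r - 1 - int s) = 0" using B(2)[of "int r - 1 - int s" i] by simp
              then show ?thesis using point_family_0[OF \<kappa>] by simp
            qed
          qed
        qed (use elim in auto)
        also have "\<dots> = \<kappa> r (w * D i \<psi>)" by (simp add: B(3) mult.commute)
        finally show ?case using elim(1) by simp
      qed
      then show ?thesis using \<kappa>_closed[OF w] by simp
    qed
    show ?case
      using point_functional_killing_gradient[OF \<psi> inv p kill] \<kappa>e by simp
  qed
  then show ?thesis using that[of c] by (simp add: \<kappa>_def)
qed

end

end

context stationary_phase
begin

context
  includes pointwise_simps_off
begin

subsection \<open>The stationary phase family\<close>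

lemma point_family_phase: "point_family phase_functional"
  by (simp add: point_family_def point_functional_phase)

text \<open>The family version of \<open>phase_functional_by_parts\<close>. The term with index \<open>0\<close> that is left over by the shift of the
  summation vanishes because \<open>x\<^sub>0\<close> is a critical point.\<close>

lemma phase_family_by_parts:
  assumes F: "formal F"
  shows "fd_apply phase_functional (D_fls i F + fls_X_inv * (fls_const (D i \<psi>) * F)) = 0"
proof (rule fls_eqI)
  fix k
  let ?Q = "D_fls i F + fls_X_inv * (fls_const (D i \<psi>) * F)"
  have FR: "F $$ j \<in> R" for j using F by (simp add: formal_def)
  have "\<forall>\<^sub>F m in sequentially. fd_apply phase_functional ?Q $$ k = 0"
    using fd_apply_nth_eventually[where \<Lambda> = phase_functional and k = k and F = ?Q, OF point_family_0[OF point_family_phase]]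
      fls_nth_eventually_0[of F k]
  proof eventually_elim
    case (elim m)
    have *: "phase_functional r (?Q $$ (k - int r)) =
        phase_functional r (D i (F $$ (k - int r))) + phase_functional r (D i \<psi> * F $$ (k + 1 - int r))" for r
    proof -
      have "k - int r + 1 = k + 1 - int r" by simp
      then have "?Q $$ (k - int r) = D i (F $$ (k - int r)) + D i \<psi> * F $$ (k + 1 - int r)"
        by (simp only: fls_plus_nth D_fls_nth fls_X_inv_mult_nth fls_const_mult_nth)
      then show ?thesis using FR by (simp add: point_functional_add[OF point_functional_phase])
    qed
    have "(\<Sum>r\<le>m. phase_functional r (D i \<psi> * F $$ (k + 1 - int r))) =
        phase_functional 0 (D i \<psi> * F $$ (k + 1)) + (\<Sum>r<m. phase_functional (Suc r) (D i \<psi> * F $$ (k - int r)))"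
      by (cases m) (simp_all add: sum.atMost_Suc_shift lessThan_Suc_atMost del: sum.atMost_Suc)
    also have "(\<Sum>r<m. phase_functional (Suc r) (D i \<psi> * F $$ (k - int r))) =
        (\<Sum>r<m. - phase_functional r (D i (F $$ (k - int r))))"
      using phase_functional_by_parts[OF FR] by (intro sum.cong refl) (simp add: eq_neg_iff_add_eq_0 add.commute)
    also have "\<dots> = - (\<Sum>r\<le>m. phase_functional r (D i (F $$ (k - int r))))"
      using elim(2) point_family_0[OF point_family_phase]
      by (simp add: sum_negf lessThan_Suc_atMost[symmetric])
    finally show ?case
      unfolding elim(1) * by (simp add: sum.distrib phase_functional_0 D_\<psi>_at)
  qed
  then show "fd_apply phase_functional ?Q $$ k = 0 $$ k" by simp
qed

text \<open>Differentiation multiplies the coefficient of \<open>\<nu>\<^sup>k\<close> by \<open>k\<close>; the part of this factor that comes from the index of the distribution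
  is supplied by \<open>phase_functional_phase_mult\<close>. The term with index \<open>0\<close> left over by the shift is \<open>\<psi>(x\<^sub>0) = 0\<close>.\<close>

lemma phase_family_deriv:
  assumes F: "formal F"
  shows "fls_deriv (fd_apply phase_functional F) =
    fd_apply phase_functional (fls_deriv F - (fls_X_inv * (fls_X_inv * (fls_const \<psi> * F))
      + fls_X_inv * (fls_const (cst (of_nat CARD('n) / 2)) * F)))"
    (is "_ = fd_apply _ ?Q")
proof (rule fls_eqI)
  fix k
  have FR: "F $$ j \<in> R" for j using F by (simp add: formal_def)
  let ?n = "of_nat CARD('n) / 2 :: complex"
  note z = point_family_0[OF point_family_phase]
  have "\<forall>\<^sub>F m in sequentially. fls_deriv (fd_apply phase_functional F) $$ k = fd_apply phase_functional ?Q $$ k"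
    using fd_apply_nth_eventually[where \<Lambda> = phase_functional and k = "k" and F = ?Q, OF z]
      fd_apply_nth_eventually[where \<Lambda> = phase_functional and k = "k + 1" and F = F, OF z]
      fls_nth_eventually_0[of F "k + 1"]
  proof eventually_elim
    case (elim m)
    have *: "phase_functional r (?Q $$ (k - int r)) =
        (of_int (k + 1 - int r) - ?n) * phase_functional r (F $$ (k + 1 - int r))
          - phase_functional r (\<psi> * F $$ (k + 2 - int r))" for r
    proof -
      have "k - int r + 1 = k + 1 - int r" "k + 1 - int r + 1 = k + 2 - int r" by simp_all
      then have "?Q $$ (k - int r) = cst (of_int (k + 1 - int r)) * F $$ (k + 1 - int r)
          - (\<psi> * F $$ (k + 2 - int r) + cst ?n * F $$ (k + 1 - int r))"
        by (simp only: fls_minus_nth fls_plus_nth fls_X_inv_mult_nth fls_const_mult_nth fls_deriv_nth of_int_mult)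
      then show ?thesis
        using FR by (simp add: point_functional_diff[OF point_functional_phase] point_functional_add[OF point_functional_phase]
            point_functional_cst[OF point_functional_phase] left_diff_distrib)
    qed
    have "(\<Sum>r\<le>m. phase_functional r (\<psi> * F $$ (k + 2 - int r))) =
        phase_functional 0 (\<psi> * F $$ (k + 2)) + (\<Sum>r<m. phase_functional (Suc r) (\<psi> * F $$ (k + 1 - int r)))"
      by (cases m) (simp_all add: sum.atMost_Suc_shift lessThan_Suc_atMost algebra_simps del: sum.atMost_Suc)
    also have "(\<Sum>r<m. phase_functional (Suc r) (\<psi> * F $$ (k + 1 - int r))) =
        (\<Sum>r<m. - (?n + of_nat r) * phase_functional r (F $$ (k + 1 - int r)))"
      using FR by (simp add: phase_functional_phase_mult)
    also have "\<dots> = (\<Sum>r\<le>m. - (?n + of_nat r) * phase_functional r (F $$ (k + 1 - int r)))"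
      using elim(3) z by (simp add: lessThan_Suc_atMost[symmetric])
    finally have "fd_apply phase_functional ?Q $$ k =
        (\<Sum>r\<le>m. (of_int (k + 1 - int r) - ?n) * phase_functional r (F $$ (k + 1 - int r)))
        - (\<Sum>r\<le>m. - (?n + of_nat r) * phase_functional r (F $$ (k + 1 - int r)))"
      unfolding elim(1) * sum_subtractf by (simp add: phase_functional_0 \<psi>_at)
    also have "\<dots> = of_int (k + 1) * (\<Sum>r\<le>m. phase_functional r (F $$ (k + 1 - int r)))"
      unfolding sum_subtractf[symmetric] sum_distrib_left
      by (intro sum.cong refl) (simp add: algebra_simps)
    finally show ?case using elim(2) by simp
  qed
  then show "fls_deriv (fd_apply phase_functional F) $$ k = fd_apply phase_functional ?Q $$ k" by simp
qed

text \<open>Passing from the phase \<open>\<psi>/\<nu>\<close> to an amplitude \<open>\<epsilon>\<close>: both identities for \<open>phase_functional\<close>, applied to \<open>\<epsilon> F\<close>, turn into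
  identities for \<open>F\<close> with the logarithmic derivatives \<open>\<beta>\<close> and \<open>\<tau>\<close> of \<open>\<epsilon>\<close> as additional coefficients.\<close>

lemma twisted_phase_functional:
  assumes \<epsilon>: "\<And>k. \<epsilon> $ k \<in> R" and \<beta>: "\<And>i k. \<beta> i $ k \<in> R" and \<tau>: "\<And>k. \<tau> $ k \<in> R"
    and D\<epsilon>: "\<And>i k. D i (\<epsilon> $ k) = (\<epsilon> * \<beta> i) $ k" and deriv\<epsilon>: "fps_deriv \<epsilon> = \<epsilon> * \<tau>"
  defines "\<Lambda> \<equiv> twist \<epsilon> phase_functional"
  shows "point_family \<Lambda>" "\<Lambda> 0 f = (\<epsilon> $ 0) x\<^sub>0 * f x\<^sub>0"
    "closed_under (\<lambda>i. fls_X_inv * fls_const (D i \<psi>) + fps_to_fls (\<beta> i)) \<Lambda>"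
    "formal F \<Longrightarrow> fls_deriv (fd_apply \<Lambda> F) = fd_apply \<Lambda> (fls_deriv F +
       (fps_to_fls \<tau> - fls_X_inv * (fls_X_inv * fls_const \<psi>) - fls_const (cst (of_nat CARD('n) / 2)) * fls_X_inv) * F)"
proof -
  show "point_family \<Lambda>" unfolding \<Lambda>_def using point_family_phase \<epsilon> by (rule point_family_twist)
  show "\<Lambda> 0 f = (\<epsilon> $ 0) x\<^sub>0 * f x\<^sub>0" by (simp add: \<Lambda>_def twist_def phase_functional_0)
  let ?E = "fps_to_fls \<epsilon>"
  have E: "formal ?E" using \<epsilon> by (rule formal_fps)
  note ap = fd_apply_twist[OF point_family_phase \<epsilon>, folded \<Lambda>_def]
  show "closed_under (\<lambda>i. fls_X_inv * fls_const (D i \<psi>) + fps_to_fls (\<beta> i)) \<Lambda>"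
    unfolding closed_under_def
  proof (intro allI impI)
    fix i F assume F: "formal F"
    let ?Q = "D_fls i F + (fls_X_inv * fls_const (D i \<psi>) + fps_to_fls (\<beta> i)) * F"
    have "D_fls i ?E = ?E * fps_to_fls (\<beta> i)"
    proof (rule fls_eqI)
      fix k
      show "D_fls i ?E $$ k = (?E * fps_to_fls (\<beta> i)) $$ k"
        by (simp add: fls_times_fps_to_fls[symmetric] D\<epsilon>)
    qed
    then have "?E * ?Q = D_fls i (?E * F) + fls_X_inv * (fls_const (D i \<psi>) * (?E * F))"
      unfolding D_fls_mult[OF E F] by (simp add: algebra_simps)
    moreover have "formal ?Q"
      using F \<beta> by (intro formal_add formal_mult formal_D formal_shift formal_const formal_fps) auto
    ultimately show "fd_apply \<Lambda> ?Q = 0"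
      using phase_family_by_parts[OF formal_mult[OF E F], of i] by (simp add: ap)
  qed
  assume F: "formal F"
  let ?T = "fps_to_fls \<tau> - fls_X_inv * (fls_X_inv * fls_const \<psi>) - fls_const (cst (of_nat CARD('n) / 2)) * fls_X_inv"
  let ?Q = "fls_deriv F + ?T * F"
  have "fls_deriv ?E = ?E * fps_to_fls \<tau>"
    by (simp add: fls_deriv_fps_to_fls deriv\<epsilon> fls_times_fps_to_fls)
  then have "?E * ?Q = fls_deriv (?E * F) - (fls_X_inv * (fls_X_inv * (fls_const \<psi> * (?E * F)))
      + fls_X_inv * (fls_const (cst (of_nat CARD('n) / 2)) * (?E * F)))"
    by (simp add: algebra_simps)
  moreover have "formal ?Q"
  proof -
    have "?Q = fls_deriv F + (fps_to_fls \<tau> * F - fls_X_inv * (fls_X_inv * (fls_const \<psi> * F))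
        - fls_X_inv * (fls_const (cst (of_nat CARD('n) / 2)) * F))"
      by (simp add: algebra_simps)
    also have "formal \<dots>"
      using F \<tau> by (intro formal_add formal_diff formal_deriv formal_shift formal_cst_mult formal_mult[OF _ F] formal_const formal_fps) auto
    finally show ?thesis .
  qed
  ultimately show "fls_deriv (fd_apply \<Lambda> F) = fd_apply \<Lambda> ?Q"
    using phase_family_deriv[OF formal_mult[OF E F]] F by (simp add: ap)
qed

end

end

unbundle no Formal_Power_Series.fps_syntax
unbundle vec_syntax

section \<open>Smooth functions on the manifold\<close>

abbreviation cpd :: "('m, 'n::finite) chart \<Rightarrow> 'n \<Rightarrow> ('m \<Rightarrow> 'b::real_normed_vector) \<Rightarrow> 'm \<Rightarrow> 'b" where
  "cpd c i f \<equiv> chart_pds c [i] f"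

locale manifold =
  fixes A :: "('m::{t2_space, second_countable_topology}, 'n::finite) chart set"
  assumes atlas: "oriented_atlas A"
begin

lemma chart_ex: "\<exists>c\<in>A. p \<in> fst c"
  using atlas unfolding oriented_atlas_def by blast

lemma open_dom: "c \<in> A \<Longrightarrow> open (fst c)"
  and open_ran: "c \<in> A \<Longrightarrow> open (snd c ` fst c)"
  and chart_homeo: "c \<in> A \<Longrightarrow> homeomorphism (fst c) (snd c ` fst c) (snd c) (chart_inv c)"
  and transition_smooth: "c \<in> A \<Longrightarrow> c' \<in> A \<Longrightarrow> smooth_map_on (snd c ` (fst c \<inter> fst c')) (snd c' \<circ> chart_inv c)"
  and det_jac_pos: "c \<in> A \<Longrightarrow> c' \<in> A \<Longrightarrow> p \<in> fst c \<inter> fst c' \<Longrightarrow> det (jac c c' p) > 0"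
  using atlas unfolding oriented_atlas_def by blast+

lemma chart_inv_chart [simp]: "c \<in> A \<Longrightarrow> p \<in> fst c \<Longrightarrow> chart_inv c (snd c p) = p"
  using chart_homeo unfolding homeomorphism_def by blast

lemma open_image:
  assumes "c \<in> A" "open W"
  shows "open (snd c ` (fst c \<inter> W))"
proof -
  have "snd c ` (fst c \<inter> W) = snd c ` fst c \<inter> chart_inv c -` W"
    using assms(1) by force
  then show ?thesis
    using continuous_open_preimage[of "snd c ` fst c" "chart_inv c" W] chart_homeo[OF assms(1)]
      open_ran[OF assms(1)] assms(2) unfolding homeomorphism_def by simp
qed

lemma open_image': "c \<in> A \<Longrightarrow> open W \<Longrightarrow> W \<subseteq> fst c \<Longrightarrow> open (snd c ` W)"
  using open_image[of c W] by (simp add: inf_absorb2)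

lemma eventually_chart:
  assumes c: "c \<in> A" "p \<in> fst c" and ev: "\<forall>\<^sub>F q in nhds p. P q"
  obtains S where "open S" "snd c p \<in> S" "\<And>y. y \<in> S \<Longrightarrow> P (chart_inv c y)"
proof -
  obtain W where W: "open W" "p \<in> W" "\<And>q. q \<in> W \<Longrightarrow> P q" using ev unfolding eventually_nhds by blast
  show ?thesis
  proof (rule that[of "snd c ` (fst c \<inter> W)"])
    show "open (snd c ` (fst c \<inter> W))" using open_image c W by blast
    show "snd c p \<in> snd c ` (fst c \<inter> W)" using c W by blast
    show "P (chart_inv c y)" if "y \<in> snd c ` (fst c \<inter> W)" for y using that W c by auto
  qed
qed

lemma chart_pds_cong:
  assumes c: "c \<in> A" "p \<in> fst c" and ev: "\<forall>\<^sub>F q in nhds p. f q = g q"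
  shows "chart_pds c is f p = chart_pds c is g p"
proof -
  obtain S where S: "open S" "snd c p \<in> S" "\<And>y. y \<in> S \<Longrightarrow> f (chart_inv c y) = g (chart_inv c y)"
    using eventually_chart[OF c ev] by blast
  show ?thesis unfolding chart_pds_def by (rule pds_cong[OF S(1,2)]) (simp add: S(3))
qed

lemma chart_pds_append:
  assumes c: "c \<in> A" "p \<in> fst c"
  shows "chart_pds c (is @ js) f p = chart_pds c is (chart_pds c js f) p"
proof -
  have "pds is (pds js (f \<circ> chart_inv c)) (snd c p) = pds is (chart_pds c js f \<circ> chart_inv c) (snd c p)"
    by (rule pds_cong[OF open_ran[OF c(1)]]) (use c in \<open>auto simp: chart_pds_def\<close>)
  then show ?thesis by (simp add: chart_pds_def pds_append)
qed

lemma chart_pds_Cons: "c \<in> A \<Longrightarrow> p \<in> fst c \<Longrightarrow> chart_pds c (i # is) f p = cpd c i (chart_pds c is f) p"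
  using chart_pds_append[of c p "[i]" "is" f] by simp

text \<open>Smoothness in one chart suffices because the transition maps are smooth.\<close>

lemma smooth_fun_onI:
  assumes c: "c \<in> A" and W: "open W" "W \<subseteq> fst c" and f: "smooth_map_on (snd c ` W) (f \<circ> chart_inv c)"
  shows "smooth_fun_on A W f"
  unfolding smooth_fun_on_def
proof
  fix c' assume c': "c' \<in> A"
  let ?S = "snd c' ` (fst c' \<inter> W)" and ?\<tau> = "snd c \<circ> chart_inv c'"
  have S: "open ?S" using open_image[OF c' W(1)] .
  have \<tau>: "smooth_map_on ?S ?\<tau>"
    by (rule smooth_map_on_subset[OF transition_smooth[OF c' c]]) (use W in auto)
  have "smooth_map_on ?S (\<lambda>y. (f \<circ> chart_inv c) (?\<tau> y))"
    by (rule smooth_map_on_compose[OF S \<tau> _ f]) (use c' in auto)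
  then show "smooth_map_on ?S (f \<circ> chart_inv c')"
    by (subst smooth_map_on_cong[OF S, of _ "\<lambda>y. (f \<circ> chart_inv c) (?\<tau> y)"]) (use c c' W in auto)
qed

lemma smooth_fun_onD:
  "smooth_fun_on A W f \<Longrightarrow> c \<in> A \<Longrightarrow> W \<subseteq> fst c \<Longrightarrow> smooth_map_on (snd c ` W) (f \<circ> chart_inv c)"
  unfolding smooth_fun_on_def by (metis inf_absorb2)

lemma smooth_fun_on_subset: "smooth_fun_on A W f \<Longrightarrow> V \<subseteq> W \<Longrightarrow> smooth_fun_on A V f"
  unfolding smooth_fun_on_def by (meson Int_mono image_mono smooth_map_on_subset subset_refl)

lemma smooth_fun_on_Un: "smooth_fun_on A V f \<Longrightarrow> smooth_fun_on A W f \<Longrightarrow> smooth_fun_on A (V \<union> W) f"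
  unfolding smooth_fun_on_def Int_Un_distrib image_Un using smooth_map_on_Un by blast

lemma smooth_fun_on_cong:
  assumes W: "open W" and eq: "\<And>p. p \<in> W \<Longrightarrow> f p = g p"
  shows "smooth_fun_on A W f \<longleftrightarrow> smooth_fun_on A W g"
  unfolding smooth_fun_on_def
proof (rule ball_cong[OF refl])
  fix c assume c: "c \<in> A"
  show "smooth_map_on (snd c ` (fst c \<inter> W)) (f \<circ> chart_inv c) \<longleftrightarrow>
      smooth_map_on (snd c ` (fst c \<inter> W)) (g \<circ> chart_inv c)"
    by (rule smooth_map_on_cong[OF open_image[OF c W]]) (use c eq in auto)
qed

lemma smooth_fun_on_const: "smooth_fun_on A W (\<lambda>_. a)"
  unfolding smooth_fun_on_def comp_def by (simp add: smooth_map_on_const)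

lemma smooth_fun_on_add:
  assumes "open W" "smooth_fun_on A W f" "smooth_fun_on A W g"
  shows "smooth_fun_on A W (\<lambda>p. f p + g p)"
  using assms(2,3) smooth_map_on_add[OF open_image[OF _ assms(1)]]
  unfolding smooth_fun_on_def comp_def by blast

lemma smooth_fun_on_mult:
  fixes f g :: "'m \<Rightarrow> 'b::real_normed_algebra"
  assumes "open W" "smooth_fun_on A W f" "smooth_fun_on A W g"
  shows "smooth_fun_on A W (\<lambda>p. f p * g p)"
  using assms(2,3) smooth_map_on_mult[OF open_image[OF _ assms(1)]]
  unfolding smooth_fun_on_def comp_def by blast

lemma smooth_fun_on_sum:
  assumes "open W" "\<And>k. k \<in> I \<Longrightarrow> smooth_fun_on A W (f k)"
  shows "smooth_fun_on A W (\<lambda>p. \<Sum>k\<in>I. f k p)"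
  using assms(2)
  by (induction I rule: infinite_finite_induct)
    (auto intro: smooth_fun_on_const smooth_fun_on_add[OF assms(1)])

lemma smooth_fun_on_bounded_linear:
  assumes "bounded_linear h" "open W" "smooth_fun_on A W f"
  shows "smooth_fun_on A W (\<lambda>p. h (f p))"
  using assms(3) smooth_map_on_bounded_linear[OF assms(1) open_image[OF _ assms(2)]]
  unfolding smooth_fun_on_def comp_def by blast

lemma smooth_fun_on_vec:
  fixes f :: "'m \<Rightarrow> 'b::real_normed_vector^'k::finite"
  assumes "open W" "\<And>a. smooth_fun_on A W (\<lambda>p. f p $ a)"
  shows "smooth_fun_on A W f"
  unfolding smooth_fun_on_def comp_def
proof
  fix c assume c: "c \<in> A"
  show "smooth_map_on (snd c ` (fst c \<inter> W)) (\<lambda>y. f (chart_inv c y))"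
    by (rule smooth_map_on_vec[OF open_image[OF c assms(1)]])
      (use assms(2) c in \<open>simp add: smooth_fun_on_def comp_def\<close>)
qed

lemma smooth_fun_on_component:
  fixes f :: "'m \<Rightarrow> 'b::real_normed_vector^'k::finite"
  shows "open W \<Longrightarrow> smooth_fun_on A W f \<Longrightarrow> smooth_fun_on A W (\<lambda>p. f p $ a)"
  by (rule smooth_fun_on_bounded_linear[OF bounded_linear_vec_nth])

lemma smooth_fun_on_inverse:
  fixes f :: "'m \<Rightarrow> complex"
  assumes "open W" "smooth_fun_on A W f" "\<And>p. p \<in> W \<Longrightarrow> f p \<noteq> 0"
  shows "smooth_fun_on A W (\<lambda>p. inverse (f p))"
  unfolding smooth_fun_on_def comp_def
proof
  fix c assume c: "c \<in> A"
  show "smooth_map_on (snd c ` (fst c \<inter> W)) (\<lambda>y. inverse (f (chart_inv c y)))"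
    using assms(2,3) c unfolding smooth_fun_on_def comp_def
    by (intro smooth_map_on_inverse[OF open_image[OF c assms(1)]]) auto
qed

lemma smooth_fun_on_exp:
  fixes f :: "'m \<Rightarrow> complex"
  assumes "open W" "smooth_fun_on A W f"
  shows "smooth_fun_on A W (\<lambda>p. exp (f p))"
  using assms(2) smooth_map_on_exp[OF open_image[OF _ assms(1)]]
  unfolding smooth_fun_on_def comp_def by blast

lemma smooth_fun_on_Ln:
  assumes "open W" "smooth_fun_on A W f" "\<And>p. p \<in> W \<Longrightarrow> f p \<notin> \<real>\<^sub>\<le>\<^sub>0"
  shows "smooth_fun_on A W (\<lambda>p. Ln (f p))"
  unfolding smooth_fun_on_def comp_def
proof
  fix c assume c: "c \<in> A"
  show "smooth_map_on (snd c ` (fst c \<inter> W)) (\<lambda>y. Ln (f (chart_inv c y)))"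
    using assms(2,3) c unfolding smooth_fun_on_def comp_def
    by (intro smooth_map_on_Ln[OF open_image[OF c assms(1)]]) auto
qed

lemma differentiable_in_chart:
  assumes "smooth_fun_on A W f" "c \<in> A" "p \<in> fst c" "p \<in> W"
  shows "(f \<circ> chart_inv c) differentiable at (snd c p)"
  using assms unfolding smooth_fun_on_def
  by (intro smooth_map_on_differentiable[of "snd c ` (fst c \<inter> W)"]) auto

lemma smooth_fun_on_chart_pds:
  assumes c: "c \<in> A" and W: "open W" "W \<subseteq> fst c" and f: "smooth_fun_on A W f"
  shows "smooth_fun_on A W (chart_pds c is f)"
proof (rule smooth_fun_onI[OF c W])
  have S: "open (snd c ` W)" using open_image'[OF c W] .
  have "smooth_map_on (snd c ` W) (pds is (f \<circ> chart_inv c))"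
    by (intro smooth_map_on_pds smooth_fun_onD f c W)
  then show "smooth_map_on (snd c ` W) (chart_pds c is f \<circ> chart_inv c)"
    by (subst smooth_map_on_cong[OF S, of _ "pds is (f \<circ> chart_inv c)"])
      (use c W in \<open>auto simp: chart_pds_def\<close>)
qed

lemma cpd_eq: "cpd c i f p = pd i (\<lambda>y. f (chart_inv c y)) (snd c p)"
  by (simp add: chart_pds_def comp_def)

lemma cpd_add:
  assumes "c \<in> A" "p \<in> fst c" "p \<in> W" "smooth_fun_on A W f" "smooth_fun_on A W g"
  shows "cpd c i (\<lambda>p. f p + g p) p = cpd c i f p + cpd c i g p"
  unfolding cpd_eq using differentiable_in_chart[OF assms(4,1-3)] differentiable_in_chart[OF assms(5,1-3)]
  by (intro pd_add) (simp_all add: comp_def)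

lemma cpd_mult:
  fixes f g :: "'m \<Rightarrow> 'b::real_normed_field"
  assumes "c \<in> A" "p \<in> fst c" "p \<in> W" "smooth_fun_on A W f" "smooth_fun_on A W g"
  shows "cpd c i (\<lambda>p. f p * g p) p = cpd c i f p * g p + f p * cpd c i g p"
  unfolding cpd_eq using differentiable_in_chart[OF assms(4,1-3)] differentiable_in_chart[OF assms(5,1-3)]
  by (subst pd_mult) (simp_all add: comp_def assms(1,2))

lemma cpd_const: "cpd c i (\<lambda>_. a) p = 0"
  unfolding cpd_eq by (rule pd_eqI[OF has_derivative_const])

lemma cpd_sum:
  assumes "c \<in> A" "p \<in> fst c" "open W" "p \<in> W" "\<And>k. k \<in> I \<Longrightarrow> smooth_fun_on A W (f k)"
  shows "cpd c i (\<lambda>p. \<Sum>k\<in>I. f k p) p = (\<Sum>k\<in>I. cpd c i (f k) p)"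
  using assms(5)
proof (induction I rule: infinite_finite_induct)
  case (insert k I)
  then show ?case
    using cpd_add[OF assms(1,2,4), of "f k" "\<lambda>p. \<Sum>k\<in>I. f k p" i] smooth_fun_on_sum[OF assms(3), of I f]
    by simp
qed (simp_all add: cpd_const)

lemma cpd_commute:
  assumes c: "c \<in> A" "p \<in> fst c" and W: "open W" "p \<in> W" and f: "smooth_fun_on A W f"
  shows "cpd c i (cpd c j f) p = cpd c j (cpd c i f) p"
proof -
  have "pd i (pd j (f \<circ> chart_inv c)) (snd c p) = pd j (pd i (f \<circ> chart_inv c)) (snd c p)"
    using c W f by (intro pd_commute[of "snd c ` (fst c \<inter> W)"] open_image) (auto simp: smooth_fun_on_def)
  then show ?thesis
    using chart_pds_append[OF c, of "[i]" "[j]" f] chart_pds_append[OF c, of "[j]" "[i]" f]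
    by (simp add: chart_pds_def)
qed

lemma cpd_bounded_linear:
  assumes "bounded_linear h" "smooth_fun_on A W f" "c \<in> A" "p \<in> fst c" "p \<in> W"
  shows "cpd c i (\<lambda>p. h (f p)) p = h (cpd c i f p)"
  unfolding cpd_eq using differentiable_in_chart[OF assms(2-5)]
  by (intro pd_bounded_linear[OF assms(1)]) (simp add: comp_def)

lemma cpd_coordinate:
  assumes c: "c \<in> A" "p \<in> fst c"
  shows "cpd c i (\<lambda>p. complex_of_real (snd c p $ j - a)) p = (if i = j then 1 else 0)"
proof -
  have "pd i (\<lambda>y. complex_of_real (snd c (chart_inv c y) $ j - a)) (snd c p) =
      pd i (\<lambda>y. complex_of_real (y $ j - a)) (snd c p)"
    by (rule pd_cong[OF open_ran[OF c(1)]]) (use c in auto)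
  also have "\<dots> = complex_of_real (axis i 1 $ j)"
    by (rule pd_eqI) (auto intro!: derivative_eq_intros bounded_linear_imp_has_derivative[OF bounded_linear_vec_nth])
  finally show ?thesis unfolding cpd_eq by (simp add: axis_def)
qed

lemma smooth_coordinate:
  assumes c: "c \<in> A"
  shows "smooth_fun_on A (fst c) (\<lambda>p. complex_of_real (snd c p $ j - a))"
proof (rule smooth_fun_onI[OF c open_dom[OF c] subset_refl])
  have S: "open (snd c ` fst c)" using open_ran[OF c] .
  have "smooth_map_on (snd c ` fst c) (\<lambda>y. complex_of_real (y $ j + - a))"
    by (intro smooth_map_on_bounded_linear[OF bounded_linear_of_real S] smooth_map_on_add[OF S]
        smooth_map_on_component[OF S] smooth_map_on_id smooth_map_on_const)
  then show "smooth_map_on (snd c ` fst c) ((\<lambda>p. complex_of_real (snd c p $ j - a)) \<circ> chart_inv c)"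
    by (subst smooth_map_on_cong[OF S, of _ "\<lambda>y. complex_of_real (y $ j + - a)"]) (use c in auto)
qed

subsection \<open>Change of charts\<close>

lemma jac_nth:
  assumes "c \<in> A" "c' \<in> A" "p \<in> fst c" "p \<in> fst c'"
  shows "jac c c' p $ a $ i = cpd c i (\<lambda>q. snd c' q $ a) p"
proof -
  have "(snd c' \<circ> chart_inv c) differentiable at (snd c p)"
    using assms by (intro smooth_map_on_differentiable[OF transition_smooth[OF assms(1,2)]]) auto
  then have "pd i (\<lambda>y. (snd c' \<circ> chart_inv c) y $ a) (snd c p) = pd i (snd c' \<circ> chart_inv c) (snd c p) $ a"
    by (rule pd_component)
  then show ?thesis
    unfolding jac_def matrix_def cpd_eq by (simp add: pd_def comp_def)
qed

lemma smooth_coordinate_real: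
  assumes c: "c \<in> A" and c': "c' \<in> A"
  shows "smooth_fun_on A (fst c \<inter> fst c') (\<lambda>p. snd c' p $ a)"
proof -
  have W: "open (fst c \<inter> fst c')" using open_dom c c' by blast
  show ?thesis
    using transition_smooth[OF c c'] smooth_map_on_component[OF open_image[OF c open_dom[OF c']]]
    by (intro smooth_fun_onI[OF c W]) (auto simp: comp_def)
qed

lemma smooth_jac:
  assumes c: "c \<in> A" and c': "c' \<in> A"
  shows "smooth_fun_on A (fst c \<inter> fst c') (\<lambda>p. jac c c' p $ a $ i)"
proof -
  have W: "open (fst c \<inter> fst c')" using open_dom c c' by blast
  show ?thesis
    using smooth_fun_on_chart_pds[OF c W _ smooth_coordinate_real[OF c c'], of "[i]"]
    by (subst smooth_fun_on_cong[OF W jac_nth]) (use c c' in auto)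
qed

lemma cpd_change:
  assumes c: "c \<in> A" "c' \<in> A" "p \<in> fst c" "p \<in> fst c'" and W: "open W" "p \<in> W" and f: "smooth_fun_on A W f"
  shows "cpd c i f p = (\<Sum>a\<in>UNIV. (jac c c' p $ a $ i) *\<^sub>R cpd c' a f p)"
proof -
  let ?\<tau> = "snd c' \<circ> chart_inv c" and ?S = "snd c ` (fst c \<inter> fst c')"
  have S: "open ?S" "snd c p \<in> ?S" using open_image[OF c(1) open_dom[OF c(2)]] c by auto
  have \<tau>: "?\<tau> differentiable at (snd c p)"
    using c by (intro smooth_map_on_differentiable[OF transition_smooth[OF c(1,2)]]) auto
  have \<tau>p: "?\<tau> (snd c p) = snd c' p" using c by simp
  have fd: "(f \<circ> chart_inv c') differentiable at (?\<tau> (snd c p))"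
    unfolding \<tau>p using differentiable_in_chart[OF f c(2,4) W(2)] .
  have "cpd c i f p = pd i (\<lambda>y. (f \<circ> chart_inv c') (?\<tau> y)) (snd c p)"
    unfolding cpd_eq by (rule pd_cong[OF S]) (use c in auto)
  also have "\<dots> = (\<Sum>a\<in>UNIV. (pd i ?\<tau> (snd c p) $ a) *\<^sub>R pd a (f \<circ> chart_inv c') (?\<tau> (snd c p)))"
    by (rule pd_compose[OF fd \<tau>])
  also have "\<dots> = (\<Sum>a\<in>UNIV. (jac c c' p $ a $ i) *\<^sub>R cpd c' a f p)"
    using \<tau>p by (simp add: jac_nth[OF c] cpd_eq pd_component[OF \<tau>, unfolded comp_def] comp_def)
  finally show ?thesis .
qed

lemma jac_self:
  assumes c: "c \<in> A" "p \<in> fst c"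
  shows "jac c c p = mat 1"
proof -
  have "jac c c p $ a $ i = (mat 1 :: real^'n^'n) $ a $ i" for a i
  proof -
    have "pd i (\<lambda>y. snd c (chart_inv c y) $ a) (snd c p) = pd i (\<lambda>y. y $ a) (snd c p)"
      by (rule pd_cong[OF open_ran[OF c(1)]]) (use c in auto)
    also have "\<dots> = (axis i 1 :: real^'n) $ a"
      by (rule pd_eqI) (rule bounded_linear_imp_has_derivative[OF bounded_linear_vec_nth])
    finally show ?thesis using c by (simp add: jac_nth cpd_eq axis_def mat_def)
  qed
  then show ?thesis by (simp add: vec_eq_iff)
qed

lemma jac_cocycle:
  assumes c: "c \<in> A" "c' \<in> A" "c'' \<in> A" "p \<in> fst c" "p \<in> fst c'" "p \<in> fst c''"
  shows "jac c c'' p = jac c' c'' p ** jac c c' p"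
proof -
  have W: "open (fst c' \<inter> fst c'')" using open_dom c by blast
  have "jac c c'' p $ a $ i = (jac c' c'' p ** jac c c' p) $ a $ i" for a i
  proof -
    have "jac c c'' p $ a $ i = (\<Sum>b\<in>UNIV. (jac c c' p $ b $ i) *\<^sub>R cpd c' b (\<lambda>q. snd c'' q $ a) p)"
      unfolding jac_nth[OF c(1,3,4,6)]
      by (rule cpd_change[OF c(1,2,4,5) W _ smooth_coordinate_real[OF c(2,3)]]) (use c in auto)
    then show ?thesis
      by (simp add: matrix_matrix_mult_def jac_nth[OF c(2,3,5,6), symmetric] mult.commute)
  qed
  then show ?thesis by (simp add: vec_eq_iff)
qed

lemma jac_inverse:
  assumes "c \<in> A" "c' \<in> A" "p \<in> fst c" "p \<in> fst c'"
  shows "jac c' c p ** jac c c' p = mat 1"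
  using jac_cocycle[of c c' c p] jac_self[of c p] assms by simp

subsection \<open>Extension by zero\<close>

text \<open>Functions are smooth on unions of open sets where they are smooth; here the second set is the
  complement of the closed support.\<close>

lemma smooth_extend_zero:
  assumes W: "open W" "open O'" and K: "closed K" "K \<subseteq> W" and f: "smooth_fun_on A (W \<inter> O') f"
    and zero: "\<And>p. p \<in> O' \<Longrightarrow> p \<notin> K \<Longrightarrow> f p = 0"
  shows "smooth_fun_on A O' f"
proof -
  have "smooth_fun_on A (O' - K) f"
    using smooth_fun_on_cong[of "O' - K" f "\<lambda>_. 0"] smooth_fun_on_const W K zero by (auto simp: open_Diff)
  then have "smooth_fun_on A ((W \<inter> O') \<union> (O' - K)) f" using f smooth_fun_on_Un by blast
  moreover have "(W \<inter> O') \<union> (O' - K) = O'" using K by blast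
  ultimately show ?thesis by simp
qed

text \<open>A bump function in a chart, extended by zero. The closed ball is compact, so its image in the
  manifold is closed by the Hausdorff property; otherwise the extension might not even be continuous.\<close>

lemma bump_exists:
  assumes W: "open W" "x \<in> W"
  obtains b :: "'m \<Rightarrow> complex" and K where "closed K" "K \<subseteq> W" "smooth_fun_on A UNIV b"
    "\<And>p. p \<notin> K \<Longrightarrow> b p = 0" "\<forall>\<^sub>F p in nhds x. b p = 1"
proof -
  obtain c where c: "c \<in> A" "x \<in> fst c" using chart_ex by blast
  define V where "V = fst c \<inter> W"
  have V: "open V" "x \<in> V" "V \<subseteq> fst c" "V \<subseteq> W" using W c open_dom[OF c(1)] by (auto simp: V_def)
  have oV: "open (snd c ` V)" using open_image'[OF c(1) V(1,3)] .
  then obtain r where r: "r > 0" "cball (snd c x) r \<subseteq> snd c ` V"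
    using V(2) unfolding open_contains_cball by blast
  obtain b0 :: "real^'n \<Rightarrow> real" where b0: "smooth_map_on UNIV b0"
    "\<And>y. dist (snd c x) y \<le> r/2 \<Longrightarrow> b0 y = 1" "\<And>y. dist (snd c x) y \<ge> r \<Longrightarrow> b0 y = 0"
    by (rule smooth_bump_function[OF r(1), of "snd c x"]) (rule that)
  define K where "K = chart_inv c ` cball (snd c x) r"
  define b where "b p = (if p \<in> V then complex_of_real (b0 (snd c p)) else 0)" for p
  have "K \<subseteq> chart_inv c ` (snd c ` V)" using r(2) by (auto simp: K_def)
  also have "\<dots> \<subseteq> V" using c V by auto
  finally have KV: "K \<subseteq> V" .
  have "cball (snd c x) r \<subseteq> snd c ` fst c" using r(2) V(3) by blast
  moreover have "continuous_on (snd c ` fst c) (chart_inv c)"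
    using chart_homeo[OF c(1)] by (simp add: homeomorphism_def)
  ultimately have "continuous_on (cball (snd c x) r) (chart_inv c)"
    by (rule continuous_on_subset[rotated])
  then have "compact K"
    unfolding K_def by (rule compact_continuous_image) (rule compact_cball)
  then have K: "closed K" by (rule compact_imp_closed)
  have zero: "b p = 0" if "p \<notin> K" for p
  proof (cases "p \<in> V")
    case True
    then have "snd c p \<notin> cball (snd c x) r"
      using that c V(3) by (force simp: K_def)
    then show ?thesis using b0(3) by (simp add: b_def)
  qed (simp add: b_def)
  have "smooth_map_on (snd c ` V) (\<lambda>y. complex_of_real (b0 y))"
    using smooth_map_on_bounded_linear[OF bounded_linear_of_real oV] smooth_map_on_subset[OF b0(1)] by blast
  then have "smooth_map_on (snd c ` V) (b \<circ> chart_inv c)"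
    by (subst smooth_map_on_cong[OF oV, of _ "\<lambda>y. complex_of_real (b0 y)"]) (use c V in \<open>auto simp: b_def\<close>)
  then have "smooth_fun_on A (V \<inter> UNIV) b" using smooth_fun_onI[OF c(1) V(1,3)] by simp
  then have smooth: "smooth_fun_on A UNIV b"
    by (rule smooth_extend_zero[OF V(1) open_UNIV K KV]) (use zero in blast)
  have "continuous_on V (snd c)"
    using chart_homeo[OF c(1)] V(3) by (auto simp: homeomorphism_def intro: continuous_on_subset)
  then have o: "open (V \<inter> snd c -` ball (snd c x) (r/2))"
    using V(1) by (intro continuous_open_preimage) auto
  have "\<forall>\<^sub>F p in nhds x. b p = 1"
    unfolding eventually_nhds
    by (rule exI[of _ "V \<inter> snd c -` ball (snd c x) (r/2)"]) (use o V r b0(2) in \<open>auto simp: b_def\<close>)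
  then show ?thesis by (intro that[OF K _ smooth zero]) (use KV V(4) in auto)
qed

lemma germ_extension:
  fixes f :: "'m \<Rightarrow> complex"
  assumes "smooth_near A x f"
  obtains g where "smooth_fun_on A UNIV g" "\<forall>\<^sub>F p in nhds x. g p = f p"
proof -
  obtain W where W: "open W" "x \<in> W" "smooth_fun_on A W f" using assms unfolding smooth_near_def by blast
  obtain b :: "'m \<Rightarrow> complex" and K where b: "closed K" "K \<subseteq> W" "smooth_fun_on A UNIV b"
    "\<And>p. p \<notin> K \<Longrightarrow> b p = 0" "\<forall>\<^sub>F p in nhds x. b p = 1" by (rule bump_exists[OF W(1,2)]) (rule that)
  have "smooth_fun_on A (W \<inter> UNIV) (\<lambda>p. b p * f p)"
    using smooth_fun_on_mult[OF W(1) smooth_fun_on_subset[OF b(3)] W(3)] by simp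
  then have "smooth_fun_on A UNIV (\<lambda>p. b p * f p)"
    by (rule smooth_extend_zero[OF W(1) open_UNIV b(1,2)]) (simp add: b(4))
  moreover have "\<forall>\<^sub>F p in nhds x. b p * f p = f p" using b(5) by eventually_elim simp
  ultimately show ?thesis by (rule that)
qed

text \<open>Every germ of a multiple of a coordinate vector field extends to a global vector field, by a cut-off
  in the chart. In the other charts the components are prescribed by the transformation law, and
  their compatibility is the cocycle property of the Jacobians.\<close>

lemma vector_field_extension:
  fixes w :: "'m \<Rightarrow> complex"
  assumes c: "c \<in> A" "x \<in> fst c" and w: "smooth_near A x w"
  obtains v where "vector_field A v" "\<forall>\<^sub>F p in nhds x. v c p = axis i (w p)"
proof -
  obtain g where g: "smooth_fun_on A UNIV g" "\<forall>\<^sub>F p in nhds x. g p = w p" by (rule germ_extension[OF w]) (rule that)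
  obtain b :: "'m \<Rightarrow> complex" and K where b: "closed K" "K \<subseteq> fst c" "smooth_fun_on A UNIV b"
    "\<And>p. p \<notin> K \<Longrightarrow> b p = 0" "\<forall>\<^sub>F p in nhds x. b p = 1"
    by (rule bump_exists[OF open_dom[OF c(1)] c(2)]) (rule that)
  define v where "v c' p = (if p \<in> K then \<chi> a. complex_of_real (jac c c' p $ a $ i) * (b p * g p) else 0)"
    for c' and p
  have v_on: "v c' p $ a = complex_of_real (jac c c' p $ a $ i) * (b p * g p)" for c' p a
    by (simp add: v_def b(4))
  have "vector_field A v"
    unfolding vector_field_def
  proof (intro conjI ballI)
    fix c' assume c': "c' \<in> A"
    have o: "open (fst c \<inter> fst c')" using open_dom c(1) c' by blast
    have "smooth_fun_on A (fst c \<inter> fst c') (\<lambda>p. complex_of_real (jac c c' p $ a $ i) * (b p * g p))" for a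
      by (intro smooth_fun_on_mult[OF o] smooth_fun_on_bounded_linear[OF bounded_linear_of_real o]
          smooth_jac c(1) c' smooth_fun_on_subset[OF b(3)] smooth_fun_on_subset[OF g(1)] subset_UNIV)
    then have "smooth_fun_on A (fst c \<inter> fst c') (v c')"
      by (intro smooth_fun_on_vec[OF o]) (simp add: v_on)
    then show "smooth_fun_on A (fst c') (v c')"
      by (rule smooth_extend_zero[OF open_dom[OF c(1)] open_dom[OF c'] b(1,2)]) (simp add: v_def)
  next
    fix c' c'' p assume c': "c' \<in> A" "c'' \<in> A" and p: "p \<in> fst c' \<inter> fst c''"
    show "v c'' p = map_matrix complex_of_real (jac c' c'' p) *v v c' p"
    proof (cases "p \<in> K")
      case True
      then have "jac c c'' p = jac c' c'' p ** jac c c' p"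
        using b(2) c c' p by (intro jac_cocycle) auto
      then show ?thesis
        by (simp add: vec_eq_iff v_on matrix_vector_mult_def map_matrix_def matrix_matrix_mult_def
            sum_distrib_right mult.assoc)
    qed (simp add: v_def)
  qed
  moreover have "\<forall>\<^sub>F p in nhds x. v c p = axis i (w p)"
    using g(2) b(5) eventually_nhds_in_open[OF open_dom[OF c(1)] c(2)]
  proof eventually_elim
    case (elim p)
    then show ?case using c by (simp add: vec_eq_iff v_on jac_self axis_def mat_def)
  qed
  ultimately show ?thesis by (rule that)
qed

end

section \<open>Divergence\<close>

lemma permutation_moves_another:
  assumes "p permutes UNIV" "p \<noteq> id"
  shows "\<exists>j. j \<noteq> a \<and> p j \<noteq> j"
proof -
  obtain k where k: "p k \<noteq> k" using assms(2) by (auto simp: fun_eq_iff)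
  have "inj p" using assms(1) permutes_inj by blast
  then have "p (p a) \<noteq> p a" if "k = a" using k that by (metis injD)
  then show ?thesis using k by metis
qed

text \<open>The derivative of the determinant at the identity is the trace: in the Leibniz expansion, a
  permutation other than the identity moves at least two indices, so each of its terms retains a
  vanishing off-diagonal factor after one differentiation.\<close>

lemma pd_det_at_identity:
  fixes N :: "real^'n::finite \<Rightarrow> real^'k::finite^'k"
  assumes d: "\<And>a b. (\<lambda>y. N y $ a $ b) differentiable at y" and 1: "N y = mat 1"
  shows "(\<lambda>y. det (N y)) differentiable at y"
    and "pd i (\<lambda>y. det (N y)) y = (\<Sum>a\<in>UNIV. pd i (\<lambda>y. N y $ a $ a) y)"
proof -
  let ?F = "\<lambda>a b. frechet_derivative (\<lambda>y. N y $ a $ b) (at y)"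
  let ?P = "{p. p permutes (UNIV :: 'k set)}"
  have F: "((\<lambda>y. N y $ a $ b) has_derivative ?F a b) (at y)" for a b
    using d frechet_derivative_works by blast
  have det: "((\<lambda>y. det (N y)) has_derivative
      (\<lambda>h. \<Sum>p\<in>?P. of_int (sign p) * (\<Sum>a\<in>UNIV. ?F a (p a) h * (\<Prod>j\<in>UNIV - {a}. N y $ j $ p j)))) (at y)"
    unfolding det_def
    by (intro has_derivative_sum has_derivative_mult_right has_derivative_prod F)
  then show "(\<lambda>y. det (N y)) differentiable at y" unfolding differentiable_def by blast
  have *: "(\<Prod>j\<in>UNIV - {a}. N y $ j $ p j) = (if p = id then 1 else 0)" if p: "p \<in> ?P" for p a
  proof (cases "p = id")
    case False
    then obtain j where "j \<noteq> a" "p j \<noteq> j" using permutation_moves_another[of p a] p by blast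
    then show ?thesis using False 1 by (auto simp: mat_def intro!: prod_zero bexI[of _ j])
  qed (simp add: 1 mat_def)
  have "pd i (\<lambda>y. det (N y)) y =
      (\<Sum>p\<in>?P. of_int (sign p) * (\<Sum>a\<in>UNIV. ?F a (p a) (axis i 1) * (\<Prod>j\<in>UNIV - {a}. N y $ j $ p j)))"
    by (rule pd_eqI[OF det])
  also have "\<dots> = (\<Sum>p\<in>?P. if p = id then \<Sum>a\<in>UNIV. ?F a (p a) (axis i 1) else 0)"
    by (intro sum.cong refl) (simp add: * sign_id)
  also have "\<dots> = (\<Sum>a\<in>UNIV. ?F a a (axis i 1))"
    by (simp add: permutes_id)
  finally show "pd i (\<lambda>y. det (N y)) y = (\<Sum>a\<in>UNIV. pd i (\<lambda>y. N y $ a $ a) y)"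
    by (simp add: pd_def)
qed

text \<open>Jacobi's formula, reduced to the identity matrix by multiplication with the inverse.\<close>

lemma pd_det:
  fixes N :: "real^'n::finite \<Rightarrow> real^'k::finite^'k"
  assumes d: "\<And>a b. (\<lambda>y. N y $ a $ b) differentiable at y" and K: "K ** N y = mat 1"
  shows "pd i (\<lambda>y. det (N y)) y =
    det (N y) * (\<Sum>k\<in>UNIV. \<Sum>a\<in>UNIV. K $ k $ a * pd i (\<lambda>y. N y $ a $ k) y)"
proof -
  define L where "L z = K ** N z" for z
  have L_nth: "L z $ k $ l = (\<Sum>a\<in>UNIV. K $ k $ a * N z $ a $ l)" for z k l
    by (simp add: L_def matrix_matrix_mult_def)
  have H: "((\<lambda>z. L z $ k $ l) has_derivative
      (\<lambda>h. \<Sum>a\<in>UNIV. K $ k $ a * frechet_derivative (\<lambda>y. N y $ a $ l) (at y) h)) (at y)" for k l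
    unfolding L_nth using d frechet_derivative_works
    by (intro has_derivative_sum has_derivative_mult_right) blast
  then have dL: "(\<lambda>z. L z $ k $ l) differentiable at y" for k l unfolding differentiable_def by blast
  have L1: "L y = mat 1" using K by (simp add: L_def)
  have "det K * det (N y) = 1" using K by (metis det_I det_mul)
  then have det: "det (N z) = det (N y) * det (L z)" for z
    by (simp add: L_def det_mul mult_ac)
  have "pd i (\<lambda>z. det (N z)) y = pd i (\<lambda>z. det (N y) * det (L z)) y"
    using arg_cong[OF ext[OF det], of "\<lambda>f. pd i f y"] .
  also have "\<dots> = det (N y) * pd i (\<lambda>z. det (L z)) y"
    by (rule pd_bounded_linear[OF bounded_linear_mult_right])
      (rule pd_det_at_identity(1)[of L, OF dL L1])
  also have "pd i (\<lambda>z. det (L z)) y = (\<Sum>k\<in>UNIV. pd i (\<lambda>z. L z $ k $ k) y)"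
    by (rule pd_det_at_identity(2)[of L, OF dL L1])
  also have "\<dots> = (\<Sum>k\<in>UNIV. \<Sum>a\<in>UNIV. K $ k $ a * pd i (\<lambda>y. N y $ a $ k) y)"
    by (intro sum.cong refl) (simp only: pd_eqI[OF H], simp only: pd_def)
  finally show ?thesis .
qed

lemma det_identity_row:
  fixes z :: "'a::field^'n::finite"
  shows "det (\<chi> k. if k = i then z else axis k 1) = z $ i"
proof -
  have row: "row j (mat 1 :: 'a^'n^'n) = axis j 1" for j
    by (auto simp: row_def mat_def axis_def vec_eq_iff)
  show ?thesis
    using cramer_lemma_transpose[of i z "mat 1 :: 'a^'n^'n", unfolded row basis_expansion] by (simp add: det_I)
qed

lemma sum_rotate:
  "(\<Sum>a\<in>I. \<Sum>k\<in>J. \<Sum>i\<in>L. F a k i) = (\<Sum>k\<in>J. \<Sum>i\<in>L. \<Sum>a\<in>I. F a k i)"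
  by (subst sum.swap) (rule sum.cong[OF refl], rule sum.swap)

lemma sum_reverse:
  "(\<Sum>a\<in>I. \<Sum>k\<in>J. \<Sum>i\<in>L. F a k i) = (\<Sum>i\<in>L. \<Sum>k\<in>J. \<Sum>a\<in>I. F a k i)"
  unfolding sum_rotate[where F = F and I = I and J = J and L = L] by (rule sum.swap)

context manifold
begin

lemma smooth_fun_on_of_real:
  "open W \<Longrightarrow> smooth_fun_on A W g \<Longrightarrow> smooth_fun_on A W (\<lambda>p. complex_of_real (g p))"
  by (rule smooth_fun_on_bounded_linear[OF bounded_linear_of_real])

lemma cpd_of_real:
  "smooth_fun_on A W g \<Longrightarrow> c \<in> A \<Longrightarrow> p \<in> fst c \<Longrightarrow> p \<in> W \<Longrightarrow>
    cpd c i (\<lambda>p. complex_of_real (g p)) p = complex_of_real (cpd c i g p)"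
  by (rule cpd_bounded_linear[OF bounded_linear_of_real])

lemma smooth_fun_on_prod:
  fixes f :: "'k \<Rightarrow> 'm \<Rightarrow> 'b::real_normed_field"
  assumes "open W" "\<And>k. k \<in> I \<Longrightarrow> smooth_fun_on A W (f k)"
  shows "smooth_fun_on A W (\<lambda>p. \<Prod>k\<in>I. f k p)"
  using assms(2)
  by (induction I rule: infinite_finite_induct)
    (auto intro: smooth_fun_on_const smooth_fun_on_mult[OF assms(1)])

lemma smooth_det_jac:
  assumes c: "c \<in> A" "c' \<in> A"
  shows "smooth_fun_on A (fst c \<inter> fst c') (\<lambda>p. det (jac c c' p))"
proof -
  have o: "open (fst c \<inter> fst c')" using open_dom c by blast
  show ?thesis
    unfolding det_def
    by (intro smooth_fun_on_sum[OF o] smooth_fun_on_mult[OF o] smooth_fun_on_const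
        smooth_fun_on_prod[OF o] smooth_jac c)
qed

lemma cpd_det_jac:
  assumes c: "c \<in> A" "c' \<in> A" "p \<in> fst c" "p \<in> fst c'"
  shows "cpd c i (\<lambda>q. det (jac c c' q)) p =
    det (jac c c' p) * (\<Sum>k\<in>UNIV. \<Sum>a\<in>UNIV. jac c' c p $ k $ a * cpd c i (\<lambda>q. jac c c' q $ a $ k) p)"
  unfolding cpd_eq
proof (subst pd_det)
  show "(\<lambda>y. jac c c' (chart_inv c y) $ a $ b) differentiable at (snd c p)" for a b
    using differentiable_in_chart[OF smooth_jac[OF c(1,2)] c(1,3)] c by (simp add: comp_def)
  show "jac c' c p ** jac c c' (chart_inv c (snd c p)) = mat 1"
    using jac_inverse[OF c] c by simp
qed (use c in simp)

text \<open>Both sides are mixed second derivatives of a component of the transition map.\<close>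

lemma jac_symmetric:
  assumes c: "c \<in> A" "c' \<in> A" "p \<in> fst c" "p \<in> fst c'"
  shows "cpd c k (\<lambda>q. jac c c' q $ a $ i) p = cpd c i (\<lambda>q. jac c c' q $ a $ k) p"
proof -
  have o: "open (fst c \<inter> fst c')" using open_dom c by blast
  then have ev: "\<forall>\<^sub>F q in nhds p. q \<in> fst c \<inter> fst c'"
    using c by (intro eventually_nhds_in_open) auto
  have "cpd c k (\<lambda>q. jac c c' q $ a $ i) p = cpd c k (cpd c i (\<lambda>q. snd c' q $ a)) p" for i k
    by (rule chart_pds_cong[OF c(1,3)]) (use ev in eventually_elim, use c in \<open>simp add: jac_nth\<close>)
  then show ?thesis
    using cpd_commute[OF c(1,3) o _ smooth_coordinate_real[OF c(1,2)], of k i a] c by simp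
qed

lemma cpd_change_complex:
  fixes f :: "'m \<Rightarrow> complex"
  assumes c: "c \<in> A" "c' \<in> A" "p \<in> fst c" "p \<in> fst c'" and W: "open W" "p \<in> W" and f: "smooth_fun_on A W f"
  shows "cpd c i f p = (\<Sum>a\<in>UNIV. complex_of_real (jac c c' p $ a $ i) * cpd c' a f p)"
  using cpd_change[OF assms] by (simp add: scaleR_conv_of_real)

lemma vector_field_change:
  assumes v: "vector_field A v" and c: "c \<in> A" "c' \<in> A" "p \<in> fst c" "p \<in> fst c'"
  shows "v c' p $ a = (\<Sum>i\<in>UNIV. complex_of_real (jac c c' p $ a $ i) * v c p $ i)"
proof -
  have "v c' p = map_matrix complex_of_real (jac c c' p) *v v c p"
    using v c unfolding vector_field_def by blast
  then show ?thesis by (simp add: matrix_vector_mult_def map_matrix_def)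
qed

lemma dir_deriv_change:
  assumes v: "vector_field A v" and c: "c \<in> A" "c' \<in> A" "p \<in> fst c" "p \<in> fst c'"
    and W: "open W" "p \<in> W" and f: "smooth_fun_on A W f"
  shows "dir_deriv c' (v c') f p = dir_deriv c (v c) f p"
proof -
  have "dir_deriv c' (v c') f p =
      (\<Sum>a\<in>UNIV. \<Sum>i\<in>UNIV. complex_of_real (jac c c' p $ a $ i) * v c p $ i * cpd c' a f p)"
    by (simp add: dir_deriv_def vector_field_change[OF v c] sum_distrib_right)
  also have "\<dots> = (\<Sum>i\<in>UNIV. \<Sum>a\<in>UNIV. complex_of_real (jac c c' p $ a $ i) * v c p $ i * cpd c' a f p)"
    by (rule sum.swap)
  also have "\<dots> = dir_deriv c (v c) f p"
    by (simp add: dir_deriv_def cpd_change_complex[OF c W f] sum_distrib_left mult_ac)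
  finally show ?thesis .
qed

lemma chart_at_props: "chart_at A p \<in> A" "p \<in> fst (chart_at A p)"
proof -
  have "chart_at A p \<in> A \<and> p \<in> fst (chart_at A p)"
    unfolding chart_at_def by (rule someI_ex) (use chart_ex[of p] in blast)
  then show "chart_at A p \<in> A" "p \<in> fst (chart_at A p)" by blast+
qed

lemma vf_apply_eq:
  assumes "vector_field A v" "c \<in> A" "p \<in> fst c" "open W" "p \<in> W" "smooth_fun_on A W f"
  shows "vf_apply A v f p = (\<Sum>i\<in>UNIV. v c p $ i * cpd c i f p)"
  unfolding vf_apply_def
  by (subst dir_deriv_change[of v c _ _ W])
    (use assms chart_at_props in \<open>auto simp: dir_deriv_def\<close>)

definition div_chart :: "('m, 'n) vfield \<Rightarrow> ('m, 'n) chart \<Rightarrow> 'm \<Rightarrow> complex" where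
  "div_chart v c p = (\<Sum>i\<in>UNIV. cpd c i (\<lambda>q. v c q $ i) p)"

text \<open>In coordinates, \<open>\<L>\<^sub>v(r dx) = (v r + r div v) dx\<close>: replacing one vector of the coordinate frame by its
  bracket with \<open>v\<close> leaves a matrix with a single nontrivial row, whose determinant is a diagonal entry.\<close>

lemma lie_form_eq:
  "lie_form v \<omega> c p = (\<Sum>i\<in>UNIV. v c p $ i * cpd c i (\<omega> c) p) + \<omega> c p * div_chart v c p"
proof -
  have id: "form_eval (\<omega> c) (coord_frame :: 'n \<Rightarrow> 'm \<Rightarrow> complex^'n) = \<omega> c"
  proof
    fix p :: 'm
    have "(\<chi> k. coord_frame k p) = (mat 1 :: complex^'n^'n)"
      by (auto simp: coord_frame_def vec_eq_iff axis_def mat_def)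
    then show "form_eval (\<omega> c) (coord_frame :: 'n \<Rightarrow> 'm \<Rightarrow> complex^'n) p = \<omega> c p"
      by (simp add: form_eval_def det_I)
  qed
  have bracket: "form_eval (\<omega> c) (coord_frame(i := lie_bracket c (v c) (coord_frame i))) p =
      - (\<omega> c p * cpd c i (\<lambda>q. v c q $ i) p)" for i
  proof -
    have "(\<chi> k. (coord_frame(i := lie_bracket c (v c) (coord_frame i))) k p) =
        (\<chi> k. if k = i then lie_bracket c (v c) (coord_frame i) p else axis k 1)"
      by (auto simp: vec_eq_iff coord_frame_def)
    then have "form_eval (\<omega> c) (coord_frame(i := lie_bracket c (v c) (coord_frame i))) p =
        \<omega> c p * lie_bracket c (v c) (coord_frame i) p $ i"
      by (simp add: form_eval_def det_identity_row)
    also have "lie_bracket c (v c) (coord_frame i) p $ i = - cpd c i (\<lambda>q. v c q $ i) p"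
      by (simp add: lie_bracket_def dir_deriv_def coord_frame_def cpd_const axis_def if_distrib[of "\<lambda>z. z * _"] cong: if_cong)
    finally show ?thesis by (simp only: mult_minus_right)
  qed
  show ?thesis
    unfolding lie_form_def id bracket
    by (simp add: dir_deriv_def div_chart_def sum_negf sum_distrib_left)
qed

text \<open>The divergence with respect to \<open>dx\<close> is not invariant under a change of coordinates: by Jacobi's
  formula and the symmetry of second derivatives, the defect is the logarithmic derivative of the
  Jacobian determinant along \<open>v\<close>. This term is compensated in \<open>lie_form_change\<close> by the transformation
  law of the density.\<close>

lemma div_chart_change:
  assumes v: "vector_field A v" and c: "c \<in> A" "c' \<in> A" "p \<in> fst c" "p \<in> fst c'"
  shows "(\<Sum>i\<in>UNIV. v c p $ i * complex_of_real (cpd c i (\<lambda>q. det (jac c c' q)) p))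
      + complex_of_real (det (jac c c' p)) * div_chart v c p
    = complex_of_real (det (jac c c' p)) * div_chart v c' p"
proof -
  define W where "W = fst c \<inter> fst c'"
  have W: "open W" "p \<in> W" "W \<subseteq> fst c" "W \<subseteq> fst c'" using open_dom[OF c(1)] open_dom[OF c(2)] c by (auto simp: W_def)
  have sv: "smooth_fun_on A W (\<lambda>q. v b q $ i)" if b: "b \<in> {c, c'}" for b i
  proof -
    have "smooth_fun_on A (fst b) (v b)" using v b c unfolding vector_field_def by blast
    then have "smooth_fun_on A W (v b)" by (rule smooth_fun_on_subset) (use W b in auto)
    then show ?thesis by (rule smooth_fun_on_component[OF W(1)])
  qed
  have sj: "smooth_fun_on A W (\<lambda>q. complex_of_real (jac c c' q $ a $ i))" for a i
    unfolding W_def by (rule smooth_fun_on_of_real[OF W(1)[unfolded W_def] smooth_jac[OF c(1,2)]])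
  let ?M = "\<lambda>a i. complex_of_real (jac c c' p $ a $ i)" and ?K = "\<lambda>k a. complex_of_real (jac c' c p $ k $ a)"
  let ?dM = "\<lambda>k a i. complex_of_real (cpd c k (\<lambda>q. jac c c' q $ a $ i) p)"
  \<comment> \<open>product rule for the transformation law of v\<close>
  have d1: "cpd c k (\<lambda>q. v c' q $ a) p = (\<Sum>i\<in>UNIV. ?dM k a i * v c p $ i + ?M a i * cpd c k (\<lambda>q. v c q $ i) p)" for k a
  proof -
    have "cpd c k (\<lambda>q. v c' q $ a) p = cpd c k (\<lambda>q. \<Sum>i\<in>UNIV. complex_of_real (jac c c' q $ a $ i) * v c q $ i) p"
    proof (rule chart_pds_cong[OF c(1,3)])
      show "\<forall>\<^sub>F q in nhds p. v c' q $ a = (\<Sum>i\<in>UNIV. complex_of_real (jac c c' q $ a $ i) * v c q $ i)"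
        using eventually_nhds_in_open[OF W(1,2)]
        by eventually_elim (rule vector_field_change[OF v c(1,2)], use W in auto)
    qed
    also have "\<dots> = (\<Sum>i\<in>UNIV. cpd c k (\<lambda>q. complex_of_real (jac c c' q $ a $ i) * v c q $ i) p)"
      by (rule cpd_sum[OF c(1,3) W(1,2)]) (intro smooth_fun_on_mult[OF W(1)] sj sv, simp)
    also have "\<dots> = (\<Sum>i\<in>UNIV. cpd c k (\<lambda>q. complex_of_real (jac c c' q $ a $ i)) p * v c p $ i
        + ?M a i * cpd c k (\<lambda>q. v c q $ i) p)"
      by (intro sum.cong refl cpd_mult[OF c(1,3) W(2)] sj sv) simp
    finally show ?thesis
      using W by (simp add: cpd_of_real[OF smooth_jac[OF c(1,2)] c(1,3)] W_def)
  qed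
  have KM: "(\<Sum>a\<in>UNIV. ?K k a * ?M a i) = (if k = i then 1 else 0)" for k i
  proof -
    have "(\<Sum>a\<in>UNIV. jac c' c p $ k $ a * jac c c' p $ a $ i) = (if k = i then 1 else 0)"
      using arg_cong[OF jac_inverse[OF c], of "\<lambda>M. M $ k $ i"] by (simp add: matrix_matrix_mult_def mat_def)
    from arg_cong[OF this, of complex_of_real] show ?thesis by simp
  qed
  have "div_chart v c' p = (\<Sum>a\<in>UNIV. \<Sum>k\<in>UNIV. ?K k a * cpd c k (\<lambda>q. v c' q $ a) p)"
    unfolding div_chart_def
    by (intro sum.cong refl cpd_change_complex[OF c(2,1,4,3) W(1,2)] sv) simp
  also have "\<dots> = (\<Sum>a\<in>UNIV. \<Sum>k\<in>UNIV. \<Sum>i\<in>UNIV. v c p $ i * (?K k a * ?dM i a k))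
      + (\<Sum>a\<in>UNIV. \<Sum>k\<in>UNIV. \<Sum>i\<in>UNIV. ?K k a * ?M a i * cpd c k (\<lambda>q. v c q $ i) p)"
    unfolding d1 sum.distrib[symmetric] sum_distrib_left
    by (intro sum.cong refl) (simp add: jac_symmetric[OF c, of _ _ i for i] algebra_simps)
  also have "(\<Sum>a\<in>UNIV. \<Sum>k\<in>UNIV. \<Sum>i\<in>UNIV. ?K k a * ?M a i * cpd c k (\<lambda>q. v c q $ i) p) =
      (\<Sum>k\<in>UNIV. \<Sum>i\<in>UNIV. (\<Sum>a\<in>UNIV. ?K k a * ?M a i) * cpd c k (\<lambda>q. v c q $ i) p)"
    unfolding sum_distrib_right by (rule sum_rotate)
  also have "\<dots> = div_chart v c p"
    unfolding KM div_chart_def by (simp add: if_distrib[of "\<lambda>z. z * _"] cong: if_cong)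
  also have "(\<Sum>a\<in>UNIV. \<Sum>k\<in>UNIV. \<Sum>i\<in>UNIV. v c p $ i * (?K k a * ?dM i a k)) =
      (\<Sum>i\<in>UNIV. v c p $ i * (\<Sum>k\<in>UNIV. \<Sum>a\<in>UNIV. ?K k a * ?dM i a k))"
    unfolding sum_distrib_left by (rule sum_reverse)
  finally have eq: "div_chart v c' p = (\<Sum>i\<in>UNIV. v c p $ i * (\<Sum>k\<in>UNIV. \<Sum>a\<in>UNIV. ?K k a * ?dM i a k)) + div_chart v c p" .
  have "complex_of_real (cpd c i (\<lambda>q. det (jac c c' q)) p) =
      complex_of_real (det (jac c c' p)) * (\<Sum>k\<in>UNIV. \<Sum>a\<in>UNIV. ?K k a * ?dM i a k)" for i
    unfolding cpd_det_jac[OF c] by simp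
  then show ?thesis
    unfolding eq by (simp add: distrib_left sum_distrib_left mult_ac)
qed

lemma lie_form_change:
  assumes v: "vector_field A v" and \<omega>: "top_form A \<omega>" and c: "c \<in> A" "c' \<in> A" "p \<in> fst c" "p \<in> fst c'"
  shows "lie_form v \<omega> c p = complex_of_real (det (jac c c' p)) * lie_form v \<omega> c' p"
proof -
  define W where "W = fst c \<inter> fst c'"
  have W: "open W" "p \<in> W" "W \<subseteq> fst c" "W \<subseteq> fst c'" using open_dom[OF c(1)] open_dom[OF c(2)] c by (auto simp: W_def)
  let ?J = "\<lambda>q. complex_of_real (det (jac c c' q))"
  have sJ: "smooth_fun_on A W ?J"
    unfolding W_def by (rule smooth_fun_on_of_real[OF W(1)[unfolded W_def] smooth_det_jac[OF c(1,2)]])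
  have "smooth_fun_on A (fst c') (\<omega> c')" using \<omega> c unfolding top_form_def by blast
  then have s\<omega>: "smooth_fun_on A W (\<omega> c')" by (rule smooth_fun_on_subset) (rule W(4))
  have \<omega>c: "\<omega> c q = ?J q * \<omega> c' q" if "q \<in> W" for q
    using \<omega> c that unfolding top_form_def W_def by blast
  have "cpd c i (\<omega> c) p = complex_of_real (cpd c i (\<lambda>q. det (jac c c' q)) p) * \<omega> c' p + ?J p * cpd c i (\<omega> c') p" for i
  proof -
    have "cpd c i (\<omega> c) p = cpd c i (\<lambda>q. ?J q * \<omega> c' q) p"
      by (rule chart_pds_cong[OF c(1,3)])
        (use eventually_nhds_in_open[OF W(1,2)] in eventually_elim, use \<omega>c in simp)
    then show ?thesis
      using cpd_mult[OF c(1,3) W(2) sJ s\<omega>] W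
      by (simp add: cpd_of_real[OF smooth_det_jac[OF c(1,2)] c(1,3)] W_def)
  qed
  then have "lie_form v \<omega> c p =
      \<omega> c' p * ((\<Sum>i\<in>UNIV. v c p $ i * complex_of_real (cpd c i (\<lambda>q. det (jac c c' q)) p)) + ?J p * div_chart v c p)
      + ?J p * (\<Sum>i\<in>UNIV. v c p $ i * cpd c i (\<omega> c') p)"
    unfolding lie_form_eq \<omega>c[OF W(2)] by (simp add: algebra_simps sum.distrib sum_distrib_left)
  also have "(\<Sum>i\<in>UNIV. v c p $ i * cpd c i (\<omega> c') p) = (\<Sum>i\<in>UNIV. v c' p $ i * cpd c' i (\<omega> c') p)"
    using dir_deriv_change[OF v c W(1,2) s\<omega>] by (simp add: dir_deriv_def)
  finally show ?thesis
    unfolding div_chart_change[OF v c] lie_form_eq by (simp add: algebra_simps)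
qed

text \<open>Numerator and denominator transform with the same Jacobian determinant, so the chart chosen by
  \<open>chart_at\<close> may be replaced by any other one.\<close>

lemma divergence_eq:
  assumes v: "vector_field A v" and \<rho>: "\<And>r. top_form A (fps_nth \<rho> r)" and c: "c \<in> A" "p \<in> fst c"
  shows "fps_nth (divergence A \<rho> v) r p =
    fps_nth (form_at (Abs_fps (\<lambda>s. lie_form v (fps_nth \<rho> s))) c p / form_at \<rho> c p) r"
proof -
  let ?c = "chart_at A p"
  let ?J = "fps_const (complex_of_real (det (jac ?c c p)))"
  note cc = chart_at_props(1)[of p] c(1) chart_at_props(2)[of p] c(2)
  have "det (jac ?c c p) > 0" using det_jac_pos[OF cc(1,2)] cc(3,4) by blast
  then have J0: "?J \<noteq> 0" by simp
  let ?F = "form_at (Abs_fps (\<lambda>s. lie_form v (fps_nth \<rho> s)))"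
  have "?F ?c p = ?J * ?F c p"
    by (rule fps_ext) (simp add: form_at_def lie_form_change[OF v \<rho> cc])
  moreover have "form_at \<rho> ?c p = ?J * form_at \<rho> c p"
  proof (rule fps_ext)
    fix r
    have "fps_nth \<rho> r ?c p = complex_of_real (det (jac ?c c p)) * fps_nth \<rho> r c p"
      using \<rho>[of r] cc unfolding top_form_def by blast
    then show "fps_nth (form_at \<rho> ?c p) r = fps_nth (?J * form_at \<rho> c p) r"
      by (simp add: form_at_def)
  qed
  ultimately have "?F ?c p / form_at \<rho> ?c p = ?F c p / form_at \<rho> c p"
    by (simp only: div_mult_mult1[OF J0])
  then show ?thesis by (simp only: divergence_def fps_nth_Abs_fps)
qed

end

unbundle Formal_Power_Series.fps_syntax
unbundle no vec_syntax

section \<open>Pointwise formal power series\<close>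

definition fps_at :: "('m \<Rightarrow> 'a) fps \<Rightarrow> 'm \<Rightarrow> 'a fps" where
  "fps_at F p = Abs_fps (\<lambda>k. (F $ k) p)"

lemma fps_at_nth [simp]: "fps_at F p $ k = (F $ k) p"
  by (simp add: fps_at_def)

lemma fps_at_mult: "fps_at (F * G) p = fps_at F p * fps_at G p"
  for F G :: "('m \<Rightarrow> complex) fps"
  by (rule fps_ext) (simp add: fps_mult_nth sum_fun_apply)

lemma fps_at_deriv: "fps_at (fps_deriv F) p = fps_deriv (fps_at F p)"
  for F :: "('m \<Rightarrow> complex) fps"
  by (rule fps_ext) simp

subsection \<open>The formal exponential\<close>

lemma formal_exp_nth_0: "formal_exp a $ 0 = exp (a $ 0)"
  by (simp add: formal_exp_def)

lemma formal_exp_deriv: "fps_deriv (formal_exp a) = formal_exp a * fps_deriv a"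
proof -
  have "fps_deriv (fps_exp 1 oo (a - fps_const (a $ 0))) =
      ((fps_deriv (fps_exp 1)) oo (a - fps_const (a $ 0))) * fps_deriv (a - fps_const (a $ 0))"
    by (rule fps_compose_deriv) simp
  then show ?thesis by (simp add: formal_exp_def mult.assoc)
qed

text \<open>The equation determines the coefficient of order \<open>k + 1\<close> by those of order at most \<open>k\<close>. It identifies
  formal exponentials, and later the coordinate derivatives of an exponential.\<close>

lemma fps_linear_ode_unique:
  fixes Y :: "complex fps"
  assumes "fps_deriv Y = Y * t" "Y $ 0 = 0"
  shows "Y = 0"
proof -
  have "\<forall>j\<le>k. Y $ j = 0" for k
  proof (induction k)
    case (Suc k)
    have "of_nat (Suc k) * Y $ Suc k = (Y * t) $ k" using assms(1) by (metis fps_deriv_nth Suc_eq_plus1)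
    also have "\<dots> = 0" using Suc by (simp add: fps_mult_nth)
    finally have "Y $ Suc k = 0" by (simp del: of_nat_Suc)
    then show ?case using Suc by (metis le_Suc_eq)
  qed (use assms in simp)
  then show ?thesis by (intro fps_ext) auto
qed

lemma formal_exp_unique:
  fixes Y :: "complex fps"
  assumes "fps_deriv Y = Y * fps_deriv a" "Y $ 0 = exp (a $ 0)"
  shows "Y = formal_exp a"
proof -
  have "Y - formal_exp a = 0"
    by (rule fps_linear_ode_unique[of _ "fps_deriv a"])
      (simp_all add: assms formal_exp_deriv formal_exp_nth_0 left_diff_distrib)
  then show ?thesis by simp
qed

context manifold
begin

text \<open>The power series quotient is taken pointwise; its coefficients are smooth by recursion, since the
  recursion divides by the leading coefficient of \<open>G\<close> only.\<close>

lemma smooth_fps_quotient: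
  fixes N G Q :: "('m \<Rightarrow> complex) fps"
  assumes W: "open W" and N: "\<And>k. smooth_fun_on A W (N $ k)" and G: "\<And>k. smooth_fun_on A W (G $ k)"
    and nz: "\<And>p. p \<in> W \<Longrightarrow> (G $ 0) p \<noteq> 0"
    and Q: "\<And>p. p \<in> W \<Longrightarrow> fps_at Q p * fps_at G p = fps_at N p"
  shows "smooth_fun_on A W (Q $ k)"
proof (induction k rule: less_induct)
  case (less k)
  have "(Q $ k) p = ((N $ k) p + - 1 * (\<Sum>j<k. (Q $ j) p * (G $ (k - j)) p)) * inverse ((G $ 0) p)"
    if "p \<in> W" for p
  proof -
    have "(N $ k) p = (\<Sum>j\<le>k. (Q $ j) p * (G $ (k - j)) p)"
      using arg_cong[OF Q[OF that], of "\<lambda>F. F $ k"] by (simp add: fps_mult_nth atMost_atLeast0)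
    also have "\<dots> = (\<Sum>j<k. (Q $ j) p * (G $ (k - j)) p) + (Q $ k) p * (G $ 0) p"
      by (simp add: lessThan_Suc_atMost[symmetric])
    finally show ?thesis using nz[OF that] by (simp add: field_simps)
  qed
  moreover have "smooth_fun_on A W (\<lambda>p. ((N $ k) p + - 1 * (\<Sum>j<k. (Q $ j) p * (G $ (k - j)) p)) * inverse ((G $ 0) p))"
    by (intro smooth_fun_on_mult[OF W] smooth_fun_on_add[OF W] smooth_fun_on_sum[OF W]
        smooth_fun_on_inverse[OF W] smooth_fun_on_const N G nz less) auto
  ultimately show ?case by (subst smooth_fun_on_cong[OF W]) auto
qed

text \<open>The differential equation of the exponential expresses its coefficients recursively as
  polynomials in the coefficients of \<open>a\<close> and the classical exponential of the first one.\<close>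

lemma smooth_formal_exp:
  fixes a E :: "('m \<Rightarrow> complex) fps"
  assumes W: "open W" and a: "\<And>k. smooth_fun_on A W (a $ k)"
    and E: "\<And>p. p \<in> W \<Longrightarrow> fps_at E p = formal_exp (fps_at a p)"
  shows "smooth_fun_on A W (E $ k)"
proof (induction k rule: less_induct)
  case (less k)
  show ?case
  proof (cases k)
    case 0
    have "(E $ 0) p = exp ((a $ 0) p)" if "p \<in> W" for p
      using arg_cong[OF E[OF that], of "\<lambda>F. F $ 0"] by (simp add: formal_exp_nth_0)
    then show ?thesis
      unfolding 0 by (subst smooth_fun_on_cong[OF W]) (auto intro: smooth_fun_on_exp[OF W a])
  next
    case (Suc l)
    have "(E $ Suc l) p = inverse (of_nat (Suc l)) * (\<Sum>j\<le>l. (E $ j) p * (of_nat (Suc (l - j)) * (a $ Suc (l - j)) p))"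
      if "p \<in> W" for p
    proof -
      have "fps_deriv (fps_at E p) $ l = (fps_at E p * fps_deriv (fps_at a p)) $ l"
        using E[OF that] by (simp only: formal_exp_deriv)
      then have "of_nat (Suc l) * (E $ Suc l) p = (\<Sum>j\<le>l. (E $ j) p * (of_nat (Suc (l - j)) * (a $ Suc (l - j)) p))"
        by (simp add: fps_mult_nth atMost_atLeast0)
      then show ?thesis by (simp add: field_simps del: of_nat_Suc)
    qed
    moreover have "smooth_fun_on A W (\<lambda>p. inverse (of_nat (Suc l)) *
        (\<Sum>j\<le>l. (E $ j) p * (of_nat (Suc (l - j)) * (a $ Suc (l - j)) p)))"
      by (intro smooth_fun_on_mult[OF W] smooth_fun_on_sum[OF W] smooth_fun_on_const a less) (use Suc in auto)
    ultimately show ?thesis unfolding Suc by (subst smooth_fun_on_cong[OF W]) auto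
  qed
qed

text \<open>Near \<open>x\<close> the quotient of the leading coefficient \<open>G\<^sub>0\<close> by its value at \<open>x\<close> has positive real part, so that the
  principal branch of the logarithm is smooth there; the higher coefficients are obtained by
  integrating \<open>(dG/d\<nu>)/G\<close> in \<open>\<nu>\<close>.\<close>

lemma formal_log_exists:
  fixes G :: "('m \<Rightarrow> complex) fps"
  assumes V: "open V" "x \<in> V" and G: "\<And>k. smooth_fun_on A V (G $ k)" and nz: "(G $ 0) x \<noteq> 0"
  obtains W u where "open W" "x \<in> W" "W \<subseteq> V" "\<And>p. p \<in> W \<Longrightarrow> (G $ 0) p \<noteq> 0"
    "\<And>k. smooth_fun_on A W (u $ k)" "\<And>p. p \<in> W \<Longrightarrow> fps_at G p = formal_exp (fps_at u p)"
proof -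
  define a where "a = (G $ 0) x"
  define g where "g p = (G $ 0) p * inverse a" for p
  obtain c where c: "c \<in> A" "x \<in> fst c" using chart_ex by blast
  have "isCont ((G $ 0) \<circ> chart_inv c) (snd c x)"
    by (rule differentiable_imp_continuous_within, rule differentiable_in_chart[OF G c V(2)])
  moreover have "isCont (snd c) x"
  proof -
    have "continuous_on (fst c) (snd c)" using chart_homeo[OF c(1)] by (simp add: homeomorphism_def)
    then show ?thesis using open_dom[OF c(1)] c(2) by (simp add: continuous_on_eq_continuous_at)
  qed
  ultimately have "isCont (((G $ 0) \<circ> chart_inv c) \<circ> snd c) x"
    by (rule continuous_at_compose[rotated])
  then have "((((G $ 0) \<circ> chart_inv c) \<circ> snd c) \<longlongrightarrow> (((G $ 0) \<circ> chart_inv c) \<circ> snd c) x) (nhds x)"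
    by (simp only: isCont_def tendsto_at_iff_tendsto_nhds)
  moreover have "(((G $ 0) \<circ> chart_inv c) \<circ> snd c) x = a" using c by (simp add: a_def)
  ultimately have "((((G $ 0) \<circ> chart_inv c) \<circ> snd c) \<longlongrightarrow> a) (nhds x)" by simp
  then have "((\<lambda>p. Re ((((G $ 0) \<circ> chart_inv c) \<circ> snd c) p * inverse a)) \<longlongrightarrow> Re (a * inverse a)) (nhds x)"
    by (intro tendsto_intros)
  then have "\<forall>\<^sub>F p in nhds x. Re ((((G $ 0) \<circ> chart_inv c) \<circ> snd c) p * inverse a) > 0"
    by (rule order_tendstoD) (use nz in \<open>simp add: a_def\<close>)
  then have "\<forall>\<^sub>F p in nhds x. Re (g p) > 0 \<and> p \<in> V"
    using eventually_nhds_in_open[OF V] eventually_nhds_in_open[OF open_dom[OF c(1)] c(2)]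
    by eventually_elim (use c in \<open>simp add: g_def\<close>)
  then obtain W where W: "open W" "x \<in> W" "\<And>p. p \<in> W \<Longrightarrow> Re (g p) > 0 \<and> p \<in> V"
    unfolding eventually_nhds by blast
  have WV: "W \<subseteq> V" using W(3) by blast
  have GW: "smooth_fun_on A W (G $ k)" for k using smooth_fun_on_subset[OF G WV] .
  have nzW: "(G $ 0) p \<noteq> 0" if "p \<in> W" for p
    using W(3)[OF that] by (auto simp: g_def)
  define Q where "Q = Abs_fps (\<lambda>k p. (fps_deriv (fps_at G p) * inverse (fps_at G p)) $ k)"
  have Q: "fps_at Q p * fps_at G p = fps_at (fps_deriv G) p" if "p \<in> W" for p
  proof -
    have "fps_at Q p = fps_deriv (fps_at G p) * inverse (fps_at G p)"
      by (rule fps_ext) (simp add: Q_def)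
    moreover have "inverse (fps_at G p) * fps_at G p = 1"
      using nzW[OF that] by (intro inverse_mult_eq_1) simp
    ultimately show ?thesis by (simp add: fps_at_deriv mult.assoc)
  qed
  have QW: "smooth_fun_on A W (Q $ k)" for k
  proof (rule smooth_fps_quotient[OF W(1) _ GW nzW Q])
    show "smooth_fun_on A W (fps_deriv G $ k)" for k
    proof -
      have "fps_deriv G $ k = (\<lambda>p. of_nat (Suc k) * (G $ Suc k) p)"
        by (simp add: fun_eq_iff)
      then show ?thesis using smooth_fun_on_mult[OF W(1) smooth_fun_on_const GW] by simp
    qed
  qed
  define u where "u = Abs_fps (\<lambda>k. case k of 0 \<Rightarrow> (\<lambda>p. Ln (g p) + Ln a) | Suc l \<Rightarrow> (\<lambda>p. inverse (of_nat (Suc l)) * (Q $ l) p))"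
  have "smooth_fun_on A W (u $ k)" for k
  proof (cases k)
    case 0
    have sg: "smooth_fun_on A W g"
      using smooth_fun_on_mult[OF W(1) GW smooth_fun_on_const] by (simp add: g_def[abs_def])
    have "g p \<notin> \<real>\<^sub>\<le>\<^sub>0" if "p \<in> W" for p
      using W(3)[OF that] by (auto simp: complex_nonpos_Reals_iff)
    then show ?thesis
      using smooth_fun_on_add[OF W(1) smooth_fun_on_Ln[OF W(1) sg] smooth_fun_on_const] by (simp add: 0 u_def)
  next
    case (Suc l)
    then show ?thesis
      using smooth_fun_on_mult[OF W(1) smooth_fun_on_const QW] by (simp add: u_def)
  qed
  moreover have "fps_at G p = formal_exp (fps_at u p)" if p: "p \<in> W" for p
  proof (rule formal_exp_unique)
    have "fps_deriv (fps_at u p) = fps_at Q p"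
      by (rule fps_ext) (simp add: u_def del: of_nat_Suc)
    then show "fps_deriv (fps_at G p) = fps_at G p * fps_deriv (fps_at u p)"
      using Q[OF p] by (simp add: fps_at_deriv mult.commute)
    have "g p \<noteq> 0" "a \<noteq> 0" using W(3)[OF p] nz by (auto simp: a_def)
    then show "fps_at G p $ 0 = exp (fps_at u p $ 0)"
      by (simp add: u_def exp_add g_def)
  qed
  ultimately show ?thesis using that[OF W(1,2) WV nzW] by blast
qed

end

section \<open>The ring of germs in a chart\<close>

context manifold
begin

lemma smooth_nearI: "open W \<Longrightarrow> x \<in> W \<Longrightarrow> smooth_fun_on A W f \<Longrightarrow> smooth_near A x f"
  unfolding smooth_near_def by blast

lemma smooth_near_cong:
  assumes "smooth_near A x f" "\<forall>\<^sub>F p in nhds x. f p = g p"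
  shows "smooth_near A x g"
proof -
  obtain W where W: "open W" "x \<in> W" "smooth_fun_on A W f" using assms(1) unfolding smooth_near_def by blast
  obtain V where V: "open V" "x \<in> V" "\<And>p. p \<in> V \<Longrightarrow> f p = g p" using assms(2) unfolding eventually_nhds by blast
  have o: "open (V \<inter> W)" using V W by blast
  have "smooth_fun_on A (V \<inter> W) f" using W(3) by (rule smooth_fun_on_subset) blast
  then have "smooth_fun_on A (V \<inter> W) g" by (subst smooth_fun_on_cong[OF o, of g f]) (use V in auto)
  then show ?thesis using smooth_nearI[OF o] V W by blast
qed

lemma point_distribution_germ:
  assumes L: "point_distribution A x L" and ev: "\<forall>\<^sub>F p in nhds x. f p = g p"
  shows "L f = L g"
proof -
  obtain c I a where c: "c \<in> A" "x \<in> fst c"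
    and L: "\<And>f. L f = (if smooth_near A x f then \<Sum>is\<in>I. a is * chart_pds c is f x else 0)"
    using L unfolding point_distribution_def by blast
  have "smooth_near A x f \<longleftrightarrow> smooth_near A x g"
    using smooth_near_cong[OF _ ev] smooth_near_cong[of x g f] ev by (auto simp: eq_commute)
  moreover have "chart_pds c is f x = chart_pds c is g x" for "is"
    by (rule chart_pds_cong[OF c ev])
  ultimately show ?thesis by (simp add: L)
qed

end

locale pointed_chart = manifold A
  for A :: "('m::{t2_space, second_countable_topology}, 'n::finite) chart set" +
  fixes c :: "('m, 'n) chart" and W :: "'m set" and x\<^sub>0 :: 'm
  assumes c_in: "c \<in> A" and W_open: "open W" and W_dom: "W \<subseteq> fst c" and x0_in: "x\<^sub>0 \<in> W"
begin

definition cut :: "('m \<Rightarrow> complex) \<Rightarrow> 'm \<Rightarrow> complex" where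
  "cut f p = (if p \<in> W then f p else 0)"

definition R :: "('m \<Rightarrow> complex) set" where
  "R = {f. smooth_fun_on A W f \<and> (\<forall>p. p \<notin> W \<longrightarrow> f p = 0)}"

definition D :: "'n \<Rightarrow> ('m \<Rightarrow> complex) \<Rightarrow> 'm \<Rightarrow> complex" where
  "D i f = cut (cpd c i f)"

definition X :: "'n \<Rightarrow> 'm \<Rightarrow> complex" where
  "X i = cut (\<lambda>p. complex_of_real (vec_nth (snd c p) i - vec_nth (snd c x\<^sub>0) i))"

definition e :: "'m \<Rightarrow> complex" where
  "e = cut (\<lambda>_. 1)"

lemma x0_dom: "x\<^sub>0 \<in> fst c"
  using W_dom x0_in by blast

lemma cut_on [simp]: "p \<in> W \<Longrightarrow> cut f p = f p"
  by (simp add: cut_def)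

lemma cut_germ: "\<forall>\<^sub>F p in nhds x\<^sub>0. cut f p = f p"
  using eventually_nhds_in_open[OF W_open x0_in] by eventually_elim simp

lemma cut_in: "smooth_fun_on A W f \<Longrightarrow> cut f \<in> R"
  unfolding R_def using smooth_fun_on_cong[OF W_open, of "cut f" f] by (simp add: cut_def)

lemma cut_id: "f \<in> R \<Longrightarrow> cut f = f"
  by (auto simp: R_def cut_def fun_eq_iff)

lemma R_smooth: "f \<in> R \<Longrightarrow> smooth_fun_on A W f"
  by (simp add: R_def)

lemma R_near: "f \<in> R \<Longrightarrow> smooth_near A x\<^sub>0 f"
  using smooth_nearI[OF W_open x0_in] R_smooth by blast

lemma cut_eqI: "(\<And>p. p \<in> W \<Longrightarrow> f p = g p) \<Longrightarrow> cut f = cut g"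
  by (auto simp: cut_def fun_eq_iff)

lemma R_eqI: "f \<in> R \<Longrightarrow> g \<in> R \<Longrightarrow> (\<And>p. p \<in> W \<Longrightarrow> f p = g p) \<Longrightarrow> f = g"
  using cut_eqI[of f g] by (simp add: cut_id)

lemma cpd_smooth: "smooth_fun_on A W f \<Longrightarrow> smooth_fun_on A W (cpd c i f)"
  by (rule smooth_fun_on_chart_pds[OF c_in W_open W_dom])

lemma cpd_cut:
  assumes p: "p \<in> W" and "\<And>q. q \<in> W \<Longrightarrow> f q = g q"
  shows "cpd c i f p = cpd c i g p"
  using W_dom p by (intro chart_pds_cong[OF c_in])
    (auto intro: eventually_mono[OF eventually_nhds_in_open[OF W_open p]] assms(2))

lemma W_chart: "p \<in> W \<Longrightarrow> p \<in> fst c"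
  using W_dom by blast

text \<open>The smooth functions on \<open>W\<close>, extended by zero, form a ring as required. Extension by zero makes equality
  in \<open>R\<close> the equality of functions on \<open>W\<close>.\<close>

sublocale germ_ring R D X e x\<^sub>0
proof
  show "e \<in> R" unfolding e_def by (rule cut_in[OF smooth_fun_on_const])
  show "e x\<^sub>0 = 1" by (simp add: e_def x0_in)
  show "X i x\<^sub>0 = 0" for i by (simp add: X_def x0_in)
  show "X i \<in> R" for i
    unfolding X_def by (rule cut_in[OF smooth_fun_on_subset[OF smooth_coordinate[OF c_in] W_dom]])
  fix f assume f: "f \<in> R"
  show "e * f = f" using f by (auto simp: e_def cut_def R_def fun_eq_iff)
  show "(\<lambda>_. a) * f \<in> R" for a
    using f smooth_fun_on_mult[OF W_open smooth_fun_on_const, of f a] by (simp add: R_def times_fun_def)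
  show Df: "D i f \<in> R" for i unfolding D_def by (rule cut_in[OF cpd_smooth[OF R_smooth[OF f]]])
  show "D i ((\<lambda>_. a) * f) = (\<lambda>_. a) * D i f" for a i
  proof
    fix p
    show "D i ((\<lambda>_. a) * f) p = ((\<lambda>_. a) * D i f) p"
      using cpd_mult[OF c_in W_chart _ smooth_fun_on_const R_smooth[OF f], of p i a]
      by (simp add: D_def cut_def times_fun_def cpd_const)
  qed
  show "D i (D j f) = D j (D i f)" for i j
  proof
    fix p
    have "cpd c i (cut (cpd c j f)) p = cpd c i (cpd c j f) p" if "p \<in> W" for i j
      using that by (rule cpd_cut) simp
    then show "D i (D j f) p = D j (D i f) p"
      using cpd_commute[OF c_in W_chart W_open _ R_smooth[OF f], of p i j] by (simp add: D_def cut_def)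
  qed
  fix g assume g: "g \<in> R"
  show "f + g \<in> R" using f g smooth_fun_on_add[OF W_open, of f g] by (simp add: R_def plus_fun_def)
  show "f * g \<in> R" using f g smooth_fun_on_mult[OF W_open, of f g] by (simp add: R_def times_fun_def)
  show "D i (f + g) = D i f + D i g" for i
  proof
    fix p
    show "D i (f + g) p = (D i f + D i g) p"
      using cpd_add[OF c_in W_chart _ R_smooth[OF f] R_smooth[OF g], of p i]
      by (simp add: D_def cut_def plus_fun_def)
  qed
  show "D i (f * g) = D i f * g + f * D i g" for i
  proof
    fix p
    show "D i (f * g) p = (D i f * g + f * D i g) p"
      using cpd_mult[OF c_in W_chart _ R_smooth[OF f] R_smooth[OF g], of p i]
      by (simp add: D_def cut_def times_fun_def plus_fun_def)
  qed
next
  show "D i (X j) = (if i = j then e else 0)" for i j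
  proof
    fix p
    have "cpd c i (X j) p = (if i = j then 1 else 0)" if "p \<in> W"
    proof -
      have "cpd c i (X j) p = cpd c i (\<lambda>p. complex_of_real (vec_nth (snd c p) j - vec_nth (snd c x\<^sub>0) j)) p"
        using that by (rule cpd_cut) (simp add: X_def)
      then show ?thesis using cpd_coordinate[OF c_in W_chart[OF that]] by simp
    qed
    then show "D i (X j) p = (if i = j then e else 0) p"
      by (cases "p \<in> W"; cases "i = j") (simp_all add: D_def e_def cut_def)
  qed
qed

lemma Ds_eq_chart_pds:
  assumes f: "f \<in> R"
  shows "p \<in> W \<Longrightarrow> Ds is f p = chart_pds c is f p"
proof (induction "is" arbitrary: p)
  case Nil
  have "chart_inv c (snd c p) = p" using Nil by (intro chart_inv_chart c_in W_chart)
  then show ?case by (simp add: chart_pds_def)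
next
  case (Cons i js)
  have "Ds (i # js) f p = cpd c i (Ds js f) p" using Cons.prems by (simp add: D_def)
  also have "\<dots> = cpd c i (chart_pds c js f) p" by (rule cpd_cut[OF Cons.prems Cons.IH])
  also have "\<dots> = chart_pds c (i # js) f p"
    by (rule chart_pds_Cons[OF c_in W_chart[OF Cons.prems], symmetric])
  finally show ?case .
qed

subsection \<open>Point distributions and point functionals\<close>

text \<open>Partial derivatives in an arbitrary chart are differential operators in the coordinates of \<open>c\<close>, with
  smooth coefficients; the coefficients need an extension to \<open>W\<close> because the other chart may not contain it.\<close>

lemma point_functional_chart_pds:
  assumes c': "c' \<in> A" "x\<^sub>0 \<in> fst c'"
  shows "point_functional (\<lambda>f. chart_pds c' is f x\<^sub>0)"
proof (induction "is" rule: rev_induct)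
  case Nil
  have "chart_pds c' [] f x\<^sub>0 = f x\<^sub>0" for f :: "'m \<Rightarrow> complex" using c' by (simp add: chart_pds_def)
  then show ?case using point_functional.eval by simp
next
  case (snoc i js)
  define V where "V = fst c \<inter> fst c'"
  have V: "open V" "x\<^sub>0 \<in> V" using open_dom[OF c_in] open_dom[OF c'(1)] x0_dom c' by (auto simp: V_def)
  have "\<forall>k. \<exists>t. t \<in> R \<and> (\<forall>\<^sub>F p in nhds x\<^sub>0. t p = complex_of_real (vec_nth (vec_nth (jac c' c p) k) i))"
  proof
    fix k
    have "smooth_fun_on A V (\<lambda>p. vec_nth (vec_nth (jac c' c p) k) i)"
      unfolding V_def using smooth_jac[OF c'(1) c_in] by (simp add: Int_commute)
    then have "smooth_near A x\<^sub>0 (\<lambda>p. complex_of_real (vec_nth (vec_nth (jac c' c p) k) i))"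
      by (intro smooth_nearI[OF V] smooth_fun_on_of_real V)
    then obtain g where g: "smooth_fun_on A UNIV g"
      "\<forall>\<^sub>F p in nhds x\<^sub>0. g p = complex_of_real (vec_nth (vec_nth (jac c' c p) k) i)"
      by (rule germ_extension)
    have "cut g \<in> R" by (rule cut_in[OF smooth_fun_on_subset[OF g(1)]]) simp
    moreover have "\<forall>\<^sub>F p in nhds x\<^sub>0. cut g p = complex_of_real (vec_nth (vec_nth (jac c' c p) k) i)"
      using g(2) cut_germ[of g] by eventually_elim simp
    ultimately show "\<exists>t. t \<in> R \<and> (\<forall>\<^sub>F p in nhds x\<^sub>0. t p = complex_of_real (vec_nth (vec_nth (jac c' c p) k) i))"
      by (intro exI[of _ "cut g"] conjI)
  qed
  from choice[OF this] obtain t where t': "\<forall>k. t k \<in> R \<and>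
      (\<forall>\<^sub>F p in nhds x\<^sub>0. t k p = complex_of_real (vec_nth (vec_nth (jac c' c p) k) i))"
    by (rule exE)
  have t: "t k \<in> R" "\<forall>\<^sub>F p in nhds x\<^sub>0. t k p = complex_of_real (vec_nth (vec_nth (jac c' c p) k) i)" for k
    using t'[rule_format, of k] by simp_all
  have "point_functional (\<lambda>f. \<Sum>k\<in>UNIV. chart_pds c' js (t k * D k f) x\<^sub>0)"
  proof (rule point_functional_sum)
    fix k
    from point_functional.derivative[OF point_functional_mult[OF snoc t(1)[of k]]]
    show "point_functional (\<lambda>f. chart_pds c' js (t k * D k f) x\<^sub>0)" .
  qed
  then show ?case
  proof (rule point_functional.agree)
    fix f assume f: "f \<in> R"
    have "\<forall>\<^sub>F p in nhds x\<^sub>0. \<forall>k\<in>UNIV. t k p = complex_of_real (vec_nth (vec_nth (jac c' c p) k) i)"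
      using t(2) by (intro eventually_ball_finite) auto
    then have ev: "\<forall>\<^sub>F p in nhds x\<^sub>0. cpd c' i f p = (\<Sum>k\<in>UNIV. t k * D k f) p"
      using eventually_nhds_in_open[OF V] eventually_nhds_in_open[OF W_open x0_in]
    proof eventually_elim
      case (elim p)
      have "cpd c' i f p = (\<Sum>k\<in>UNIV. complex_of_real (vec_nth (vec_nth (jac c' c p) k) i) * cpd c k f p)"
        using elim(2) by (intro cpd_change_complex[OF c'(1) c_in _ _ W_open elim(3) R_smooth[OF f]])
          (auto simp: V_def)
      then show ?case using elim by (simp add: sum_fun_apply D_def)
    qed
    have "chart_pds c' (js @ [i]) f x\<^sub>0 = chart_pds c' js (cpd c' i f) x\<^sub>0"
      by (rule chart_pds_append[OF c'])
    also have "\<dots> = chart_pds c' js (\<Sum>k\<in>UNIV. t k * D k f) x\<^sub>0"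
      by (rule chart_pds_cong[OF c' ev])
    also have "\<dots> = (\<Sum>k\<in>UNIV. chart_pds c' js (t k * D k f) x\<^sub>0)"
      by (rule point_functional_sum_arg[OF snoc]) (use t f in auto)
    finally show "chart_pds c' (js @ [i]) f x\<^sub>0 = (\<Sum>k\<in>UNIV. chart_pds c' js (t k * D k f) x\<^sub>0)" .
  qed
qed

lemma point_distribution_functional:
  assumes "point_distribution A x\<^sub>0 L"
  shows "point_functional L"
proof -
  obtain c' I a where c': "c' \<in> A" "x\<^sub>0 \<in> fst c'"
    and L: "\<And>f. L f = (if smooth_near A x\<^sub>0 f then \<Sum>is\<in>I. a is * chart_pds c' is f x\<^sub>0 else 0)"
    using assms unfolding point_distribution_def by blast
  have "point_functional (\<lambda>f. \<Sum>is\<in>I. a is * chart_pds c' is f x\<^sub>0)"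
    by (intro point_functional_sum point_functional.scale point_functional_chart_pds c')
  then show ?thesis by (rule point_functional.agree) (simp add: L R_near)
qed

lemma point_functional_realize:
  assumes "point_functional L"
  obtains L' where "point_distribution A x\<^sub>0 L'" "\<And>f. f \<in> R \<Longrightarrow> L' f = L f"
proof -
  obtain I a where I: "finite I" "\<And>f. f \<in> R \<Longrightarrow> L f = (\<Sum>is\<in>I. a is * Ds is f x\<^sub>0)"
    using point_functional_representation[OF assms] by blast
  define L' where "L' f = (if smooth_near A x\<^sub>0 f then \<Sum>is\<in>I. a is * chart_pds c is f x\<^sub>0 else 0)" for f
  have "point_distribution A x\<^sub>0 L'"
    unfolding point_distribution_def L'_def
    by (intro bexI[of _ c] conjI exI[of _ I] exI[of _ a]) (simp_all add: c_in x0_dom I(1))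
  moreover have "L' f = L f" if "f \<in> R" for f
    using that by (simp add: L'_def R_near I(2) Ds_eq_chart_pds x0_in)
  ultimately show ?thesis by (rule that)
qed

text \<open>Every germ at \<open>x\<^sub>0\<close> has a representative in \<open>R\<close>, and both distributions are zero on functions that are
  not smooth near \<open>x\<^sub>0\<close>.\<close>

lemma point_distribution_eqI:
  assumes L: "point_distribution A x\<^sub>0 L" "point_distribution A x\<^sub>0 K" and eq: "\<And>f. f \<in> R \<Longrightarrow> L f = K f"
  shows "L = K"
proof
  fix f
  show "L f = K f"
  proof (cases "smooth_near A x\<^sub>0 f")
    case True
    obtain g where g: "smooth_fun_on A UNIV g" "\<forall>\<^sub>F p in nhds x\<^sub>0. g p = f p"
      by (rule germ_extension[OF True])
    have ev: "\<forall>\<^sub>F p in nhds x\<^sub>0. f p = cut g p" using g(2) cut_germ[of g] by eventually_elim simp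
    have "cut g \<in> R" by (rule cut_in[OF smooth_fun_on_subset[OF g(1)]]) simp
    then show ?thesis
      by (simp only: point_distribution_germ[OF L(1) ev] point_distribution_germ[OF L(2) ev] eq)
  next
    case False
    have z: "L' f = 0" if L': "point_distribution A x\<^sub>0 L'" for L'
    proof -
      obtain c' :: "('m, 'n) chart" and I a where "\<And>f. L' f = (if smooth_near A x\<^sub>0 f then \<Sum>is\<in>I. a is * chart_pds c' is f x\<^sub>0 else 0)"
        using L' unfolding point_distribution_def by blast
      then show ?thesis using False by simp
    qed
    show ?thesis using z[OF L(1)] z[OF L(2)] by simp
  qed
qed

definition pd_family :: "'m formal_distribution \<Rightarrow> bool" where
  "pd_family \<Lambda> \<longleftrightarrow> (\<forall>r. point_distribution A x\<^sub>0 (\<Lambda> r))"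

lemma pd_family_point_family: "pd_family \<Lambda> \<Longrightarrow> point_family \<Lambda>"
  by (simp add: pd_family_def point_family_def point_distribution_functional)

lemma fd_apply_germ:
  assumes \<Lambda>: "pd_family \<Lambda>" and ev: "\<And>k. \<forall>\<^sub>F p in nhds x\<^sub>0. (F $$ k) p = (G $$ k) p"
  shows "fd_apply \<Lambda> F = fd_apply \<Lambda> G"
proof (rule fd_apply_cong)
  show "\<Lambda> r 0 = 0" for r using point_family_0[OF pd_family_point_family[OF \<Lambda>]] .
  show "\<Lambda> r (F $$ k) = \<Lambda> r (G $$ k)" for r k
    using \<Lambda> ev unfolding pd_family_def by (intro point_distribution_germ) auto
qed

definition cut_fls :: "('m \<Rightarrow> complex) fls \<Rightarrow> ('m \<Rightarrow> complex) fls" where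
  "cut_fls F = Abs_fls (\<lambda>k. cut (F $$ k))"

lemma cut_0 [simp]: "cut 0 = 0"
  by (simp add: cut_def fun_eq_iff)

lemma cut_fls_nth [simp]: "cut_fls F $$ k = cut (F $$ k)"
  unfolding cut_fls_def by (rule nth_Abs_fls_lower_bound[of "fls_subdegree F"]) simp

lemma formal_cut: "(\<And>k. smooth_fun_on A W (F $$ k)) \<Longrightarrow> formal (cut_fls F)"
  by (simp add: formal_def cut_in)

text \<open>The extension of the zero function is chosen to be zero, in order that only finitely many
  coefficients of negative order occur.\<close>

lemma formal_extension:
  assumes F: "formal F"
  obtains G where "\<And>k. smooth_fun_on A UNIV (G $$ k)" "\<And>k. \<forall>\<^sub>F p in nhds x\<^sub>0. (G $$ k) p = (F $$ k) p"
proof -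
  have "\<exists>g. smooth_fun_on A UNIV g \<and> (\<forall>\<^sub>F p in nhds x\<^sub>0. g p = f p) \<and> (f = 0 \<longrightarrow> g = 0)" if f: "f \<in> R" for f
  proof (cases "f = 0")
    case True
    then show ?thesis
      using smooth_fun_on_const[of UNIV "0::complex"] by (intro exI[of _ 0]) (simp add: zero_fun_def)
  next
    case False
    obtain g where "smooth_fun_on A UNIV g" "\<forall>\<^sub>F p in nhds x\<^sub>0. g p = f p"
      by (rule germ_extension[OF R_near[OF f]])
    then show ?thesis using False by (intro exI[of _ g]) simp
  qed
  note ex = this
  define E where "E f = (SOME g. smooth_fun_on A UNIV g \<and> (\<forall>\<^sub>F p in nhds x\<^sub>0. g p = f p) \<and> (f = 0 \<longrightarrow> g = 0))"
    for f :: "'m \<Rightarrow> complex"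
  have E: "smooth_fun_on A UNIV (E f) \<and> (\<forall>\<^sub>F p in nhds x\<^sub>0. E f p = f p) \<and> (f = 0 \<longrightarrow> E f = 0)"
    if "f \<in> R" for f
    unfolding E_def by (rule someI_ex[OF ex[OF that]])
  define G where "G = Abs_fls (\<lambda>k. E (F $$ k))"
  have "G $$ k = E (F $$ k)" for k
    unfolding G_def by (rule nth_Abs_fls_lower_bound[of "fls_subdegree F"]) (use E[OF zero_in] in simp)
  then show ?thesis using E F by (intro that[of G]) (simp_all add: formal_def)
qed

end

section \<open>Formal oscillatory integrals in a chart\<close>

lemma of_int_fun_apply [simp]: "(of_int k :: 'a \<Rightarrow> complex) p = of_int k"
  by (cases k rule: int_cases2) simp_all

locale foi_chart = pointed_chart A c W x\<^sub>0
  for A :: "('m::{t2_space, second_countable_topology}, 'n::finite) chart set"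
    and c :: "('m, 'n) chart" and W :: "'m set" and x\<^sub>0 :: 'm +
  fixes \<rho> :: "('m, 'n) top_form fps" and u :: "('m \<Rightarrow> complex) fps"
  assumes top_forms: "\<And>r. top_form A (\<rho> $ r)" and log_density: "log_density A \<rho> c W u"
begin

definition dens :: "('m \<Rightarrow> complex) fps" where
  "dens = Abs_fps (\<lambda>r. (\<rho> $ r) c)"

definition d_density :: "'n \<Rightarrow> ('m \<Rightarrow> complex) fps" where
  "d_density i = Abs_fps (\<lambda>r. cpd c i ((\<rho> $ r) c))"

lemma dens_at: "fps_at dens p = form_at \<rho> c p"
  by (rule fps_ext) (simp add: dens_def form_at_def)

lemma dens_exp: "p \<in> W \<Longrightarrow> fps_at dens p = formal_exp (fps_at u p)"
  using log_density unfolding dens_at by (simp add: log_density_def fps_at_def)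

lemma smooth_u: "smooth_fun_on A W (u $ k)"
  using log_density unfolding log_density_def by blast

lemma smooth_dens: "smooth_fun_on A W (dens $ r)"
proof -
  have "smooth_fun_on A (fst c) ((\<rho> $ r) c)" using top_forms[of r] c_in unfolding top_form_def by blast
  then have "smooth_fun_on A W ((\<rho> $ r) c)" by (rule smooth_fun_on_subset) (rule W_dom)
  then show ?thesis by (simp add: dens_def)
qed

lemma d_density_nth: "d_density i $ r = cpd c i (dens $ r)"
  by (simp add: d_density_def dens_def)

lemma dens_nz: "p \<in> W \<Longrightarrow> (dens $ 0) p \<noteq> 0"
  using arg_cong[OF dens_exp, of p "\<lambda>F. F $ 0"] by (simp add: formal_exp_nth_0)

lemma dens_unit: "p \<in> W \<Longrightarrow> inverse (fps_at dens p) * fps_at dens p = 1"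
  by (rule inverse_mult_eq_1) (simp add: dens_nz)

text \<open>The logarithmic derivative \<open>(D\<^sub>i \<rho>)/\<rho>\<close> of the density.\<close>

definition \<eta> :: "'n \<Rightarrow> ('m \<Rightarrow> complex) fps" where
  "\<eta> i = Abs_fps (\<lambda>k p. (fps_at (d_density i) p * inverse (fps_at dens p)) $ k)"

lemma \<eta>_at: "fps_at (\<eta> i) p = fps_at (d_density i) p * inverse (fps_at dens p)"
  by (rule fps_ext) (simp add: \<eta>_def)

lemma smooth_\<eta>: "smooth_fun_on A W (\<eta> i $ k)"
proof (rule smooth_fps_quotient[OF W_open _ smooth_dens dens_nz])
  show "smooth_fun_on A W (d_density i $ k)" for k
    unfolding d_density_nth by (rule cpd_smooth[OF smooth_dens])
  show "fps_at (\<eta> i) p * fps_at dens p = fps_at (d_density i) p" if "p \<in> W" for p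
    using dens_unit[OF that] by (simp add: \<eta>_at mult.assoc)
qed

text \<open>The coefficient of \<open>w\<close> when \<open>D\<^sub>i\<close> is applied to \<open>e\<^sup>\<phi> w \<rho>\<close> and the result is divided by \<open>e\<^sup>\<phi> \<rho>\<close>.\<close>

definition B :: "('m \<Rightarrow> complex) fls \<Rightarrow> 'n \<Rightarrow> ('m \<Rightarrow> complex) fls" where
  "B \<phi> i = D_fls i (cut_fls \<phi>) + cut_fls (fps_to_fls (\<eta> i))"

definition smooth_phase :: "('m \<Rightarrow> complex) fls \<Rightarrow> bool" where
  "smooth_phase \<phi> \<longleftrightarrow> (\<forall>k. smooth_fun_on A UNIV (\<phi> $$ k))"

lemma smooth_phase_on: "smooth_phase \<phi> \<Longrightarrow> smooth_fun_on A W (\<phi> $$ k)"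
  unfolding smooth_phase_def by (meson smooth_fun_on_subset subset_UNIV)

lemma smooth_fps_to_fls: "(\<And>k. smooth_fun_on A W (G $ k)) \<Longrightarrow> smooth_fun_on A W (fps_to_fls G $$ k)"
  for G :: "('m \<Rightarrow> complex) fps"
  using smooth_fun_on_const[of W "0 :: complex"] by (simp add: zero_fun_def)

lemma formal_B: "smooth_phase \<phi> \<Longrightarrow> formal (B \<phi> i)"
  unfolding B_def by (intro formal_add formal_D formal_cut smooth_phase_on smooth_fps_to_fls smooth_\<eta>)

definition foi_local :: "('m \<Rightarrow> complex) fls \<Rightarrow> 'm formal_distribution \<Rightarrow> bool" where
  "foi_local \<phi> \<Lambda> \<longleftrightarrow> (\<forall>i. \<forall>w\<in>R. fd_apply \<Lambda> (fls_const (D i w) + B \<phi> i * fls_const w) = 0)"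

abbreviation foi_integrand :: "('m \<Rightarrow> complex) fls \<Rightarrow> ('m, 'n) vfield \<Rightarrow> ('m \<Rightarrow> complex) \<Rightarrow> ('m \<Rightarrow> complex) fls" where
  "foi_integrand \<phi> v f \<equiv> fls_const (vf_apply A v f) +
          (vf_apply_fls A v \<phi> + fps_to_fls (divergence A \<rho> v)) * fls_const f"

lemma divergence_at:
  assumes v: "vector_field A v" and p: "p \<in> W"
  shows "(divergence A \<rho> v $ k) p = (if k = 0 then div_chart v c p else 0) + (\<Sum>i\<in>UNIV. vec_nth (v c p) i * (\<eta> i $ k) p)"
proof -
  have "form_at (Abs_fps (\<lambda>s. lie_form v (\<rho> $ s))) c p =
      (\<Sum>i\<in>UNIV. fps_const (vec_nth (v c p) i) * fps_at (d_density i) p) + fps_const (div_chart v c p) * fps_at dens p"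
    by (rule fps_ext)
      (simp add: form_at_def lie_form_eq fps_sum_nth d_density_def dens_def mult.commute)
  then have "form_at (Abs_fps (\<lambda>s. lie_form v (\<rho> $ s))) c p / form_at \<rho> c p =
      (\<Sum>i\<in>UNIV. fps_const (vec_nth (v c p) i) * fps_at (\<eta> i) p) + fps_const (div_chart v c p)"
    using dens_unit[OF p] dens_nz[OF p]
    by (simp add: dens_at[symmetric] fps_divide_unit distrib_right sum_distrib_right \<eta>_at mult.assoc mult.commute[of "fps_at dens p"])
  then show ?thesis
    using divergence_eq[OF v top_forms c_in W_chart[OF p]] by (simp add: fps_sum_nth)
qed

text \<open>In the chart, \<open>v f + (v \<phi> + div\<^sub>\<rho> v) f = \<Sum>\<^sub>i (D\<^sub>i + B\<^sub>i)(v\<^sup>i f)\<close>: the divergence combines with the derivative of \<open>f\<close>.\<close>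

lemma foi_integrand_at:
  assumes v: "vector_field A v" and f: "smooth_fun_on A UNIV f" and \<phi>: "smooth_phase \<phi>" and p: "p \<in> W"
  shows "(foi_integrand \<phi> v f $$ k) p =
    (if k = 0 then \<Sum>i\<in>UNIV. cpd c i (\<lambda>q. vec_nth (v c q) i * f q) p else 0)
    + (\<Sum>i\<in>UNIV. (B \<phi> i $$ k) p * (vec_nth (v c p) i * f p))"
proof -
  have fW: "smooth_fun_on A W f" using f by (rule smooth_fun_on_subset) simp
  have "smooth_fun_on A (fst c) (v c)" using v c_in unfolding vector_field_def by blast
  then have "smooth_fun_on A W (v c)" by (rule smooth_fun_on_subset) (rule W_dom)
  then have vW: "smooth_fun_on A W (\<lambda>q. vec_nth (v c q) i)" for i
    by (rule smooth_fun_on_component[OF W_open])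
  have 1: "vf_apply A v g p = (\<Sum>i\<in>UNIV. vec_nth (v c p) i * cpd c i g p)" if "smooth_fun_on A W g" for g
    by (rule vf_apply_eq[OF v c_in W_chart[OF p] W_open p that])
  have 2: "(\<Sum>i\<in>UNIV. cpd c i (\<lambda>q. vec_nth (v c q) i * f q) p) = div_chart v c p * f p + vf_apply A v f p"
    unfolding 1[OF fW] div_chart_def
    by (simp add: cpd_mult[OF c_in W_chart[OF p] p vW fW] sum.distrib sum_distrib_right)
  have 3: "(B \<phi> i $$ k) p = cpd c i (\<phi> $$ k) p + (if k < 0 then 0 else (\<eta> i $ nat k) p)" for i
  proof -
    have "cpd c i (cut (\<phi> $$ k)) p = cpd c i (\<phi> $$ k) p" using p by (rule cpd_cut) simp
    then show ?thesis using p by (simp add: B_def D_def)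
  qed
  have 4: "(\<Sum>i\<in>UNIV. (B \<phi> i $$ k) p * (vec_nth (v c p) i * f p)) =
      (vf_apply A v (\<phi> $$ k) p + (if k < 0 then 0 else \<Sum>i\<in>UNIV. vec_nth (v c p) i * (\<eta> i $ nat k) p)) * f p"
    unfolding 3 1[OF smooth_phase_on[OF \<phi>]]
    by (simp add: distrib_right distrib_left sum.distrib sum_distrib_left sum_distrib_right mult_ac)
  show ?thesis
    unfolding 2 4
    by (simp add: vf_apply_fls_nth divergence_at[OF v p] algebra_simps)
qed

text \<open>By \<open>foi_integrand_at\<close> the condition for \<open>v\<close> and \<open>f\<close> is a sum of local conditions for the functions \<open>v\<^sup>i f\<close>. Conversely, the local condition
  for \<open>w\<close> is the one for \<open>f = 1\<close> and a global vector field with the germ \<open>w \<partial>\<^sub>i\<close>.\<close>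

lemma foi_iff_local:
  assumes \<Lambda>: "pd_family \<Lambda>" and \<phi>: "smooth_phase \<phi>"
  shows "(\<forall>v f. vector_field A v \<longrightarrow> smooth_fun_on A UNIV f \<longrightarrow> fd_apply \<Lambda> (foi_integrand \<phi> v f) = 0)
    \<longleftrightarrow> foi_local \<phi> \<Lambda>"
proof
  assume foi: "\<forall>v f. vector_field A v \<longrightarrow> smooth_fun_on A UNIV f \<longrightarrow> fd_apply \<Lambda> (foi_integrand \<phi> v f) = 0"
  show "foi_local \<phi> \<Lambda>"
    unfolding foi_local_def
  proof (intro allI ballI)
    fix i w assume w: "w \<in> R"
    let ?one = "\<lambda>_::'m. 1 :: complex"
    obtain v where v: "vector_field A v" "\<forall>\<^sub>F p in nhds x\<^sub>0. v c p = axis i (w p)"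
      by (rule vector_field_extension[OF c_in x0_dom R_near[OF w]])
    obtain N where N: "open N" "x\<^sub>0 \<in> N" "\<And>p. p \<in> N \<Longrightarrow> v c p = axis i (w p)"
      using v(2) unfolding eventually_nhds by blast
    have "\<forall>\<^sub>F p in nhds x\<^sub>0. (foi_integrand \<phi> v ?one $$ k) p = ((fls_const (D i w) + B \<phi> i * fls_const w) $$ k) p" for k
      using eventually_nhds_in_open[OF N(1,2)] eventually_nhds_in_open[OF W_open x0_in]
    proof eventually_elim
      case (elim p)
      have "cpd c j (\<lambda>q. vec_nth (v c q) j * 1) p = (if j = i then cpd c i w p else 0)" for j
      proof -
        have "cpd c j (\<lambda>q. vec_nth (v c q) j * 1) p = cpd c j (\<lambda>q. if j = i then w q else 0) p"
          using W_chart[OF elim(2)]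
          by (intro chart_pds_cong[OF c_in] eventually_mono[OF eventually_nhds_in_open[OF N(1) elim(1)]])
            (auto simp: N(3) axis_def)
        then show ?thesis by (cases "j = i") (simp_all add: cpd_const)
      qed
      moreover have "(\<Sum>j\<in>UNIV. (B \<phi> j $$ k) p * (vec_nth (v c p) j * 1)) = (B \<phi> i $$ k) p * w p"
        by (simp add: N(3)[OF elim(1)] axis_def if_distrib[of "\<lambda>z. _ * z"] cong: if_cong)
      ultimately show ?case
        unfolding foi_integrand_at[OF v(1) smooth_fun_on_const \<phi> elim(2)]
        using elim(2) by (simp add: D_def)
    qed
    then have "fd_apply \<Lambda> (foi_integrand \<phi> v ?one) = fd_apply \<Lambda> (fls_const (D i w) + B \<phi> i * fls_const w)"
      by (rule fd_apply_germ[OF \<Lambda>])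
    then show "fd_apply \<Lambda> (fls_const (D i w) + B \<phi> i * fls_const w) = 0"
      using foi v(1) smooth_fun_on_const[of UNIV "1 :: complex"] by metis
  qed
next
  assume loc: "foi_local \<phi> \<Lambda>"
  show "\<forall>v f. vector_field A v \<longrightarrow> smooth_fun_on A UNIV f \<longrightarrow> fd_apply \<Lambda> (foi_integrand \<phi> v f) = 0"
  proof (intro allI impI)
    fix v :: "('m, 'n) vfield" and f :: "'m \<Rightarrow> complex" assume v: "vector_field A v" and f: "smooth_fun_on A UNIV f"
    have fW: "smooth_fun_on A W f" using f by (rule smooth_fun_on_subset) simp
    have "smooth_fun_on A (fst c) (v c)" using v c_in unfolding vector_field_def by blast
    then have "smooth_fun_on A W (v c)" by (rule smooth_fun_on_subset) (rule W_dom)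
    then have vW: "smooth_fun_on A W (\<lambda>q. vec_nth (v c q) i)" for i
      by (rule smooth_fun_on_component[OF W_open])
    define w where "w i = cut (\<lambda>q. vec_nth (v c q) i * f q)" for i
    have w: "w i \<in> R" for i unfolding w_def by (rule cut_in[OF smooth_fun_on_mult[OF W_open vW fW]])
    let ?Q = "\<lambda>i. fls_const (D i (w i)) + B \<phi> i * fls_const (w i)"
    have Q: "formal (?Q i)" for i
      using w formal_B[OF \<phi>] by (intro formal_add formal_mult formal_const) auto
    have sum: "formal (\<Sum>i\<in>I. ?Q i) \<and> fd_apply \<Lambda> (\<Sum>i\<in>I. ?Q i) = 0" for I :: "'n set"
    proof (induction I rule: infinite_finite_induct)
      case (insert i I)
      then show ?case
        using loc w Q fd_apply_add[OF pd_family_point_family[OF \<Lambda>] Q[of i], of "\<Sum>i\<in>I. ?Q i"]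
        by (simp add: formal_add foi_local_def)
    next
      case empty
      have "fd_apply \<Lambda> 0 = 0"
        by (rule fls_eqI) (simp add: fd_apply_nth point_family_0[OF pd_family_point_family[OF \<Lambda>]])
      then show ?case by (simp add: formal_def)
    next
      case (infinite I)
      have "fd_apply \<Lambda> 0 = 0"
        by (rule fls_eqI) (simp add: fd_apply_nth point_family_0[OF pd_family_point_family[OF \<Lambda>]])
      then show ?case using infinite by (simp add: formal_def)
    qed
    have "\<forall>\<^sub>F p in nhds x\<^sub>0. (foi_integrand \<phi> v f $$ k) p = ((\<Sum>i\<in>UNIV. ?Q i) $$ k) p" for k
      using eventually_nhds_in_open[OF W_open x0_in]
    proof eventually_elim
      case (elim p)
      have nth: "(\<Sum>i\<in>I. ?Q i) $$ k = (\<Sum>i\<in>I. ?Q i $$ k)" for I :: "'n set"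
        by (induction I rule: infinite_finite_induct) simp_all
      have "D i (w i) p = cpd c i (\<lambda>q. vec_nth (v c q) i * f q) p" for i
        using elim cpd_cut[OF elim, of "w i" "\<lambda>q. vec_nth (v c q) i * f q"] by (simp add: D_def w_def)
      moreover have "w i p = vec_nth (v c p) i * f p" for i using elim by (simp add: w_def)
      ultimately show ?case
        unfolding foi_integrand_at[OF v f \<phi> elim] nth
        by (simp add: sum_fun_apply sum.distrib)
    qed
    then have "fd_apply \<Lambda> (foi_integrand \<phi> v f) = fd_apply \<Lambda> (\<Sum>i\<in>UNIV. ?Q i)"
      by (rule fd_apply_germ[OF \<Lambda>])
    then show "fd_apply \<Lambda> (foi_integrand \<phi> v f) = 0" using sum by simp
  qed
qed

subsection \<open>Strong association\<close>

text \<open>The coefficient in strong association, as an element of the ring on \<open>W\<close>.\<close>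

definition T :: "('m \<Rightarrow> complex) fls \<Rightarrow> ('m \<Rightarrow> complex) fls" where
  "T \<phi> = cut_fls (fls_deriv (\<phi> + fps_to_fls u)) - fls_const (\<lambda>_. of_nat CARD('n) / 2) * (fls_X_inv * fls_const e)"

definition strong_local :: "('m \<Rightarrow> complex) fls \<Rightarrow> 'm formal_distribution \<Rightarrow> bool" where
  "strong_local \<phi> \<Lambda> \<longleftrightarrow> (\<forall>F. formal F \<longrightarrow> fls_deriv (fd_apply \<Lambda> F) = fd_apply \<Lambda> (fls_deriv F + T \<phi> * F))"

lemma smooth_deriv:
  fixes F :: "('m \<Rightarrow> complex) fls"
  assumes "open V" "\<And>k. smooth_fun_on A V (F $$ k)"
  shows "smooth_fun_on A V (fls_deriv F $$ k)"
proof -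
  have "fls_deriv F $$ k = (\<lambda>p. of_int (k + 1) * (F $$ (k + 1)) p)"
    by (simp add: fun_eq_iff)
  then show ?thesis using smooth_fun_on_mult[OF assms(1) smooth_fun_on_const assms(2)] by simp
qed

lemma smooth_phase_u:
  assumes "smooth_phase \<phi>"
  shows "smooth_fun_on A W (fls_deriv (\<phi> + fps_to_fls u) $$ k)"
proof (rule smooth_deriv[OF W_open])
  show "smooth_fun_on A W ((\<phi> + fps_to_fls u) $$ k)" for k
    using smooth_fun_on_add[OF W_open smooth_phase_on[OF assms, of k] smooth_fps_to_fls[OF smooth_u], of k]
    by (simp add: plus_fun_def del: fps_to_fls_nth)
qed

lemma formal_T: "smooth_phase \<phi> \<Longrightarrow> formal (T \<phi>)"
  unfolding T_def
  by (intro formal_diff formal_cut smooth_phase_u formal_cst_mult formal_shift formal_const e_in)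

lemma fls_mult_germ:
  fixes F G F' G' :: "('m \<Rightarrow> complex) fls"
  assumes "\<And>k. \<forall>\<^sub>F p in nhds x\<^sub>0. (F $$ k) p = (F' $$ k) p" "\<And>k. \<forall>\<^sub>F p in nhds x\<^sub>0. (G $$ k) p = (G' $$ k) p"
  shows "\<forall>\<^sub>F p in nhds x\<^sub>0. ((F * G) $$ k) p = ((F' * G') $$ k) p"
proof -
  define I where "I = {min (fls_subdegree F) (fls_subdegree F')..k - min (fls_subdegree G) (fls_subdegree G')}"
  have "(F * G) $$ k = (\<Sum>i\<in>I. F $$ i * G $$ (k - i))"
    by (rule fls_times_nth_finite) (auto simp: I_def not_le)
  moreover have "(F' * G') $$ k = (\<Sum>i\<in>I. F' $$ i * G' $$ (k - i))"
    by (rule fls_times_nth_finite) (auto simp: I_def not_le)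
  moreover have "\<forall>\<^sub>F p in nhds x\<^sub>0. \<forall>i\<in>I. (F $$ i) p = (F' $$ i) p \<and> (G $$ (k - i)) p = (G' $$ (k - i)) p"
    using assms by (intro eventually_ball_finite ballI eventually_conj) (auto simp: I_def)
  ultimately show ?thesis
    by (auto elim!: eventually_mono simp: sum_fun_apply)
qed

text \<open>Two densities of the same form differ by the Jacobian determinant, which does not depend on \<open>\<nu>\<close> and disappears
  under the logarithmic derivative. So strong association may be tested in the chart \<open>c\<close>.\<close>

lemma u_deriv_germ:
  assumes "log_density A \<rho> c' W' u'" "x\<^sub>0 \<in> W'"
  shows "\<forall>\<^sub>F p in nhds x\<^sub>0. (fps_deriv u' $ k) p = (fps_deriv u $ k) p"
proof -
  have c': "c' \<in> A" "open W'" "W' \<subseteq> fst c'" "\<And>p. p \<in> W' \<Longrightarrow> form_at \<rho> c' p = formal_exp (fps_at u' p)"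
    using assms(1) unfolding log_density_def fps_at_def by blast+
  show ?thesis
    using eventually_nhds_in_open[OF W_open x0_in] eventually_nhds_in_open[OF c'(2) assms(2)]
  proof eventually_elim
    case (elim p)
    let ?J = "fps_const (complex_of_real (Determinants.det (jac c c' p)))"
    have "form_at \<rho> c p = ?J * form_at \<rho> c' p"
    proof (rule fps_ext)
      fix r
      have "(\<rho> $ r) c p = complex_of_real (Determinants.det (jac c c' p)) * (\<rho> $ r) c' p"
        using top_forms[of r] c_in c'(1,3) W_chart[OF elim(1)] elim(2) unfolding top_form_def by blast
      then show "form_at \<rho> c p $ r = (?J * form_at \<rho> c' p) $ r" by (simp add: form_at_def)
    qed
    then have e1: "formal_exp (fps_at u p) = ?J * formal_exp (fps_at u' p)"
      using dens_exp[OF elim(1)] c'(4)[OF elim(2)] by (simp add: dens_at)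
    have "formal_exp (fps_at u p) * fps_deriv (fps_at u p) = ?J * (formal_exp (fps_at u' p) * fps_deriv (fps_at u' p))"
      using arg_cong[OF e1, of fps_deriv]
      by (simp only: formal_exp_deriv fps_deriv_mult fps_deriv_const mult_zero_left add_0_right)
    also have "\<dots> = formal_exp (fps_at u p) * fps_deriv (fps_at u' p)"
      unfolding e1 by (simp add: mult.assoc)
    finally have e2: "formal_exp (fps_at u p) * fps_deriv (fps_at u p) = formal_exp (fps_at u p) * fps_deriv (fps_at u' p)" .
    have "formal_exp (fps_at u p) \<noteq> 0"
    proof
      assume "formal_exp (fps_at u p) = 0"
      then have "formal_exp (fps_at u p) $ 0 = 0" by (simp only: fps_zero_nth)
      then show False by (simp add: formal_exp_nth_0)
    qed
    then have "fps_deriv (fps_at u p) = fps_deriv (fps_at u' p)"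
      using e2 mult_left_cancel[of "formal_exp (fps_at u p)"] by blast
    then have "fps_at (fps_deriv u') p $ k = fps_at (fps_deriv u) p $ k"
      by (simp only: fps_at_deriv)
    then show ?case by (simp only: fps_at_nth)
  qed
qed

lemma integrand_strong_germ:
  assumes u': "log_density A \<rho> c' W' u'" "x\<^sub>0 \<in> W'"
    and fF: "\<And>k. \<forall>\<^sub>F p in nhds x\<^sub>0. (f $$ k) p = (F $$ k) p"
  shows "\<forall>\<^sub>F p in nhds x\<^sub>0. ((fls_deriv f +
             (fls_deriv (\<phi> + fps_to_fls u') - fls_const (\<lambda>_. of_nat CARD('n) / 2) * fls_X_inv) * f) $$ k) p
      = ((fls_deriv F + T \<phi> * F) $$ k) p"
proof -
  have 1: "\<forall>\<^sub>F p in nhds x\<^sub>0. (fls_deriv f $$ k) p = (fls_deriv F $$ k) p"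
    using fF[of "k + 1"] by eventually_elim simp
  have "\<forall>\<^sub>F p in nhds x\<^sub>0. ((fls_deriv (\<phi> + fps_to_fls u') - fls_const (\<lambda>_. of_nat CARD('n) / 2) * fls_X_inv) $$ k) p
      = (T \<phi> $$ k) p" for k
  proof -
    have "\<forall>\<^sub>F p in nhds x\<^sub>0. (fls_deriv (fps_to_fls u') $$ k) p = (fls_deriv (fps_to_fls u) $$ k) p"
      using u_deriv_germ[OF u', of "nat k"] unfolding fls_deriv_fps_to_fls
      by eventually_elim (simp del: fps_deriv_nth)
    then show ?thesis
      using eventually_nhds_in_open[OF W_open x0_in]
    proof eventually_elim
      case (elim p)
      have "(fls_const (\<lambda>_. of_nat CARD('n) / 2) * fls_X_inv) $$ k =
          (fls_const (\<lambda>_. of_nat CARD('n) / 2) $$ (k + 1) :: 'm \<Rightarrow> complex)"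
        by (simp add: fls_X_inv_times_conv_shift)
      then show ?case
        using elim(1) elim(2) by (simp add: T_def e_def del: fls_deriv_nth)
    qed
  qed
  from 1 fls_mult_germ[OF this fF, of k] show ?thesis
    by eventually_elim (simp only: fls_plus_nth plus_fun_apply)
qed

theorem strongly_associated_iff_local:
  assumes \<phi>: "smooth_phase \<phi>"
  shows "strongly_associated A x\<^sub>0 \<phi> \<rho> \<Lambda> \<longleftrightarrow>
    pd_family \<Lambda> \<and> \<Lambda> 0 \<noteq> 0 \<and> foi_local \<phi> \<Lambda> \<and> strong_local \<phi> \<Lambda>"
proof (cases "pd_family \<Lambda> \<and> \<Lambda> 0 \<noteq> 0 \<and> foi_local \<phi> \<Lambda>")
  case True
  then have \<Lambda>: "pd_family \<Lambda>" by blast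
  have foi: "foi A x\<^sub>0 \<phi> \<rho> \<Lambda>"
    using True foi_iff_local[OF \<Lambda> \<phi>] unfolding foi_def pd_family_def by blast
  let ?I = "\<lambda>u f. fls_deriv f + (fls_deriv (\<phi> + fps_to_fls u) - fls_const (\<lambda>_. of_nat CARD('n) / 2) * fls_X_inv) * f"
  have "(\<exists>c W u. x\<^sub>0 \<in> W \<and> log_density A \<rho> c W u \<and>
        (\<forall>f. (\<forall>k. smooth_fun_on A W (f $$ k)) \<longrightarrow> fls_deriv (fd_apply \<Lambda> f) - fd_apply \<Lambda> (?I u f) = 0))
      \<longleftrightarrow> strong_local \<phi> \<Lambda>" (is "?l \<longleftrightarrow> _")
  proof
    assume ?l
    then obtain c' W' u' where u': "x\<^sub>0 \<in> W'" "log_density A \<rho> c' W' u'"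
      and st: "\<And>f. (\<And>k. smooth_fun_on A W' (f $$ k)) \<Longrightarrow> fls_deriv (fd_apply \<Lambda> f) - fd_apply \<Lambda> (?I u' f) = 0"
      by blast
    show "strong_local \<phi> \<Lambda>"
      unfolding strong_local_def
    proof (intro allI impI)
      fix F assume F: "formal F"
      obtain f where f: "\<And>k. smooth_fun_on A UNIV (f $$ k)" "\<And>k. \<forall>\<^sub>F p in nhds x\<^sub>0. (f $$ k) p = (F $$ k) p"
        by (rule formal_extension[OF F]) (rule that)
      have "fls_deriv (fd_apply \<Lambda> f) - fd_apply \<Lambda> (?I u' f) = 0"
        by (rule st, rule smooth_fun_on_subset[OF f(1)]) simp
      moreover have "fd_apply \<Lambda> f = fd_apply \<Lambda> F" by (rule fd_apply_germ[OF \<Lambda> f(2)])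
      moreover have "fd_apply \<Lambda> (?I u' f) = fd_apply \<Lambda> (fls_deriv F + T \<phi> * F)"
        by (rule fd_apply_germ[OF \<Lambda> integrand_strong_germ[OF u'(2,1) f(2)]])
      ultimately show "fls_deriv (fd_apply \<Lambda> F) = fd_apply \<Lambda> (fls_deriv F + T \<phi> * F)" by simp
    qed
  next
    assume sl: "strong_local \<phi> \<Lambda>"
    have "fls_deriv (fd_apply \<Lambda> f) - fd_apply \<Lambda> (?I u f) = 0" if f: "\<And>k. smooth_fun_on A W (f $$ k)" for f
    proof -
      have g: "\<forall>\<^sub>F p in nhds x\<^sub>0. (f $$ k) p = (cut_fls f $$ k) p" for k
        using cut_germ[of "f $$ k"] by eventually_elim simp
      have "fd_apply \<Lambda> f = fd_apply \<Lambda> (cut_fls f)" by (rule fd_apply_germ[OF \<Lambda> g])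
      moreover have "fd_apply \<Lambda> (?I u f) = fd_apply \<Lambda> (fls_deriv (cut_fls f) + T \<phi> * cut_fls f)"
        by (rule fd_apply_germ[OF \<Lambda> integrand_strong_germ[OF log_density x0_in g]])
      moreover have "fls_deriv (fd_apply \<Lambda> (cut_fls f)) = fd_apply \<Lambda> (fls_deriv (cut_fls f) + T \<phi> * cut_fls f)"
        using sl formal_cut[OF f] unfolding strong_local_def by blast
      ultimately show ?thesis by simp
    qed
    then show ?l using x0_in log_density by blast
  qed
  then show ?thesis using True foi unfolding strongly_associated_def by blast
next
  case False
  have "pd_family \<Lambda> \<and> \<Lambda> 0 \<noteq> 0 \<and> foi_local \<phi> \<Lambda>" if "foi A x\<^sub>0 \<phi> \<rho> \<Lambda>"
    using that foi_iff_local[OF _ \<phi>, of \<Lambda>] unfolding foi_def pd_family_def by blast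
  then show ?thesis using False unfolding strongly_associated_def by blast
qed

end

section \<open>Existence and uniqueness in a chart\<close>

lemma fps_scale_const: "fps_scale (fps_const a) \<Lambda> = (\<lambda>r f. a * \<Lambda> r f)"
proof (intro ext)
  fix r f
  have "(\<Sum>l\<le>r. fps_const a $ l * \<Lambda> (r - l) f) = (\<Sum>l\<in>{0}. fps_const a $ l * \<Lambda> (r - l) f)"
    by (rule sum.mono_neutral_right) auto
  then show "fps_scale (fps_const a) \<Lambda> r f = a * \<Lambda> r f" by (simp add: fps_scale_def)
qed

lemma point_distribution_scale:
  fixes A :: "('m::topological_space, 'n::finite) chart set"
  assumes "point_distribution A x L" shows "point_distribution A x (\<lambda>f. a * L f)"
proof -
  from assms[unfolded point_distribution_def] obtain c where c: "c \<in> A"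
    and ex: "x \<in> fst c \<and> (\<exists>I (b :: 'n list \<Rightarrow> complex). finite I \<and>
      (\<forall>f. L f = (if smooth_near A x f then \<Sum>is\<in>I. b is * chart_pds c is f x else 0)))" by (rule bexE)
  from ex[THEN conjunct2] obtain I where "\<exists>b :: 'n list \<Rightarrow> complex. finite I \<and>
      (\<forall>f. L f = (if smooth_near A x f then \<Sum>is\<in>I. b is * chart_pds c is f x else 0))" by (rule exE)
  then obtain b :: "'n list \<Rightarrow> complex" where b: "finite I \<and>
      (\<forall>f. L f = (if smooth_near A x f then \<Sum>is\<in>I. b is * chart_pds c is f x else 0))" by (rule exE)
  show ?thesis
    unfolding point_distribution_def
  proof (intro bexI[OF _ c] conjI exI[of _ I] exI[of _ "\<lambda>is. a * b is"] allI)
    show "x \<in> fst c" by (rule ex[THEN conjunct1])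
    show "finite I" by (rule b[THEN conjunct1])
    fix f
    show "a * L f = (if smooth_near A x f then \<Sum>is\<in>I. a * b is * chart_pds c is f x else 0)"
      by (simp add: b[THEN conjunct2, THEN spec[of _ f]] sum_distrib_left mult.assoc)
  qed
qed

text \<open>The inverse of a symmetric matrix is symmetric; it is stated without matrices to match the index notation of the
  Gaussian functionals.\<close>

lemma symmetric_inverse_exists:
  fixes H :: "'n::finite \<Rightarrow> 'n \<Rightarrow> complex"
  assumes sym: "\<And>i j. H i j = H j i" and det: "Determinants.det (vec_lambda (\<lambda>i. vec_lambda (\<lambda>j. H i j))) \<noteq> 0"
  obtains M where "\<And>i j. M i j = M j i" "\<And>j i. (\<Sum>l\<in>UNIV. H j l * M l i) = (if j = i then 1 else 0)"
proof -
  let ?H = "vec_lambda (\<lambda>i. vec_lambda (\<lambda>j. H i j)) :: complex^'n^'n"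
  have "invertible ?H" using det invertible_det_nz by blast
  then obtain N where N: "?H ** N = mat 1" "N ** ?H = mat 1" unfolding invertible_def by blast
  have "transpose N ** ?H = mat 1"
  proof -
    have "transpose ?H = ?H" using sym by (simp add: transpose_def vec_eq_iff)
    then have "transpose N ** ?H = transpose (?H ** N)" by (simp add: matrix_transpose_mul)
    then show ?thesis by (simp add: N(1) transpose_mat)
  qed
  then have "transpose N ** (?H ** N) = N" by (simp add: matrix_mul_assoc)
  then have tN: "transpose N = N" by (simp add: N(1))
  show ?thesis
  proof (rule that[of "\<lambda>i j. vec_nth (vec_nth N i) j"])
    show "vec_nth (vec_nth N i) j = vec_nth (vec_nth N j) i" for i j
      using arg_cong[OF tN, of "\<lambda>N. vec_nth (vec_nth N i) j"] by (simp add: transpose_def)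
    show "(\<Sum>l\<in>UNIV. H j l * vec_nth (vec_nth N l) i) = (if j = i then 1 else 0)" for i j
      using arg_cong[OF N(1), of "\<lambda>N. vec_nth (vec_nth N j) i"] by (simp add: matrix_matrix_mult_def mat_def)
  qed
qed

context foi_chart
begin

lemma formal_phase_smooth: "formal_phase A x\<^sub>0 \<phi> \<Longrightarrow> smooth_phase \<phi>"
  by (simp add: formal_phase_def smooth_phase_def)

text \<open>The leading term of the phase, as an element of the ring on \<open>W\<close>.\<close>

definition \<psi> :: "('m \<Rightarrow> complex) fls \<Rightarrow> 'm \<Rightarrow> complex" where
  "\<psi> \<phi> = cut (\<phi> $$ (- 1))"

lemma \<psi>_in: "smooth_phase \<phi> \<Longrightarrow> \<psi> \<phi> \<in> R"
  unfolding \<psi>_def by (intro cut_in smooth_phase_on)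

lemma phase_hessian:
  assumes \<phi>: "formal_phase A x\<^sub>0 \<phi>"
  shows "\<psi> \<phi> x\<^sub>0 = 0" "D i (\<psi> \<phi>) x\<^sub>0 = 0"
    and "(\<And>M. (\<And>i j. M i j = M j i) \<Longrightarrow>
      (\<And>i j. (\<Sum>l\<in>UNIV. D j (D l (\<psi> \<phi>)) x\<^sub>0 * M l i) = (if j = i then 1 else 0)) \<Longrightarrow> thesis) \<Longrightarrow> thesis"
proof -
  have \<psi>R: "\<psi> \<phi> \<in> R" by (rule \<psi>_in[OF formal_phase_smooth[OF \<phi>]])
  have Ds: "Ds is (\<psi> \<phi>) x\<^sub>0 = chart_pds c is (\<phi> $$ (- 1)) x\<^sub>0" for "is"
    unfolding Ds_eq_chart_pds[OF \<psi>R x0_in] unfolding \<psi>_def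
    by (rule chart_pds_cong[OF c_in x0_dom cut_germ])
  have crit: "\<And>i. chart_pds c [i] (\<phi> $$ (- 1)) x\<^sub>0 = 0"
    "Determinants.det (vec_lambda (\<lambda>i. vec_lambda (\<lambda>j. chart_pds c [i, j] (\<phi> $$ (- 1)) x\<^sub>0))) \<noteq> 0"
    using \<phi> c_in x0_dom unfolding formal_phase_def nondegenerate_critical_def by blast+
  show "\<psi> \<phi> x\<^sub>0 = 0" using \<phi> x0_in by (simp add: \<psi>_def formal_phase_def)
  show "D i (\<psi> \<phi>) x\<^sub>0 = 0" using Ds[of "[i]"] crit(1) by simp
  have H: "D i (D j (\<psi> \<phi>)) x\<^sub>0 = chart_pds c [i, j] (\<phi> $$ (- 1)) x\<^sub>0" for i j
    using Ds[of "[i, j]"] by simp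
  have sym: "D i (D j (\<psi> \<phi>)) x\<^sub>0 = D j (D i (\<psi> \<phi>)) x\<^sub>0" for i j using D_comm[OF \<psi>R, of i j] by simp
  show thesis if "\<And>M. (\<And>i j. M i j = M j i) \<Longrightarrow>
      (\<And>i j. (\<Sum>l\<in>UNIV. D j (D l (\<psi> \<phi>)) x\<^sub>0 * M l i) = (if j = i then 1 else 0)) \<Longrightarrow> thesis"
  proof (rule symmetric_inverse_exists[of "\<lambda>i j. D i (D j (\<psi> \<phi>)) x\<^sub>0"])
    show "D i (D j (\<psi> \<phi>)) x\<^sub>0 = D j (D i (\<psi> \<phi>)) x\<^sub>0" for i j by (rule sym)
    show "Determinants.det (vec_lambda (\<lambda>i. vec_lambda (\<lambda>j. D i (D j (\<psi> \<phi>)) x\<^sub>0))) \<noteq> 0"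
      unfolding H by (rule crit(2))
    fix M assume "\<And>i j. M i j = M j i"
      "\<And>j i. (\<Sum>l\<in>UNIV. D j (D l (\<psi> \<phi>)) x\<^sub>0 * M l i) = (if j = i then 1 else 0)"
    then show thesis by (rule that)
  qed
qed

definition regular_phase :: "('m \<Rightarrow> complex) fls \<Rightarrow> ('m \<Rightarrow> complex) fps" where
  "regular_phase \<phi> = Abs_fps (\<lambda>k. \<phi> $$ int k)"

text \<open>The part \<open>e\<^bsup>\<phi>\<^sub>0 + \<nu> \<phi>\<^sub>1 + \<dots>\<^esup> \<rho>\<close> of the integrand that has no pole in \<open>\<nu>\<close>; \<open>\<epsilon>\<close> is its version in the ring on \<open>W\<close>,
  and \<open>\<beta>\<close> and \<open>\<tau>\<close> are its logarithmic derivatives in \<open>x\<^sup>i\<close> and in \<open>\<nu>\<close>.\<close>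

definition amplitude :: "('m \<Rightarrow> complex) fls \<Rightarrow> 'm \<Rightarrow> complex fps" where
  "amplitude \<phi> p = formal_exp (fps_at (regular_phase \<phi>) p) * fps_at dens p"

definition \<epsilon> :: "('m \<Rightarrow> complex) fls \<Rightarrow> ('m \<Rightarrow> complex) fps" where
  "\<epsilon> \<phi> = Abs_fps (\<lambda>k. cut (\<lambda>p. amplitude \<phi> p $ k))"

definition \<beta> :: "('m \<Rightarrow> complex) fls \<Rightarrow> 'n \<Rightarrow> ('m \<Rightarrow> complex) fps" where
  "\<beta> \<phi> i = Abs_fps (\<lambda>k. D i (cut (\<phi> $$ int k)) + cut (\<eta> i $ k))"

definition \<tau> :: "('m \<Rightarrow> complex) fls \<Rightarrow> ('m \<Rightarrow> complex) fps" where
  "\<tau> \<phi> = Abs_fps (\<lambda>k. cut (fps_deriv (regular_phase \<phi> + u) $ k))"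

lemma cut_off: "p \<notin> W \<Longrightarrow> cut f p = 0"
  by (simp add: cut_def)

lemma \<epsilon>_at: "p \<in> W \<Longrightarrow> fps_at (\<epsilon> \<phi>) p = amplitude \<phi> p"
  by (rule fps_ext) (simp add: \<epsilon>_def)

lemma smooth_exp_phase:
  assumes "smooth_phase \<phi>"
  shows "smooth_fun_on A W (\<lambda>p. formal_exp (fps_at (regular_phase \<phi>) p) $ k)"
proof -
  define E where "E = Abs_fps (\<lambda>k p. formal_exp (fps_at (regular_phase \<phi>) p) $ k)"
  have "smooth_fun_on A W (E $ k)"
  proof (rule smooth_formal_exp[OF W_open])
    show "smooth_fun_on A W (regular_phase \<phi> $ k)" for k
      using smooth_phase_on[OF assms] by (simp add: regular_phase_def)
    show "fps_at E p = formal_exp (fps_at (regular_phase \<phi>) p)" for p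
      by (rule fps_ext) (simp add: E_def)
  qed
  then show ?thesis by (simp add: E_def)
qed

lemma \<epsilon>_in:
  assumes "smooth_phase \<phi>"
  shows "\<epsilon> \<phi> $ k \<in> R"
proof -
  have "smooth_fun_on A W (\<lambda>p. \<Sum>j\<in>{0..k}. formal_exp (fps_at (regular_phase \<phi>) p) $ j * (dens $ (k - j)) p)"
    by (intro smooth_fun_on_sum[OF W_open] smooth_fun_on_mult[OF W_open] smooth_exp_phase[OF assms] smooth_dens)
  then show ?thesis
    by (simp add: \<epsilon>_def amplitude_def fps_mult_nth cut_in)
qed

lemma \<beta>_in: "smooth_phase \<phi> \<Longrightarrow> \<beta> \<phi> i $ k \<in> R"
  unfolding \<beta>_def by (simp add: cut_in smooth_phase_on smooth_\<eta>)

lemma \<tau>_in: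
  assumes "smooth_phase \<phi>"
  shows "\<tau> \<phi> $ k \<in> R"
proof -
  have "fps_deriv (regular_phase \<phi> + u) $ k =
      (\<lambda>p. of_nat (Suc k) * ((\<phi> $$ int (Suc k)) p + (u $ Suc k) p))"
    by (simp add: fun_eq_iff regular_phase_def distrib_left)
  then show ?thesis
    using smooth_fun_on_mult[OF W_open smooth_fun_on_const smooth_fun_on_add[OF W_open smooth_phase_on[OF assms] smooth_u]]
    by (simp add: \<tau>_def cut_in)
qed

text \<open>The exponential of a power series is defined by composition in \<open>\<complex>[[\<nu>]]\<close> at every point, which says nothing about the
  dependence on the point. The formula \<open>D\<^sub>i e\<^sup>a = e\<^sup>a D\<^sub>i a\<close> follows from uniqueness for the linear equation in \<open>\<nu>\<close>
  that the difference of both sides satisfies.\<close>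

lemma D_\<epsilon>:
  assumes \<phi>: "smooth_phase \<phi>"
  shows "D i (\<epsilon> \<phi> $ k) = (\<epsilon> \<phi> * \<beta> \<phi> i) $ k"
proof (rule R_eqI)
  show "D i (\<epsilon> \<phi> $ k) \<in> R" using \<epsilon>_in[OF \<phi>] by blast
  show "(\<epsilon> \<phi> * \<beta> \<phi> i) $ k \<in> R"
    unfolding fps_mult_nth using \<epsilon>_in[OF \<phi>] \<beta>_in[OF \<phi>] by auto
  fix p assume p: "p \<in> W"
  let ?a = "fps_at (regular_phase \<phi>) p"
  define E where "E k q = formal_exp (fps_at (regular_phase \<phi>) q) $ k" for k q
  define dE where "dE = Abs_fps (\<lambda>k. cpd c i (E k) p)"
  define da where "da = Abs_fps (\<lambda>k. cpd c i (\<phi> $$ int k) p)"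
  have sE: "smooth_fun_on A W (E k)" for k using smooth_exp_phase[OF \<phi>] by (simp add: E_def[abs_def])
  have sa: "smooth_fun_on A W (\<phi> $$ k)" for k by (rule smooth_phase_on[OF \<phi>])
  note rules = c_in W_chart[OF p]
  have fpsE: "Abs_fps (\<lambda>k. E k q) = formal_exp (fps_at (regular_phase \<phi>) q)" for q
    by (rule fps_ext) (simp add: E_def)
  have dE: "dE = formal_exp ?a * da"
  proof -
    have "fps_deriv (dE - formal_exp ?a * da) = (dE - formal_exp ?a * da) * fps_deriv ?a"
    proof -
      have "fps_deriv dE = dE * fps_deriv ?a + formal_exp ?a * fps_deriv da"
      proof (rule fps_ext)
        fix k
        have rec: "of_nat (Suc k) * E (Suc k) q = (\<Sum>j\<in>{0..k}. E j q * (of_nat (Suc (k - j)) * (\<phi> $$ int (Suc (k - j))) q))" for q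
        proof -
          have "fps_deriv (formal_exp (fps_at (regular_phase \<phi>) q)) $ k =
              (formal_exp (fps_at (regular_phase \<phi>) q) * fps_deriv (fps_at (regular_phase \<phi>) q)) $ k"
            by (simp only: formal_exp_deriv)
          then show ?thesis by (simp add: fps_mult_nth E_def regular_phase_def)
        qed
        have "of_nat (Suc k) * cpd c i (E (Suc k)) p = cpd c i (\<lambda>q. of_nat (Suc k) * E (Suc k) q) p"
          using cpd_mult[OF rules p smooth_fun_on_const sE] by (simp add: cpd_const)
        also have "\<dots> = cpd c i (\<lambda>q. \<Sum>j\<in>{0..k}. E j q * (of_nat (Suc (k - j)) * (\<phi> $$ int (Suc (k - j))) q)) p"
          by (simp only: rec)
        also have "\<dots> = (\<Sum>j\<in>{0..k}. cpd c i (\<lambda>q. E j q * (of_nat (Suc (k - j)) * (\<phi> $$ int (Suc (k - j))) q)) p)"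
          by (rule cpd_sum[OF rules W_open p])
            (intro smooth_fun_on_mult[OF W_open] sE sa smooth_fun_on_const)
        also have "\<dots> = (\<Sum>j\<in>{0..k}. cpd c i (E j) p * (of_nat (Suc (k - j)) * (\<phi> $$ int (Suc (k - j))) p)
            + E j p * (of_nat (Suc (k - j)) * cpd c i (\<phi> $$ int (Suc (k - j))) p))"
        proof (rule sum.cong[OF refl])
          fix j
          have s: "smooth_fun_on A W (\<lambda>q. of_nat (Suc (k - j)) * (\<phi> $$ int (Suc (k - j))) q)"
            by (intro smooth_fun_on_mult[OF W_open] sa smooth_fun_on_const)
          show "cpd c i (\<lambda>q. E j q * (of_nat (Suc (k - j)) * (\<phi> $$ int (Suc (k - j))) q)) p =
            cpd c i (E j) p * (of_nat (Suc (k - j)) * (\<phi> $$ int (Suc (k - j))) p)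
            + E j p * (of_nat (Suc (k - j)) * cpd c i (\<phi> $$ int (Suc (k - j))) p)"
            unfolding cpd_mult[OF rules p sE s] cpd_mult[OF rules p smooth_fun_on_const sa]
            by (simp add: cpd_const)
        qed
        finally show "fps_deriv dE $ k = (dE * fps_deriv ?a + formal_exp ?a * fps_deriv da) $ k"
          by (simp add: dE_def da_def fps_mult_nth sum.distrib E_def regular_phase_def)
      qed
      then show ?thesis by (simp add: formal_exp_deriv algebra_simps)
    qed
    moreover have "(dE - formal_exp ?a * da) $ 0 = 0"
    proof -
      let ?g = "\<lambda>y. (\<phi> $$ 0) (chart_inv c y)"
      have "(?g has_derivative frechet_derivative ?g (at (snd c p))) (at (snd c p))"
        using differentiable_in_chart[OF sa rules p, of 0, unfolded comp_def frechet_derivative_works] by simp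
      then have d: "((\<lambda>y. exp (?g y)) has_derivative
          (\<lambda>v. exp (?g (snd c p)) * frechet_derivative ?g (at (snd c p)) v)) (at (snd c p))"
        by (rule has_derivative_compose) (use DERIV_exp in \<open>simp add: has_field_derivative_def\<close>)
      have "E 0 = (\<lambda>q. exp ((\<phi> $$ 0) q))" by (simp add: E_def formal_exp_nth_0 regular_phase_def fun_eq_iff)
      then have "cpd c i (E 0) p = exp ((\<phi> $$ 0) p) * cpd c i (\<phi> $$ 0) p"
        using pd_eqI[OF d, of i] rules by (simp add: cpd_eq pd_def)
      then show ?thesis by (simp add: dE_def da_def formal_exp_nth_0 regular_phase_def)
    qed
    ultimately have "dE - formal_exp ?a * da = 0" by (rule fps_linear_ode_unique)
    then show ?thesis by simp
  qed
  have d\<epsilon>: "cpd c i (\<epsilon> \<phi> $ k) p = (dE * fps_at dens p + formal_exp ?a * fps_at (d_density i) p) $ k" for k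
  proof -
    have "cpd c i (\<epsilon> \<phi> $ k) p = cpd c i (\<lambda>q. \<Sum>j\<in>{0..k}. E j q * (dens $ (k - j)) q) p"
      using p by (rule cpd_cut) (simp add: \<epsilon>_def amplitude_def fps_mult_nth E_def)
    also have "\<dots> = (\<Sum>j\<in>{0..k}. cpd c i (\<lambda>q. E j q * (dens $ (k - j)) q) p)"
      by (rule cpd_sum[OF rules W_open p]) (intro smooth_fun_on_mult[OF W_open] sE smooth_dens)
    also have "\<dots> = (\<Sum>j\<in>{0..k}. cpd c i (E j) p * (dens $ (k - j)) p + E j p * cpd c i (dens $ (k - j)) p)"
      by (intro sum.cong refl cpd_mult[OF rules p sE smooth_dens])
    finally show ?thesis by (simp add: dE_def fps_mult_nth sum.distrib E_def d_density_nth)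
  qed
  have \<beta>: "fps_at (\<beta> \<phi> i) p = da + fps_at (\<eta> i) p"
  proof (rule fps_ext)
    fix k
    have "cpd c i (cut (\<phi> $$ int k)) p = cpd c i (\<phi> $$ int k) p" using p by (rule cpd_cut) simp
    then show "fps_at (\<beta> \<phi> i) p $ k = (da + fps_at (\<eta> i) p) $ k" using p by (simp add: \<beta>_def da_def D_def)
  qed
  have "fps_at dens p * fps_at (\<eta> i) p = fps_at (d_density i) p"
    using dens_unit[OF p] by (simp add: \<eta>_at mult.left_commute[of "fps_at dens p"] mult.commute[of "fps_at dens p"])
  then have "fps_at (\<epsilon> \<phi> * \<beta> \<phi> i) p = dE * fps_at dens p + formal_exp ?a * fps_at (d_density i) p"
    unfolding fps_at_mult \<beta> \<epsilon>_at[OF p] amplitude_def dE by (simp add: algebra_simps)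
  then have "fps_at (\<epsilon> \<phi> * \<beta> \<phi> i) p $ k = cpd c i (\<epsilon> \<phi> $ k) p" by (simp only: d\<epsilon>)
  then show "D i (\<epsilon> \<phi> $ k) p = ((\<epsilon> \<phi> * \<beta> \<phi> i) $ k) p" using p by (simp add: D_def)
qed

lemma deriv_\<epsilon>: "fps_deriv (\<epsilon> \<phi>) = \<epsilon> \<phi> * \<tau> \<phi>"
proof (rule fps_ext, rule ext)
  fix k p
  show "(fps_deriv (\<epsilon> \<phi>) $ k) p = ((\<epsilon> \<phi> * \<tau> \<phi>) $ k) p"
  proof (cases "p \<in> W")
    case True
    have t: "fps_at (\<tau> \<phi>) p = fps_deriv (fps_at (regular_phase \<phi>) p) + fps_deriv (fps_at u p)"
      using True by (intro fps_ext) (simp add: \<tau>_def algebra_simps)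
    have "fps_deriv (fps_at (\<epsilon> \<phi>) p) = fps_at (\<epsilon> \<phi>) p * fps_at (\<tau> \<phi>) p"
      unfolding \<epsilon>_at[OF True] t amplitude_def dens_exp[OF True]
      by (simp add: formal_exp_deriv algebra_simps)
    then have "fps_at (fps_deriv (\<epsilon> \<phi>)) p $ k = fps_at (\<epsilon> \<phi> * \<tau> \<phi>) p $ k"
      by (simp only: fps_at_deriv fps_at_mult)
    then show ?thesis by (simp only: fps_at_nth)
  next
    case False
    then show ?thesis by (simp add: \<epsilon>_def fps_mult_nth sum_fun_apply cut_off)
  qed
qed

lemma \<epsilon>_leading: "(\<epsilon> \<phi> $ 0) x\<^sub>0 \<noteq> 0"
  using x0_in dens_nz[OF x0_in] by (simp add: \<epsilon>_def amplitude_def fps_mult_nth formal_exp_nth_0)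

lemma B_eq:
  assumes \<phi>: "formal_phase A x\<^sub>0 \<phi>"
  shows "B \<phi> i = fls_X_inv * fls_const (D i (\<psi> \<phi>)) + fps_to_fls (\<beta> \<phi> i)"
proof (rule fls_eqI)
  fix k :: int
  have z: "\<phi> $$ k = 0" if "k < - 1" for k :: int using \<phi> that by (simp add: formal_phase_def)
  consider "k < - 1" | "k = - 1" | "k \<ge> 0" by linarith
  then show "B \<phi> i $$ k = (fls_X_inv * fls_const (D i (\<psi> \<phi>)) + fps_to_fls (\<beta> \<phi> i)) $$ k"
    by cases (simp_all add: B_def z \<psi>_def \<beta>_def)
qed

lemma T_eq:
  assumes \<phi>: "formal_phase A x\<^sub>0 \<phi>" and F: "formal F"
  shows "T \<phi> * F = (fps_to_fls (\<tau> \<phi>) - fls_X_inv * (fls_X_inv * fls_const (\<psi> \<phi>))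
    - fls_const (cst (of_nat CARD('n) / 2)) * fls_X_inv) * F"
proof -
  have z: "\<phi> $$ k = 0" if "k < - 1" for k :: int using \<phi> that by (simp add: formal_phase_def)
  have "cut_fls (fls_deriv (\<phi> + fps_to_fls u)) = fps_to_fls (\<tau> \<phi>) - fls_X_inv * (fls_X_inv * fls_const (\<psi> \<phi>))"
  proof (rule fls_eqI)
    fix k :: int
    consider "k < - 2" | "k = - 2" | "k = - 1" | "k \<ge> 0" by linarith
    then show "cut_fls (fls_deriv (\<phi> + fps_to_fls u)) $$ k = (fps_to_fls (\<tau> \<phi>) - fls_X_inv * (fls_X_inv * fls_const (\<psi> \<phi>))) $$ k"
    proof cases
      case 4
      have "nat (k + 1) = Suc (nat k)" using 4 by simp
      then show ?thesis using 4
        by (simp add: \<tau>_def regular_phase_def) (rule cut_eqI, simp add: algebra_simps)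
    qed (simp_all add: z \<psi>_def cut_def fun_eq_iff)
  qed
  moreover have "fls_const e * F = F"
    using F by (intro fls_eqI) (simp add: formal_def)
  then have "(fls_X_inv * fls_const e) * F = fls_X_inv * F" by (simp add: mult.assoc)
  ultimately show ?thesis
    unfolding T_def by (simp add: left_diff_distrib mult.assoc)
qed

text \<open>The twisted stationary phase functional; its coefficients are functionals on the ring on \<open>W\<close> only
  and are replaced by the distributions that they determine.\<close>

lemma solution_exists:
  assumes \<phi>: "formal_phase A x\<^sub>0 \<phi>"
  obtains \<Lambda> a where "pd_family \<Lambda>" "a \<noteq> 0" "\<And>f. f \<in> R \<Longrightarrow> \<Lambda> 0 f = a * f x\<^sub>0"
    "closed_under (B \<phi>) \<Lambda>" "strong_local \<phi> \<Lambda>"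
proof -
  have s\<phi>: "smooth_phase \<phi>" by (rule formal_phase_smooth[OF \<phi>])
  obtain M where M: "M i j = M j i"
    "(\<Sum>l\<in>UNIV. D j (D l (\<psi> \<phi>)) x\<^sub>0 * M l i) = (if j = i then 1 else 0)" for i j
    by (rule phase_hessian(3)[OF \<phi>]) (rule that)
  interpret S: stationary_phase R D X e x\<^sub>0 "\<lambda>i j. D i (D j (\<psi> \<phi>)) x\<^sub>0" "\<lambda>i j. - (1/2) * M i j" "\<psi> \<phi>"
  proof
    show "- (1/2) * M i j = - (1/2) * M j i" for i j using M(1)[of i j] by simp
    show "D i (D j (\<psi> \<phi>)) x\<^sub>0 = D j (D i (\<psi> \<phi>)) x\<^sub>0" for i j
      using D_comm[OF \<psi>_in[OF s\<phi>], of i j] by simp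
    show "(\<Sum>l\<in>UNIV. D j (D l (\<psi> \<phi>)) x\<^sub>0 * (- (1/2) * M l i)) = (if j = i then - 1/2 else 0)" for i j
    proof -
      have "(\<Sum>l\<in>UNIV. D j (D l (\<psi> \<phi>)) x\<^sub>0 * (- (1/2) * M l i)) = - (1/2) * (\<Sum>l\<in>UNIV. D j (D l (\<psi> \<phi>)) x\<^sub>0 * M l i)"
        unfolding sum_distrib_left by (intro sum.cong refl) simp
      then show ?thesis unfolding M(2) by simp
    qed
  qed (use \<psi>_in[OF s\<phi>] phase_hessian(1,2)[OF \<phi>] in auto)
  define \<Lambda>0 where "\<Lambda>0 = twist (\<epsilon> \<phi>) S.phase_functional"
  note ex = S.twisted_phase_functional[where \<epsilon> = "\<epsilon> \<phi>" and \<beta> = "\<beta> \<phi>" and \<tau> = "\<tau> \<phi>",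
      OF \<epsilon>_in[OF s\<phi>] \<beta>_in[OF s\<phi>] \<tau>_in[OF s\<phi>] D_\<epsilon>[OF s\<phi>] deriv_\<epsilon>, folded \<Lambda>0_def]
  have "\<exists>L'. point_distribution A x\<^sub>0 L' \<and> (\<forall>f\<in>R. L' f = \<Lambda>0 r f)" for r
  proof -
    have "point_functional (\<Lambda>0 r)" using ex(1) by (simp add: point_family_def)
    then obtain L' where "point_distribution A x\<^sub>0 L'" "\<And>f. f \<in> R \<Longrightarrow> L' f = \<Lambda>0 r f"
      by (rule point_functional_realize) (rule that)
    then show ?thesis by (intro exI[of _ L']) simp
  qed
  then have "\<forall>r. \<exists>L'. point_distribution A x\<^sub>0 L' \<and> (\<forall>f\<in>R. L' f = \<Lambda>0 r f)" by (rule allI)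
  from choice[OF this] obtain \<Lambda> where \<Lambda>: "\<forall>r. point_distribution A x\<^sub>0 (\<Lambda> r) \<and> (\<forall>f\<in>R. \<Lambda> r f = \<Lambda>0 r f)"
    by (rule exE)
  have pd: "pd_family \<Lambda>" using \<Lambda> by (simp add: pd_family_def)
  have ap: "fd_apply \<Lambda> F = fd_apply \<Lambda>0 F" if "formal F" for F
    using that \<Lambda> by (intro fd_apply_cong_functional point_family_0[OF pd_family_point_family[OF pd]] point_family_0[OF ex(1)])
      (simp add: formal_def)
  have cl: "closed_under (B \<phi>) \<Lambda>"
    unfolding closed_under_def
  proof (intro allI impI)
    fix i F assume F: "formal F"
    have "formal (D_fls i F + B \<phi> i * F)"
      using F formal_B[OF s\<phi>] by (intro formal_add formal_mult formal_D)
    then show "fd_apply \<Lambda> (D_fls i F + B \<phi> i * F) = 0"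
      using ex(3) F unfolding closed_under_def B_eq[OF \<phi>, symmetric] by (simp add: ap)
  qed
  have st: "strong_local \<phi> \<Lambda>"
    unfolding strong_local_def
  proof (intro allI impI)
    fix F assume F: "formal F"
    have "formal (fls_deriv F + T \<phi> * F)"
      using F formal_T[OF s\<phi>] by (intro formal_add formal_mult formal_deriv)
    then show "fls_deriv (fd_apply \<Lambda> F) = fd_apply \<Lambda> (fls_deriv F + T \<phi> * F)"
      using ex(4)[OF F] F unfolding T_eq[OF \<phi> F, symmetric] by (simp add: ap)
  qed
  have lead: "\<Lambda> 0 f = (\<epsilon> \<phi> $ 0) x\<^sub>0 * f x\<^sub>0" if "f \<in> R" for f
    using \<Lambda> that ex(2) by simp
  show ?thesis by (rule that[OF pd \<epsilon>_leading lead cl st])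
qed

text \<open>Both conditions together: the FOI condition determines \<open>\<Lambda>'\<close> up to a factor \<open>b \<in> \<complex>[[\<nu>]]\<close>. Strong association of
  both shows \<open>(b g)' = b g'\<close> for \<open>g = \<Lambda>(1) \<noteq> 0\<close>, hence \<open>b' = 0\<close>.\<close>

lemma solution_unique:
  assumes \<phi>: "formal_phase A x\<^sub>0 \<phi>"
    and \<Lambda>: "pd_family \<Lambda>" "\<Lambda> 0 e \<noteq> 0" "closed_under (B \<phi>) \<Lambda>" "strong_local \<phi> \<Lambda>"
    and \<Lambda>': "pd_family \<Lambda>'" "foi_local \<phi> \<Lambda>'" "strong_local \<phi> \<Lambda>'"
  obtains a where "\<Lambda>' = (\<lambda>r f. a * \<Lambda> r f)"
proof -
  have s\<phi>: "smooth_phase \<phi>" by (rule formal_phase_smooth[OF \<phi>])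
  obtain M where M: "M i j = M j i"
    "(\<Sum>l\<in>UNIV. D j (D l (\<psi> \<phi>)) x\<^sub>0 * M l i) = (if j = i then 1 else 0)" for i j
    by (rule phase_hessian(3)[OF \<phi>]) (rule that)
  have inv: "(\<Sum>i\<in>UNIV. M j i * D i (D l (\<psi> \<phi>)) x\<^sub>0) = (if j = l then 1 else 0)" for j l
  proof -
    have "(\<Sum>i\<in>UNIV. M j i * D i (D l (\<psi> \<phi>)) x\<^sub>0) = (\<Sum>i\<in>UNIV. D l (D i (\<psi> \<phi>)) x\<^sub>0 * M i j)"
      by (intro sum.cong refl) (simp add: M(1)[of j] D_comm[OF \<psi>_in[OF s\<phi>], of l] mult.commute)
    then show ?thesis by (simp add: M(2) eq_commute)
  qed
  have Bm1: "B \<phi> i $$ (- 1) = D i (\<psi> \<phi>)" and Blow: "k < - 1 \<Longrightarrow> B \<phi> i $$ k = 0" for i k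
    by (simp_all add: B_eq[OF \<phi>])
  have pf: "point_family \<Lambda>" "point_family \<Lambda>'" by (rule pd_family_point_family, fact)+
  have cl: "fd_apply \<Lambda>' (fls_const (D i w) + B \<phi> i * fls_const w) = 0" if "w \<in> R" for i w
    using \<Lambda>'(2) that unfolding foi_local_def by blast
  obtain b where b: "\<And>r f. f \<in> R \<Longrightarrow> \<Lambda>' r f = fps_scale b \<Lambda> r f"
    by (rule closed_functional_unique[OF \<psi>_in[OF s\<phi>] phase_hessian(2)[OF \<phi>] inv formal_B[OF s\<phi>] Blow Bm1
          pf(1) \<Lambda>(3,2) pf(2) cl])
      (assumption, assumption, rule that)
  have ap: "fd_apply \<Lambda>' F = fps_to_fls b * fd_apply \<Lambda> F" if "formal F" for F
  proof -
    have "fd_apply \<Lambda>' F = fd_apply (fps_scale b \<Lambda>) F"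
      using that b by (intro fd_apply_cong_functional point_family_0[OF pf(2)] point_family_0[OF point_family_fps_scale[OF pf(1)]])
        (simp add: formal_def)
    then show ?thesis by (simp add: fd_apply_fps_scale[where \<Lambda> = \<Lambda>, OF point_family_0[OF pf(1)]])
  qed
  let ?F = "fls_const e"
  let ?g = "fd_apply \<Lambda> ?F"
  have F: "formal ?F" by (rule formal_const[OF e_in])
  have Q: "formal (fls_deriv ?F + T \<phi> * ?F)"
    using F formal_T[OF s\<phi>] by (intro formal_add formal_mult formal_deriv)
  have "fls_deriv (fps_to_fls b * ?g) = fps_to_fls b * fls_deriv ?g"
    unfolding ap[OF F, symmetric] \<Lambda>(4)[unfolded strong_local_def, rule_format, OF F]
      ap[OF Q, symmetric]
    by (rule \<Lambda>'(3)[unfolded strong_local_def, rule_format, OF F])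
  then have "fls_deriv (fps_to_fls b) * ?g = 0" by (simp only: fls_deriv_mult add_cancel_left_right)
  moreover have "?g $$ 0 = \<Lambda> 0 e"
  proof -
    have "\<forall>\<^sub>F m in sequentially. ?g $$ 0 = \<Lambda> 0 e"
      using fd_apply_nth_eventually[where \<Lambda> = \<Lambda> and F = ?F and k = 0, OF point_family_0[OF pf(1)]]
    proof eventually_elim
      case (elim m)
      have "(\<Sum>r\<le>m. \<Lambda> r (?F $$ (0 - int r))) = (\<Sum>r\<in>{0}. \<Lambda> r (?F $$ (0 - int r)))"
        by (rule sum.mono_neutral_right) (auto simp: point_family_0[OF pf(1)])
      then show ?case using elim by simp
    qed
    then show ?thesis by simp
  qed
  then have "?g \<noteq> 0" using \<Lambda>(2) by auto
  ultimately have "fls_deriv (fps_to_fls b) = 0" by (simp only: mult_eq_0_iff simp_thms)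
  then have "fps_deriv b = 0" by (simp only: fls_deriv_fps_to_fls fps_to_fls_eq_0_iff)
  then have "b = fps_const (b $ 0)" by (rule iffD1[OF fps_deriv_eq_0_iff])
  then obtain s where s: "b = fps_const s" by (rule that)
  have eq: "\<Lambda>' r = (\<lambda>f. s * \<Lambda> r f)" for r
  proof (rule point_distribution_eqI)
    show "point_distribution A x\<^sub>0 (\<Lambda>' r)" by (rule \<Lambda>'(1)[unfolded pd_family_def, rule_format])
    show "point_distribution A x\<^sub>0 (\<lambda>f. s * \<Lambda> r f)"
      by (rule point_distribution_scale[OF \<Lambda>(1)[unfolded pd_family_def, rule_format]])
    fix f assume f: "f \<in> R"
    show "\<Lambda>' r f = s * \<Lambda> r f" unfolding b[OF f] s fps_scale_const by (rule refl)
  qed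
  show ?thesis by (rule that[of s]) (rule ext, rule eq)
qed

end

section \<open>Strongly associated integrals and the jet of the phase\<close>

context foi_chart
begin

lemma fd_apply_scale: "point_family \<Lambda> \<Longrightarrow> fd_apply (\<lambda>r f. a * \<Lambda> r f) F = fls_const a * fd_apply \<Lambda> F"
  unfolding fps_scale_const[symmetric] by (simp add: fd_apply_fps_scale point_family_0)

lemma closed_under_scale:
  assumes "point_family \<Lambda>" "closed_under b \<Lambda>"
  shows "closed_under b (\<lambda>r f. a * \<Lambda> r f)"
  using assms by (simp add: closed_under_def fd_apply_scale)

lemma closed_under_imp_foi_local:
  assumes "closed_under (B \<phi>) \<Lambda>"
  shows "foi_local \<phi> \<Lambda>"
  unfolding foi_local_def
proof (intro allI ballI)
  fix i w assume w: "w \<in> R"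
  have "D_fls i (fls_const w) = fls_const (D i w)" by (rule fls_eqI) simp
  then show "fd_apply \<Lambda> (fls_const (D i w) + B \<phi> i * fls_const w) = 0"
    using assms[unfolded closed_under_def, rule_format, OF formal_const[OF w], of i] by simp
qed

lemma strongly_associated_scale:
  assumes \<phi>: "smooth_phase \<phi>" and a: "a \<noteq> 0" and \<Lambda>: "strongly_associated A x\<^sub>0 \<phi> \<rho> \<Lambda>"
  shows "strongly_associated A x\<^sub>0 \<phi> \<rho> (\<lambda>r f. a * \<Lambda> r f)"
proof -
  note l = \<Lambda>[unfolded strongly_associated_iff_local[OF \<phi>]]
  have pd: "pd_family \<Lambda>" and nz: "\<Lambda> 0 \<noteq> 0" and foi: "foi_local \<phi> \<Lambda>" and strong: "strong_local \<phi> \<Lambda>"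
    using l by blast+
  note ap = fd_apply_scale[OF pd_family_point_family[OF pd], of a]
  have "pd_family (\<lambda>r f. a * \<Lambda> r f)"
    unfolding pd_family_def
    by (rule allI, rule point_distribution_scale[OF pd[unfolded pd_family_def, rule_format]])
  moreover have "(\<lambda>f. a * \<Lambda> 0 f) \<noteq> 0"
  proof
    assume z: "(\<lambda>f. a * \<Lambda> 0 f) = 0"
    have "\<Lambda> 0 f = 0" for f using fun_cong[OF z, of f] a by simp
    then show False using nz by (simp add: fun_eq_iff)
  qed
  moreover have "foi_local \<phi> (\<lambda>r f. a * \<Lambda> r f)"
    unfolding foi_local_def
  proof (intro allI ballI)
    fix i w assume "w \<in> R"
    then have "fd_apply \<Lambda> (fls_const (D i w) + B \<phi> i * fls_const w) = 0"
      by (rule foi[unfolded foi_local_def, rule_format])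
    then show "fd_apply (\<lambda>r f. a * \<Lambda> r f) (fls_const (D i w) + B \<phi> i * fls_const w) = 0"
      unfolding ap by simp
  qed
  moreover have "strong_local \<phi> (\<lambda>r f. a * \<Lambda> r f)"
    unfolding strong_local_def
  proof (intro allI impI)
    fix F assume "formal F"
    then have "fls_deriv (fd_apply \<Lambda> F) = fd_apply \<Lambda> (fls_deriv F + T \<phi> * F)"
      by (rule strong[unfolded strong_local_def, rule_format])
    then show "fls_deriv (fd_apply (\<lambda>r f. a * \<Lambda> r f) F) = fd_apply (\<lambda>r f. a * \<Lambda> r f) (fls_deriv F + T \<phi> * F)"
      unfolding ap by (simp add: fls_deriv_mult)
  qed
  ultimately show ?thesis unfolding strongly_associated_iff_local[OF \<phi>] by blast
qed

lemma delta_point_distribution: "point_distribution A x\<^sub>0 (delta A x\<^sub>0)"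
  unfolding point_distribution_def
proof (intro bexI[OF _ c_in] conjI x0_dom exI[of _ "{[]}"] exI[of _ "\<lambda>_. 1"] allI)
  show "finite {[] :: 'n list}" by simp
  fix f :: "'m \<Rightarrow> complex"
  show "delta A x\<^sub>0 f = (if smooth_near A x\<^sub>0 f then \<Sum>is\<in>{[] :: 'n list}. 1 * chart_pds c is f x\<^sub>0 else 0)"
    using chart_inv_chart[OF c_in x0_dom] by (simp add: delta_def chart_pds_def)
qed

theorem normalized_solution:
  assumes \<phi>: "formal_phase A x\<^sub>0 \<phi>"
  obtains \<Lambda> where "strongly_associated A x\<^sub>0 \<phi> \<rho> \<Lambda>" "\<Lambda> 0 = delta A x\<^sub>0" "closed_under (B \<phi>) \<Lambda>"
    "\<And>\<Lambda>'. strongly_associated A x\<^sub>0 \<phi> \<rho> \<Lambda>' \<Longrightarrow> \<exists>a. a \<noteq> 0 \<and> \<Lambda>' = (\<lambda>r f. a * \<Lambda> r f)"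
proof -
  have s\<phi>: "smooth_phase \<phi>" by (rule formal_phase_smooth[OF \<phi>])
  obtain \<Lambda>1 b where pd1: "pd_family \<Lambda>1" and b: "b \<noteq> 0" and lead1: "\<And>f. f \<in> R \<Longrightarrow> \<Lambda>1 0 f = b * f x\<^sub>0"
    and cl1: "closed_under (B \<phi>) \<Lambda>1" and st1: "strong_local \<phi> \<Lambda>1"
    by (rule solution_exists[OF \<phi>]) (rule that)
  note pf1 = pd_family_point_family[OF pd1]
  have \<Lambda>1e: "\<Lambda>1 0 e \<noteq> 0" unfolding lead1[OF e_in] e_at using b by simp
  have "\<Lambda>1 0 \<noteq> 0" using \<Lambda>1e by (auto simp: fun_eq_iff)
  then have sa1: "strongly_associated A x\<^sub>0 \<phi> \<rho> \<Lambda>1"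
    unfolding strongly_associated_iff_local[OF s\<phi>]
    using pd1 st1 closed_under_imp_foi_local[OF cl1] by blast
  define \<Lambda> where "\<Lambda> = (\<lambda>r f. inverse b * \<Lambda>1 r f)"
  have \<Lambda>1: "\<Lambda>1 r f = b * \<Lambda> r f" for r f using b by (simp add: \<Lambda>_def)
  have sa: "strongly_associated A x\<^sub>0 \<phi> \<rho> \<Lambda>"
    unfolding \<Lambda>_def by (rule strongly_associated_scale[OF s\<phi> _ sa1]) (use b in simp)
  have cl: "closed_under (B \<phi>) \<Lambda>"
    unfolding \<Lambda>_def by (rule closed_under_scale[OF pf1 cl1])
  have \<Lambda>0: "\<Lambda> 0 = delta A x\<^sub>0"
  proof (rule point_distribution_eqI)
    show "point_distribution A x\<^sub>0 (\<Lambda> 0)"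
      unfolding \<Lambda>_def by (rule point_distribution_scale[OF pd1[unfolded pd_family_def, rule_format]])
    show "point_distribution A x\<^sub>0 (delta A x\<^sub>0)" by (rule delta_point_distribution)
    fix f assume f: "f \<in> R"
    show "\<Lambda> 0 f = delta A x\<^sub>0 f"
      using b R_near[OF f] by (simp add: \<Lambda>_def lead1[OF f] delta_def)
  qed
  have un: "\<exists>a. a \<noteq> 0 \<and> \<Lambda>' = (\<lambda>r f. a * \<Lambda> r f)" if sa': "strongly_associated A x\<^sub>0 \<phi> \<rho> \<Lambda>'" for \<Lambda>'
  proof -
    note l = sa'[unfolded strongly_associated_iff_local[OF s\<phi>]]
    have l': "pd_family \<Lambda>'" "\<Lambda>' 0 \<noteq> 0" "foi_local \<phi> \<Lambda>'" "strong_local \<phi> \<Lambda>'" using l by blast+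
    obtain a where a: "\<Lambda>' = (\<lambda>r f. a * \<Lambda>1 r f)"
      by (rule solution_unique[OF \<phi> pd1 \<Lambda>1e cl1 st1 l'(1,3,4)]) (rule that)
    have "a \<noteq> 0"
    proof
      assume "a = 0"
      then have "\<Lambda>' 0 = 0" by (simp add: a fun_eq_iff)
      then show False using l'(2) by simp
    qed
    then show ?thesis using b by (intro exI[of _ "a * b"]) (simp add: a \<Lambda>1 mult.assoc)
  qed
  show ?thesis by (rule that[OF sa \<Lambda>0 cl un])
qed

text \<open>By uniqueness \<open>\<Lambda>\<close> is a multiple of the constructed solutions for both phases, so that it is closed on all formal
  functions and has a multiple of the evaluation as its leading term. The differences of the coefficients \<open>B\<close> and \<open>T\<close>
  for the two phases then lie in the annihilator of \<open>\<Lambda>\<close> and are flat.\<close>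

lemma jet_determined:
  assumes \<phi>: "formal_phase A x\<^sub>0 \<phi>" and \<phi>': "formal_phase A x\<^sub>0 \<phi>'"
    and sa: "strongly_associated A x\<^sub>0 \<phi> \<rho> \<Lambda>" and sa': "strongly_associated A x\<^sub>0 \<phi>' \<rho> \<Lambda>"
  shows "\<exists>a. \<forall>c'\<in>A. x\<^sub>0 \<in> fst c' \<longrightarrow> full_jet c' x\<^sub>0 (\<phi> - \<phi>') = full_jet c' x\<^sub>0 (fls_const (\<lambda>_. a))"
proof -
  have s: "smooth_phase \<phi>" "smooth_phase \<phi>'" using formal_phase_smooth \<phi> \<phi>' by auto
  have l: "pd_family \<Lambda>" "strong_local \<phi> \<Lambda>" "strong_local \<phi>' \<Lambda>"
    using sa[unfolded strongly_associated_iff_local[OF s(1)]] sa'[unfolded strongly_associated_iff_local[OF s(2)]]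
    by blast+
  note pf = pd_family_point_family[OF l(1)]
  have sol: "\<exists>a. a \<noteq> 0 \<and> (\<forall>f\<in>R. \<Lambda> 0 f = a * f x\<^sub>0) \<and> closed_under (B \<chi>) \<Lambda>"
    if \<chi>: "formal_phase A x\<^sub>0 \<chi>" and sa\<chi>: "strongly_associated A x\<^sub>0 \<chi> \<rho> \<Lambda>" for \<chi>
  proof -
    obtain \<Lambda>1 where n: "strongly_associated A x\<^sub>0 \<chi> \<rho> \<Lambda>1" "\<Lambda>1 0 = delta A x\<^sub>0" "closed_under (B \<chi>) \<Lambda>1"
      "\<And>\<Lambda>'. strongly_associated A x\<^sub>0 \<chi> \<rho> \<Lambda>' \<Longrightarrow> \<exists>a. a \<noteq> 0 \<and> \<Lambda>' = (\<lambda>r f. a * \<Lambda>1 r f)"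
      by (rule normalized_solution[OF \<chi>]) (rule that)
    have "pd_family \<Lambda>1"
      using n(1) strongly_associated_iff_local[OF formal_phase_smooth[OF \<chi>]] by blast
    note pf1 = pd_family_point_family[OF this]
    from n(4)[OF sa\<chi>] obtain a where a: "a \<noteq> 0 \<and> \<Lambda> = (\<lambda>r f. a * \<Lambda>1 r f)" by (rule exE)
    have "closed_under (B \<chi>) \<Lambda>"
      unfolding a[THEN conjunct2] by (rule closed_under_scale[OF pf1 n(3)])
    moreover have "\<Lambda> 0 f = a * f x\<^sub>0" if "f \<in> R" for f
      unfolding a[THEN conjunct2] n(2) using R_near[OF that] by (simp add: delta_def)
    ultimately show ?thesis using a by (intro exI[of _ a]) simp
  qed
  from sol[OF \<phi> sa] obtain a where a: "a \<noteq> 0 \<and> (\<forall>f\<in>R. \<Lambda> 0 f = a * f x\<^sub>0) \<and> closed_under (B \<phi>) \<Lambda>"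
    by (rule exE)
  have lead: "\<And>f. f \<in> R \<Longrightarrow> \<Lambda> 0 f = a * f x\<^sub>0" and a0: "a \<noteq> 0" and cl: "closed_under (B \<phi>) \<Lambda>"
    using a by auto
  have cl': "closed_under (B \<phi>') \<Lambda>" using sol[OF \<phi>' sa'] by (elim exE conjE)
  note fB = formal_B[OF s(1)] formal_B[OF s(2)]
  note fT = formal_T[OF s(1)] formal_T[OF s(2)]
  have killB: "fd_apply \<Lambda> ((B \<phi> i - B \<phi>' i) * F) = 0" if F: "formal F" for i F
  proof -
    have "fd_apply \<Lambda> (D_fls i F + B \<phi> i * F) = fd_apply \<Lambda> ((D_fls i F + B \<phi>' i * F) + (B \<phi> i - B \<phi>' i) * F)"
      by (simp add: algebra_simps)
    also have "\<dots> = fd_apply \<Lambda> (D_fls i F + B \<phi>' i * F) + fd_apply \<Lambda> ((B \<phi> i - B \<phi>' i) * F)"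
      by (rule fd_apply_add[OF pf]) (intro formal_add formal_D formal_mult formal_diff fB F)+
    finally show ?thesis using cl cl' F unfolding closed_under_def by simp
  qed
  have killT: "fd_apply \<Lambda> ((T \<phi> - T \<phi>') * F) = 0" if F: "formal F" for F
  proof -
    have "fd_apply \<Lambda> (fls_deriv F + T \<phi> * F) = fd_apply \<Lambda> ((fls_deriv F + T \<phi>' * F) + (T \<phi> - T \<phi>') * F)"
      by (simp add: algebra_simps)
    also have "\<dots> = fd_apply \<Lambda> (fls_deriv F + T \<phi>' * F) + fd_apply \<Lambda> ((T \<phi> - T \<phi>') * F)"
      by (rule fd_apply_add[OF pf]) (intro formal_add formal_deriv formal_mult formal_diff fT F)+
    finally show ?thesis
      unfolding l(2,3)[unfolded strong_local_def, rule_format, OF F, symmetric] by simp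
  qed
  define g where "g k = cut (\<phi> $$ k) - cut (\<phi>' $$ k)" for k
  have gc: "cut (\<phi> $$ k) \<in> R" "cut (\<phi>' $$ k) \<in> R" for k
    using s by (auto intro: cut_in smooth_phase_on)
  have g: "g k \<in> R" for k unfolding g_def using gc[of k] by simp
  have flatB: "vanish n (D i (g k))" for n i k
  proof -
    have "vanish n ((B \<phi> i - B \<phi>' i) $$ k)"
      by (rule closed_functional_flat[OF pf lead a0 fB(1) cl formal_diff[OF fB] killB])
    moreover have "(B \<phi> i - B \<phi>' i) $$ k = D i (g k)"
      by (simp add: B_def g_def D_diff gc)
    ultimately show ?thesis by simp
  qed
  \<comment> \<open>the coefficient of order k - 1 of the derivative in nu is k times that of order k\<close>
  have flatT: "vanish n (g k)" if k: "k \<noteq> 0" for n k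
  proof -
    have "vanish n ((T \<phi> - T \<phi>') $$ (k - 1))"
      by (rule closed_functional_flat[OF pf lead a0 fB(1) cl formal_diff[OF fT] killT])
    moreover have "(T \<phi> - T \<phi>') $$ (k - 1) = cst (of_int k) * g k"
      by (rule ext) (simp add: T_def g_def cut_def algebra_simps)
    ultimately have v: "vanish n (cst (of_int k) * g k)" by (simp only:)
    have "vanish n (cst (inverse (of_int k)) * (cst (of_int k) * g k))"
      by (rule vanish_cst[OF _ v]) (use g in simp)
    moreover have "cst (inverse (of_int k)) * (cst (of_int k) * g k) = g k"
      using k by (simp add: fun_eq_iff)
    ultimately show ?thesis by simp
  qed
  define a' where "a' = g 0 x\<^sub>0"
  \<comment> \<open>of order 0 only the derivatives are flat, so that the value at the point survives as the constant\<close>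
  have flat: "cut ((\<phi> - \<phi>') $$ k) - cut (fls_const (cst a') $$ k) \<in> R \<and>
      vanish n (cut ((\<phi> - \<phi>') $$ k) - cut (fls_const (cst a') $$ k))" for k n
  proof (cases "k = 0")
    case True
    have eq: "cut ((\<phi> - \<phi>') $$ k) - cut (fls_const (cst a') $$ k) = g 0 - cst a' * e"
      using True by (simp add: fun_eq_iff g_def e_def cut_def)
    have "vanish (Suc n) (g 0 - cst a' * e)"
      using flatB g by (simp add: D_diff D_cst a'_def e_at)
    then show ?thesis unfolding eq using g vanish_Suc_imp by simp
  next
    case False
    have eq: "cut ((\<phi> - \<phi>') $$ k) - cut (fls_const (cst a') $$ k) = g k"
      using False by (simp add: fun_eq_iff g_def cut_def)
    show ?thesis unfolding eq using g flatT[OF False] by simp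
  qed
  have "full_jet c' x\<^sub>0 (\<phi> - \<phi>') k is = full_jet c' x\<^sub>0 (fls_const (cst a')) k is"
    if c': "c' \<in> A" "x\<^sub>0 \<in> fst c'" for c' k "is"
  proof -
    let ?P = "(\<phi> - \<phi>') $$ k" and ?Q = "fls_const (cst a') $$ k"
    let ?L = "\<lambda>f :: 'm \<Rightarrow> complex. chart_pds c' is f x\<^sub>0"
    note L = point_functional_chart_pds[OF c', of "is"]
    have Q: "cut ?Q \<in> R"
      by (cases "k = 0") (auto intro!: cut_in smooth_fun_on_const)
    have "?L (cut ?P - cut ?Q) = 0"
      by (rule point_functional_flat[OF L]) (use flat in auto)
    moreover have "?L ((cut ?P - cut ?Q) + cut ?Q) = ?L (cut ?P - cut ?Q) + ?L (cut ?Q)"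
      by (rule point_functional_add[OF L flat[THEN conjunct1] Q])
    ultimately have "?L (cut ?P) = ?L (cut ?Q)" by (simp only: diff_add_cancel add_0_left)
    then have "?L ?P = ?L ?Q" unfolding chart_pds_cong[OF c' cut_germ] .
    then show ?thesis by (simp only: full_jet_def jet_def)
  qed
  then show ?thesis by (intro exI[of _ a'] ballI impI ext) simp
qed

end

theorem theorem4p1:
  fixes A :: "('m::{t2_space, second_countable_topology}, 'n::finite) chart set"
    and x\<^sub>0 :: 'm
    and \<phi> :: "('m \<Rightarrow> complex) fls"
    and \<rho> :: "('m, 'n) top_form fps"
  assumes "oriented_atlas A"
    and "formal_phase A x\<^sub>0 \<phi>"
    and "formal_volume A x\<^sub>0 \<rho>"
  shows "(\<exists>\<Lambda>. strongly_associated A x\<^sub>0 \<phi> \<rho> \<Lambda> \<and>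
            (\<forall>\<Lambda>'. strongly_associated A x\<^sub>0 \<phi> \<rho> \<Lambda>' \<longleftrightarrow>
               (\<exists>a::complex. a \<noteq> 0 \<and> \<Lambda>' = (\<lambda>r f. a * \<Lambda> r f)))) \<and>
         (\<exists>!\<Lambda>. strongly_associated A x\<^sub>0 \<phi> \<rho> \<Lambda> \<and> \<Lambda> 0 = delta A x\<^sub>0) \<and>
         (\<forall>\<Lambda> \<psi>. strongly_associated A x\<^sub>0 \<phi> \<rho> \<Lambda> \<longrightarrow> formal_phase A x\<^sub>0 \<psi> \<longrightarrow>
            strongly_associated A x\<^sub>0 \<psi> \<rho> \<Lambda> \<longrightarrow>
            (\<exists>a::complex. \<forall>c\<in>A. x\<^sub>0 \<in> fst c \<longrightarrow>
               full_jet c x\<^sub>0 (\<phi> - \<psi>) = full_jet c x\<^sub>0 (fls_const (\<lambda>_. a))))"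
proof -
  interpret manifold A by unfold_locales (rule assms(1))
  obtain c where c: "c \<in> A" "x\<^sub>0 \<in> fst c" using chart_ex by blast
  have tf: "top_form A (\<rho> $ r)" for r using assms(3) by (simp add: formal_volume_def)
  define G where "G = Abs_fps (\<lambda>r. (\<rho> $ r) c)"
  have G_smooth: "smooth_fun_on A (fst c) (G $ k)" for k
    using tf[of k] c(1) by (simp add: G_def top_form_def)
  have G0: "(G $ 0) x\<^sub>0 \<noteq> 0" using assms(3) c by (simp add: G_def formal_volume_def)
  obtain W u where W: "open W" "x\<^sub>0 \<in> W" "W \<subseteq> fst c"
    and u: "\<And>k. smooth_fun_on A W (u $ k)" "\<And>p. p \<in> W \<Longrightarrow> fps_at G p = formal_exp (fps_at u p)"
    by (rule formal_log_exists[OF open_dom[OF c(1)] c(2) G_smooth G0]) (rule that)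
  have "fps_at G p = form_at \<rho> c p" for p by (rule fps_ext) (simp add: G_def form_at_def)
  then have ld: "log_density A \<rho> c W u"
    unfolding log_density_def using c(1) W u by (simp add: fps_at_def)
  interpret foi_chart A c W x\<^sub>0 \<rho> u
    by unfold_locales (use c W tf ld in auto)
  note s\<phi> = formal_phase_smooth[OF assms(2)]
  obtain \<Lambda> where \<Lambda>: "strongly_associated A x\<^sub>0 \<phi> \<rho> \<Lambda>" "\<Lambda> 0 = delta A x\<^sub>0"
    and un: "\<And>\<Lambda>'. strongly_associated A x\<^sub>0 \<phi> \<rho> \<Lambda>' \<Longrightarrow> \<exists>a. a \<noteq> 0 \<and> \<Lambda>' = (\<lambda>r f. a * \<Lambda> r f)"
    by (rule normalized_solution[OF assms(2)]) (rule that)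
  show ?thesis
  proof (intro conjI allI impI)
    show "\<exists>\<Lambda>. strongly_associated A x\<^sub>0 \<phi> \<rho> \<Lambda> \<and>
        (\<forall>\<Lambda>'. strongly_associated A x\<^sub>0 \<phi> \<rho> \<Lambda>' \<longleftrightarrow> (\<exists>a::complex. a \<noteq> 0 \<and> \<Lambda>' = (\<lambda>r f. a * \<Lambda> r f)))"
    proof (intro exI[of _ \<Lambda>] conjI allI iffI)
      show "strongly_associated A x\<^sub>0 \<phi> \<rho> \<Lambda>" by (rule \<Lambda>)
      show "\<exists>a. a \<noteq> 0 \<and> \<Lambda>' = (\<lambda>r f. a * \<Lambda> r f)" if "strongly_associated A x\<^sub>0 \<phi> \<rho> \<Lambda>'" for \<Lambda>'
        using that by (rule un)
      fix \<Lambda>' assume "\<exists>a. a \<noteq> 0 \<and> \<Lambda>' = (\<lambda>r f. a * \<Lambda> r f)"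
      then obtain a where a: "a \<noteq> 0 \<and> \<Lambda>' = (\<lambda>r f. a * \<Lambda> r f)" by (rule exE)
      show "strongly_associated A x\<^sub>0 \<phi> \<rho> \<Lambda>'"
        unfolding a[THEN conjunct2] by (rule strongly_associated_scale[OF s\<phi> a[THEN conjunct1] \<Lambda>(1)])
    qed
    show "\<exists>!\<Lambda>. strongly_associated A x\<^sub>0 \<phi> \<rho> \<Lambda> \<and> \<Lambda> 0 = delta A x\<^sub>0"
    proof (rule ex1I[of _ \<Lambda>])
      show "strongly_associated A x\<^sub>0 \<phi> \<rho> \<Lambda> \<and> \<Lambda> 0 = delta A x\<^sub>0" using \<Lambda> by blast
      fix \<Lambda>' assume \<Lambda>': "strongly_associated A x\<^sub>0 \<phi> \<rho> \<Lambda>' \<and> \<Lambda>' 0 = delta A x\<^sub>0"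
      from un[OF \<Lambda>'[THEN conjunct1]] obtain a where a: "a \<noteq> 0 \<and> \<Lambda>' = (\<lambda>r f. a * \<Lambda> r f)" by (rule exE)
      have d: "delta A x\<^sub>0 e = 1" using R_near[OF e_in] e_at by (simp add: delta_def)
      have "\<Lambda>' 0 e = a * \<Lambda> 0 e" unfolding a[THEN conjunct2] by (rule refl)
      then have "a = 1" unfolding \<Lambda>'[THEN conjunct2] \<Lambda>(2) d by simp
      then show "\<Lambda>' = \<Lambda>" unfolding a[THEN conjunct2] by simp
    qed
  next
    fix \<Lambda> \<psi>
    assume "strongly_associated A x\<^sub>0 \<phi> \<rho> \<Lambda>" "formal_phase A x\<^sub>0 \<psi>" "strongly_associated A x\<^sub>0 \<psi> \<rho> \<Lambda>"
    then show "\<exists>a::complex. \<forall>c\<in>A. x\<^sub>0 \<in> fst c \<longrightarrow>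
        full_jet c x\<^sub>0 (\<phi> - \<psi>) = full_jet c x\<^sub>0 (fls_const (\<lambda>_. a))"
      by (intro jet_determined[OF assms(2)])
  qed
qed

end
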